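(* Let $\Phi$ be a Bochner measurable linear RDS on a Banach space $X$ over a measure-preserving dynamical system $(\Omega,\mathcal F,\mathbb P,\theta)$ with time $\mathbb R$, exhibiting an $\alpha$-trichotomy with bounds $\alpha=(\alpha^c,\alpha^s,\alpha^u)$ and associated projections $P^c,P^s,P^u$, and let $f\in\mathscr F^{(B)}_\alpha$. Suppose that $\Psi$ is a Bochner measurable RDS on $X$ over $(\Omega,\mathcal F,\mathbb P,\theta)$ such that, for all $(\omega,x)\in\Omega\times X$, $\Psi(\cdot,\omega,x)$ is the unique solution of $$u(t)=\Phi_\omega^t x+\int_0^t\Phi_{\theta^r\omega}^{t-r}f_{\theta^r\omega}(u(r))\,dr,\qquad t\in\mathbb R.$$ If $$\lim_{t\to-\infty}\alpha^s_{-t,\theta^t\omega}\,\alpha^c_{t,\omega}=\lim_{t\to+\infty}\alpha^u_{-t,\theta^t\omega}\,\alpha^c_{t,\omega}=0\quad\text{for all }\omega\in\Omega$$ and $\sigma+\tau<1/2$, then there are $N\in\,]0,1[$ and a unique $\varphi\in\mathfrak D^{(B)}_N$ such that $$\Psi^t_\omega(\Gamma_{\varphi,\omega})\subseteq\Gamma_{\varphi,\theta^t\omega}\quad\text{for all }(t,\omega)\in\mathbb R\times\Omega.$$ Moreover, for all $(t,\omega)\in\mathbb R\times\Omega$ and all $\xi,\xi'\in E^c_\omega$, $$\|\Psi^t_\omega(\xi,\varphi_\omega(\xi))-\Psi^t_\omega(\xi',\varphi_\omega(\xi'))\|\le\frac{N}{\tau}\,\alpha^c_{t,\omega}\,\|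\xi-\xi'\|.$$
   Context: Measure-preserving dynamical system (time $\mathbb R$): $(\Omega,\mathcal F,\mathbb P)$ is a measure space, $\theta:\mathbb R\times\Omega\to\Omega$ is measurable, each $\theta^t=\theta(t,\cdot)$ preserves $\mathbb P$, $\theta^0=\mathrm{Id}$, $\theta^{t+s}=\theta^t\circ\theta^s$. A Bochner measurable RDS on $X$ is a map $\Phi:\mathbb R\times\Omega\times X\to X$ such that $\Phi(\cdot,\cdot,x)$ is Bochner measurable for every $x\in X$ and $\Phi^t_\omega=\Phi(t,\omega,\cdot)$ satisfies $\Phi^0_\omega=\mathrm{Id}_X$, $\Phi^{t+s}_\omega=\Phi^t_{\theta^s\omega}\circ\Phi^s_\omega$ for all $s,t\in\mathbb R$, $\omega\in\Omega$. It is linear if every $\Phi^t_\omega$ is a bounded linear operator. $\alpha$-trichotomy: let $\alpha^c:\mathbb R\times\Omega\to(0,\infty)$, $\alpha^s:[0,\infty)\times\Omega\to(0,\infty)$, $\alpha^u:(-\infty,0]\times\Omega\to(0,\infty)$, and write $\alpha^i_{t,\omega}=\alpha^i(t,\omega)$. A Bochner measurable linear RDS $\Phi$ exhibits an $\alpha$-trichotomy if there are maps $P^i:\Omega\times X\to X$, $i\in\{c,s,u\}$, $P^i_\omega=P^i(\omega,\cdot)$, such that: $P^i(\cdot,x)$ is Bochner measurable for all $x$; each $P^i_\omega$ is a bounded linear projection; $P^c_\omega+P^s_\omega+P^u_\omega=\mathrm{Id}$; $P^c_\omega P^s_\omega=0$; $P^i_{\theta^t\omega}\Phi^t_\omega=\Phi^t_\omega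 P^i_\omega$ for all $t\in\mathbb R$, $\omega\in\Omega$; and $\|\Phi^t_\omega P^c_\omega\|\le\alpha^c_{t,\omega}$ for $t\in\mathbb R$, $\|\Phi^t_\omega P^s_\omega\|\le\alpha^s_{t,\omega}$ for $t\ge0$, $\|\Phi^t_\omega P^u_\omega\|\le\alpha^u_{t,\omega}$ for $t\le0$, for all $\omega$. Put $E^i_\omega=P^i_\omega(X)$ and identify $E^c_\omega\times E^s_\omega\times E^u_\omega$ with $E^c_\omega\oplus E^s_\omega\oplus E^u_\omega=X$; thus $(\xi,\eta)$ with $\xi\in E^c_\omega$, $\eta\in E^s_\omega\oplus E^u_\omega$ denotes $\xi+\eta$. $\mathscr F^{(B)}_\alpha$ is the set of maps $f:\Omega\times X\to X$, $f_\omega=f(\omega,\cdot)$, such that $f(\cdot,x)$ is Bochner measurable for all $x\in X$; $f_\omega(0)=0$ and the Lipschitz constant $\mathrm{Lip}(f_\omega)$ is finite for all $\omega$; and for every $\omega\in\Omega$, $a<b$, $c<0$, $d>0$, $t\in\mathbb R$ the functions $[a,b]\ni r\mapsto\alpha^c_{t-r,\theta^r\omega}\mathrm{Lip}(f_{\theta^r\omega})\alpha^c_{r,\omega}$, $[c,0]\ni r\mapsto\alpha^s_{-r,\theta^r\omega}\mathrm{Lip}(f_{\theta^r\omega})\alpha^c_{r,\omega}$ and $[0,d]\ni r\mapsto\alpha^u_{-r,\theta^r\omega}\mathrm{Lip}(f_{\theta^r\omega})\alpha^c_{r,\omega}$ are measurable. Constants: $$\sigma=\sup_{(t,\omega)\in\mathbb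 R\times\Omega}\frac1{\alpha^c_{t,\omega}}\left|\int_0^t\alpha^c_{t-r,\theta^r\omega}\mathrm{Lip}(f_{\theta^r\omega})\alpha^c_{r,\omega}\,dr\right|,$$ $$\tau=\sup_{\omega\in\Omega}\left(\int_{-\infty}^0\alpha^s_{-r,\theta^r\omega}\mathrm{Lip}(f_{\theta^r\omega})\alpha^c_{r,\omega}\,dr+\int_0^{+\infty}\alpha^u_{-r,\theta^r\omega}\mathrm{Lip}(f_{\theta^r\omega})\alpha^c_{r,\omega}\,dr\right).$$ For $N>0$, $\mathfrak D^{(B)}_N$ is the set of maps $\varphi:\{(\omega,\xi)\in\Omega\times X:\xi\in E^c_\omega\}\to X$, $\varphi_\omega=\varphi(\omega,\cdot)$, such that $\omega\mapsto\varphi(\omega,P^c_\omega x)$ is Bochner measurable for all $x\in X$; $\varphi_\omega(0)=0$; $\varphi_\omega(E^c_\omega)\subseteq E^s_\omega\oplus E^u_\omega$; and $\|\varphi_\omega(\xi)-\varphi_\omega(\xi')\|\le N\|\xi-\xi'\|$ for all $\omega$ and $\xi,\xi'\in E^c_\omega$. Its graph at $\omega$ is $\Gamma_{\varphi,\omega}=\{(\xi,\varphi_\omega(\xi)):\xi\in E^c_\omega\}\subseteq X$. *)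

theory Defs
  imports "HOL-Analysis.Analysis"
begin

text \<open>Pointwise (everywhere) limit of a sequence of measurable functions with finite range.
  The Borel measurability of the library would be too weak, as the Banach space need not be
  separable.\<close>

definition bochner_measurable :: "'a measure \<Rightarrow> ('a \<Rightarrow> 'x::real_normed_vector) \<Rightarrow> bool" where
  "bochner_measurable M f \<longleftrightarrow>
     (\<exists>s. (\<forall>i. simple_function M (s i)) \<and> (\<forall>a\<in>space M. (\<lambda>i. s i a) \<longlonglongrightarrow> f a))"

text \<open>The library predicate \<open>has_bochner_integral\<close> is restricted to second countable
  types; this is the same definition for arbitrary normed spaces. The approximation of \<open>f\<close> in mean
  by simple functions makes \<open>f\<close> almost separably valued.\<close>

definition has_bochner_int :: "'a measure \<Rightarrow> ('a \<Rightarrow> 'x::real_normed_vector) \<Rightarrow> 'x \<Rightarrow> bool" where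
  "has_bochner_int M f v \<longleftrightarrow> f \<in> borel_measurable M \<and>
     (\<exists>s. (\<forall>i. Bochner_Integration.simple_bochner_integrable M (s i)) \<and>
          (\<lambda>i. \<integral>\<^sup>+a. ennreal (norm (f a - s i a)) \<partial>M) \<longlonglongrightarrow> 0 \<and>
          (\<lambda>i. Bochner_Integration.simple_bochner_integral M (s i)) \<longlonglongrightarrow> v)"

definition has_oriented_int :: "(real \<Rightarrow> 'x::real_normed_vector) \<Rightarrow> real \<Rightarrow> real \<Rightarrow> 'x \<Rightarrow> bool" where
  "has_oriented_int g a b v \<longleftrightarrow>
     (if a \<le> b then has_bochner_int (lebesgue_on {a..b}) g v
      else has_bochner_int (lebesgue_on {b..a}) g (- v))"

text \<open>Best Lipschitz constant; only meaningful for Lipschitz maps.\<close>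

definition Lip :: "('x::metric_space \<Rightarrow> 'y::metric_space) \<Rightarrow> real" where
  "Lip g = Inf {L. L-lipschitz_on UNIV g}"

text \<open>\<open>\<Omega>\<close> is \<^term>\<open>space M\<close>; the values of all maps outside of it are irrelevant.\<close>

definition measure_preserving_ds :: "'w measure \<Rightarrow> (real \<Rightarrow> 'w \<Rightarrow> 'w) \<Rightarrow> bool" where
  "measure_preserving_ds M \<theta> \<longleftrightarrow>
     (\<lambda>(t, \<omega>). \<theta> t \<omega>) \<in> (borel \<Otimes>\<^sub>M M) \<rightarrow>\<^sub>M M \<and>
     (\<forall>t. distr M M (\<theta> t) = M) \<and>
     (\<forall>\<omega>\<in>space M. \<theta> 0 \<omega> = \<omega>) \<and>
     (\<forall>t s. \<forall>\<omega>\<in>space M. \<theta> (t + s) \<omega> = \<theta> t (\<theta> s \<omega>))"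

definition bochner_rds ::
    "'w measure \<Rightarrow> (real \<Rightarrow> 'w \<Rightarrow> 'w) \<Rightarrow> (real \<Rightarrow> 'w \<Rightarrow> 'x \<Rightarrow> 'x::real_normed_vector) \<Rightarrow> bool" where
  "bochner_rds M \<theta> \<Phi> \<longleftrightarrow>
     (\<forall>x. bochner_measurable (borel \<Otimes>\<^sub>M M) (\<lambda>(t, \<omega>). \<Phi> t \<omega> x)) \<and>
     (\<forall>\<omega>\<in>space M. \<Phi> 0 \<omega> = id) \<and>
     (\<forall>s t. \<forall>\<omega>\<in>space M. \<Phi> (t + s) \<omega> = \<Phi> t (\<theta> s \<omega>) \<circ> \<Phi> s \<omega>)"

definition bochner_linear_rds ::
    "'w measure \<Rightarrow> (real \<Rightarrow> 'w \<Rightarrow> 'w) \<Rightarrow> (real \<Rightarrow> 'w \<Rightarrow> 'x \<Rightarrow> 'x::real_normed_vector) \<Rightarrow> bool" where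
  "bochner_linear_rds M \<theta> \<Phi> \<longleftrightarrow>
     bochner_rds M \<theta> \<Phi> \<and> (\<forall>t. \<forall>\<omega>\<in>space M. bounded_linear (\<Phi> t \<omega>))"

definition bochner_projections ::
    "'w measure \<Rightarrow> ('w \<Rightarrow> 'x \<Rightarrow> 'x::real_normed_vector) \<Rightarrow> bool" where
  "bochner_projections M P \<longleftrightarrow>
     (\<forall>x. bochner_measurable M (\<lambda>\<omega>. P \<omega> x)) \<and>
     (\<forall>\<omega>\<in>space M. bounded_linear (P \<omega>) \<and> P \<omega> \<circ> P \<omega> = P \<omega>)"

text \<open>The bounds \<open>\<alpha>s\<close> and \<open>\<alpha>u\<close> are total functions, but are only constrained at times
  \<open>t \<ge> 0\<close> and \<open>t \<le> 0\<close>, respectively.\<close>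

definition trichotomy ::
    "'w measure \<Rightarrow> (real \<Rightarrow> 'w \<Rightarrow> 'w) \<Rightarrow> (real \<Rightarrow> 'w \<Rightarrow> 'x \<Rightarrow> 'x::real_normed_vector) \<Rightarrow>
     (real \<Rightarrow> 'w \<Rightarrow> real) \<Rightarrow> (real \<Rightarrow> 'w \<Rightarrow> real) \<Rightarrow> (real \<Rightarrow> 'w \<Rightarrow> real) \<Rightarrow>
     ('w \<Rightarrow> 'x \<Rightarrow> 'x) \<Rightarrow> ('w \<Rightarrow> 'x \<Rightarrow> 'x) \<Rightarrow> ('w \<Rightarrow> 'x \<Rightarrow> 'x) \<Rightarrow> bool" where
  "trichotomy M \<theta> \<Phi> \<alpha>c \<alpha>s \<alpha>u Pc Ps Pu \<longleftrightarrow>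
     (\<forall>t. \<forall>\<omega>\<in>space M. 0 < \<alpha>c t \<omega>) \<and>
     (\<forall>t\<ge>0. \<forall>\<omega>\<in>space M. 0 < \<alpha>s t \<omega>) \<and>
     (\<forall>t\<le>0. \<forall>\<omega>\<in>space M. 0 < \<alpha>u t \<omega>) \<and>
     (\<forall>P\<in>{Pc, Ps, Pu}. bochner_projections M P) \<and>
     (\<forall>\<omega>\<in>space M. \<forall>x. Pc \<omega> x + Ps \<omega> x + Pu \<omega> x = x) \<and>
     (\<forall>\<omega>\<in>space M. \<forall>x. Pc \<omega> (Ps \<omega> x) = 0) \<and>
     (\<forall>P\<in>{Pc, Ps, Pu}. \<forall>t. \<forall>\<omega>\<in>space M. P (\<theta> t \<omega>) \<circ> \<Phi> t \<omega> = \<Phi> t \<omega> \<circ> P \<omega>) \<and>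
     (\<forall>t. \<forall>\<omega>\<in>space M. onorm (\<Phi> t \<omega> \<circ> Pc \<omega>) \<le> \<alpha>c t \<omega>) \<and>
     (\<forall>t\<ge>0. \<forall>\<omega>\<in>space M. onorm (\<Phi> t \<omega> \<circ> Ps \<omega>) \<le> \<alpha>s t \<omega>) \<and>
     (\<forall>t\<le>0. \<forall>\<omega>\<in>space M. onorm (\<Phi> t \<omega> \<circ> Pu \<omega>) \<le> \<alpha>u t \<omega>)"

definition perturbations ::
    "'w measure \<Rightarrow> (real \<Rightarrow> 'w \<Rightarrow> 'w) \<Rightarrow>
     (real \<Rightarrow> 'w \<Rightarrow> real) \<Rightarrow> (real \<Rightarrow> 'w \<Rightarrow> real) \<Rightarrow> (real \<Rightarrow> 'w \<Rightarrow> real) \<Rightarrow>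
     ('w \<Rightarrow> 'x \<Rightarrow> 'x::real_normed_vector) set" where
  "perturbations M \<theta> \<alpha>c \<alpha>s \<alpha>u =
     {f. (\<forall>x. bochner_measurable M (\<lambda>\<omega>. f \<omega> x)) \<and>
         (\<forall>\<omega>\<in>space M. f \<omega> 0 = 0 \<and> (\<exists>L. L-lipschitz_on UNIV (f \<omega>))) \<and>
         (\<forall>\<omega>\<in>space M. \<forall>t a b. a < b \<longrightarrow>
            (\<lambda>r. \<alpha>c (t - r) (\<theta> r \<omega>) * Lip (f (\<theta> r \<omega>)) * \<alpha>c r \<omega>)
              \<in> borel_measurable (lebesgue_on {a..b})) \<and>
         (\<forall>\<omega>\<in>space M. \<forall>c<0.
            (\<lambda>r. \<alpha>s (- r) (\<theta> r \<omega>) * Lip (f (\<theta> r \<omega>)) * \<alpha>c r \<omega>)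
              \<in> borel_measurable (lebesgue_on {c..0})) \<and>
         (\<forall>\<omega>\<in>space M. \<forall>d>0.
            (\<lambda>r. \<alpha>u (- r) (\<theta> r \<omega>) * Lip (f (\<theta> r \<omega>)) * \<alpha>c r \<omega>)
              \<in> borel_measurable (lebesgue_on {0..d}))}"

text \<open>The integrand is nonnegative, so the absolute value of its integral from \<open>0\<close> to \<open>t\<close>
  is its integral over the interval with these end points. Both constants may be infinite. Being
  extended nonnegative reals, they also make the quotient \<open>N / \<tau>\<close> infinite, not \<open>0\<close>, if
  \<open>\<tau> = 0 < N\<close>.\<close>

definition sigma_const ::
    "'w measure \<Rightarrow> (real \<Rightarrow> 'w \<Rightarrow> 'w) \<Rightarrow> (real \<Rightarrow> 'w \<Rightarrow> real) \<Rightarrow>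
     ('w \<Rightarrow> 'x \<Rightarrow> 'x::real_normed_vector) \<Rightarrow> ennreal" where
  "sigma_const M \<theta> \<alpha>c f =
     (SUP (t, \<omega>) \<in> UNIV \<times> space M.
        ennreal (1 / \<alpha>c t \<omega>) *
        (\<integral>\<^sup>+ r \<in> {min 0 t..max 0 t}.
           ennreal (\<alpha>c (t - r) (\<theta> r \<omega>) * Lip (f (\<theta> r \<omega>)) * \<alpha>c r \<omega>) \<partial>lebesgue))"

definition tau_const ::
    "'w measure \<Rightarrow> (real \<Rightarrow> 'w \<Rightarrow> 'w) \<Rightarrow>
     (real \<Rightarrow> 'w \<Rightarrow> real) \<Rightarrow> (real \<Rightarrow> 'w \<Rightarrow> real) \<Rightarrow> (real \<Rightarrow> 'w \<Rightarrow> real) \<Rightarrow>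
     ('w \<Rightarrow> 'x \<Rightarrow> 'x::real_normed_vector) \<Rightarrow> ennreal" where
  "tau_const M \<theta> \<alpha>c \<alpha>s \<alpha>u f =
     (SUP \<omega> \<in> space M.
        (\<integral>\<^sup>+ r \<in> {..0}. ennreal (\<alpha>s (- r) (\<theta> r \<omega>) * Lip (f (\<theta> r \<omega>)) * \<alpha>c r \<omega>) \<partial>lebesgue) +
        (\<integral>\<^sup>+ r \<in> {0..}. ennreal (\<alpha>u (- r) (\<theta> r \<omega>) * Lip (f (\<theta> r \<omega>)) * \<alpha>c r \<omega>) \<partial>lebesgue))"

text \<open>Being a solution includes the Bochner integrability of the integrand between \<open>0\<close> and every
  \<open>t\<close>; no other regularity of \<open>u\<close> is required.\<close>

definition mild_solution ::
    "(real \<Rightarrow> 'w \<Rightarrow> 'w) \<Rightarrow> (real \<Rightarrow> 'w \<Rightarrow> 'x \<Rightarrow> 'x::real_normed_vector) \<Rightarrow> ('w \<Rightarrow> 'x \<Rightarrow> 'x) \<Rightarrow>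
     'w \<Rightarrow> 'x \<Rightarrow> (real \<Rightarrow> 'x) \<Rightarrow> bool" where
  "mild_solution \<theta> \<Phi> f \<omega> x u \<longleftrightarrow>
     (\<forall>t. \<exists>v. has_oriented_int (\<lambda>r. \<Phi> (t - r) (\<theta> r \<omega>) (f (\<theta> r \<omega>) (u r))) 0 t v \<and>
              u t = \<Phi> t \<omega> x + v)"

text \<open>A map with domain \<open>{(\<omega>, \<xi>). \<omega> \<in> \<Omega> \<and> \<xi> \<in> E\<^sup>c\<^sub>\<omega>}\<close> is a function that is
  \<^const>\<open>extensional\<close> on this set, so that equality of functions is equality of such maps.\<close>

definition lipschitz_sections ::
    "'w measure \<Rightarrow> ('w \<Rightarrow> 'x \<Rightarrow> 'x) \<Rightarrow> ('w \<Rightarrow> 'x \<Rightarrow> 'x) \<Rightarrow> ('w \<Rightarrow> 'x \<Rightarrow> 'x) \<Rightarrow> real \<Rightarrow>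
     ('w \<times> 'x \<Rightarrow> 'x::real_normed_vector) set" where
  "lipschitz_sections M Pc Ps Pu N =
     {\<phi>. \<phi> \<in> extensional (SIGMA \<omega>:space M. range (Pc \<omega>)) \<and>
         (\<forall>x. bochner_measurable M (\<lambda>\<omega>. \<phi> (\<omega>, Pc \<omega> x))) \<and>
         (\<forall>\<omega>\<in>space M. \<phi> (\<omega>, 0) = 0) \<and>
         (\<forall>\<omega>\<in>space M. \<forall>\<xi>\<in>range (Pc \<omega>).
            \<phi> (\<omega>, \<xi>) \<in> {y + z | y z. y \<in> range (Ps \<omega>) \<and> z \<in> range (Pu \<omega>)}) \<and>
         (\<forall>\<omega>\<in>space M. \<forall>\<xi>\<in>range (Pc \<omega>). \<forall>\<xi>'\<in>range (Pc \<omega>).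
            norm (\<phi> (\<omega>, \<xi>) - \<phi> (\<omega>, \<xi>')) \<le> N * norm (\<xi> - \<xi>'))}"

definition section_graph ::
    "('w \<Rightarrow> 'x \<Rightarrow> 'x) \<Rightarrow> ('w \<times> 'x \<Rightarrow> 'x::real_normed_vector) \<Rightarrow> 'w \<Rightarrow> 'x set" where
  "section_graph Pc \<phi> \<omega> = {\<xi> + \<phi> (\<omega>, \<xi>) | \<xi>. \<xi> \<in> range (Pc \<omega>)}"

definition invariant_section ::
    "'w measure \<Rightarrow> (real \<Rightarrow> 'w \<Rightarrow> 'w) \<Rightarrow> (real \<Rightarrow> 'w \<Rightarrow> 'x \<Rightarrow> 'x::real_normed_vector) \<Rightarrow>
     ('w \<Rightarrow> 'x \<Rightarrow> 'x) \<Rightarrow> ('w \<times> 'x \<Rightarrow> 'x) \<Rightarrow> bool" where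
  "invariant_section M \<theta> \<Psi> Pc \<phi> \<longleftrightarrow>
     (\<forall>t. \<forall>\<omega>\<in>space M. \<Psi> t \<omega> ` section_graph Pc \<phi> \<omega> \<subseteq> section_graph Pc \<phi> (\<theta> t \<omega>))"

end

theory Submission
  imports Defs
begin

text \<open>The proof is a Lyapunov-Perron argument. Parametrize the graph of the section by \<open>\<xi> \<in> E\<^sup>c\<close> and
  let \<open>V t \<omega> \<xi>\<close> be the orbit starting on it over \<open>\<xi>\<close>. By variation of constants, its centre part is
  \<open>X V\<close>, and if the orbit grows at most like \<open>\<alpha>c\<close>, the limit hypotheses force the section to be
  \<open>Y V\<close>, the difference of two integrals over half lines. Thus \<open>V\<close> is a fixed point of
  \<open>LP V t \<omega> \<xi> = X V t \<omega> \<xi> + Y V (\<theta> t \<omega>) (X V t \<omega> \<xi>)\<close>. Measured by the norms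
  \<open>\<parallel>V t \<omega> \<xi>\<parallel> / (\<alpha>c t \<omega> * \<parallel>\<xi>\<parallel>)\<close>, this operator preserves the Lipschitz constant \<open>L = (1 + N) (1 + \<sigma> L)\<close> and
  contracts by \<open>(1 + N) \<sigma> + (1 + \<sigma> L) \<tau>\<close>; the smallness of \<open>\<sigma> + \<tau>\<close> makes a choice of \<open>N < 1\<close> with
  \<open>\<tau> L \<le> N\<close> and a factor below \<open>1\<close> possible. Conversely, the fixed point satisfies the cocycle property by
  uniqueness of the centre equation, hence is a mild solution and thereby an orbit of \<open>\<Psi>\<close>.

  As \<open>X\<close> need not be separable, integrals are Henstock-Kurzweil integrals of functions that are
  everywhere limits of simple functions.\<close>

section \<open>Bochner measurable functions\<close>

text \<open>The unknown is the family \<open>V\<close> of orbits and not the section, because an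
  equation for the section alone would contain the centre flow on its own graph; in terms of
  \<open>V\<close> both are explicit integrals. As \<open>Y\<close> is taken over
  \<open>\<theta> t \<omega>\<close>, the equation couples all points of an orbit of \<theta>, so
  every estimate has to be uniform in \<omega>. The equation for \<open>L\<close> says that on a
  graph with constant \<open>N\<close> an orbit moves at most \<open>1 + N\<close> times as much as
  its centre part, whose constant is \<open>1 + \<sigma> * L\<close>;
  \<open>\<tau> * L \<le> N\<close> returns the section to its class. Two obstacles shape the rest.
  No growth of \<Psi> is assumed, so before the limit hypotheses can act on an arbitrary invariant
  section, its orbits must be shown to obey the Lipschitz bound of \<open>V\<close>; this is
  extracted from the centre equation on the graph. And Borel functions into a nonseparable space
  need not be closed under sums, so measurability always passes through simple functions or
  separable ranges.\<close>

text \<open>Greedy approximation along an enumeration of \<open>insert 0 D\<close>: stage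
  \<open>n\<close> keeps the nearer of the old value and \<open>e n\<close>. Since the start is 0,
  the error never exceeds \<open>norm (f a)\<close>, whence the factor 2; this built-in majorant
  serves dominated convergence later.\<close>

lemma simple_approximation_of_separable_range:
  fixes f :: "'a \<Rightarrow> 'x::real_normed_vector"
  assumes f[measurable]: "f \<in> borel_measurable M"
    and D: "countable D" "f ` space M \<subseteq> closure D"
  shows "\<exists>s. (\<forall>i. simple_function M (s i)) \<and> (\<forall>a\<in>space M. (\<lambda>i. s i a) \<longlonglongrightarrow> f a) \<and>
             (\<forall>i. \<forall>a\<in>space M. norm (s i a) \<le> 2 * norm (f a))"
proof -
  define e where "e = from_nat_into (insert 0 D)"
  have e_range: "range e = insert 0 D"
    unfolding e_def using D(1) by (intro range_from_nat_into) auto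
  then obtain k0 where k0: "e k0 = 0" by (metis insertI1 rangeE)
  define s where "s = rec_nat (\<lambda>a. 0)
    (\<lambda>n F a. if dist (e n) (f a) < dist (F a) (f a) then e n else F a)"
  have s0: "s 0 a = 0" and sS: "s (Suc n) a =
      (if dist (e n) (f a) < dist (s n a) (f a) then e n else s n a)" for n a
    by (simp_all add: s_def)
  \<comment> \<open>The distance to \<open>f\<close> is carried through the induction: it is a
    running minimum of distances to fixed points, hence measurable even where the difference of two
    Borel functions need not be.\<close>
  have simp_meas: "simple_function M (s n) \<and> (\<lambda>a. dist (s n a) (f a)) \<in> borel_measurable M" for n
  proof (induction n)
    case 0
    have "(\<lambda>a. dist (0::'x) (f a)) \<in> borel_measurable M"
      by (intro borel_measurable_continuous_on[OF _ f] continuous_intros)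
    moreover have "simple_function M (s 0)"
      using simple_function_const[of M "0::'x"] by (simp add: s0 [abs_def])
    ultimately show ?case by (simp add: s0)
  next
    case (Suc n)
    then have [measurable]: "(\<lambda>a. dist (s n a) (f a)) \<in> borel_measurable M"
      and sn: "simple_function M (s n)" by auto
    have [measurable]: "(\<lambda>a. dist (e n) (f a)) \<in> borel_measurable M"
      by (intro borel_measurable_continuous_on[OF _ f] continuous_intros)
    have "simple_function M (\<lambda>a. if dist (e n) (f a) < dist (s n a) (f a) then e n else s n a)"
      by (intro simple_function_If sn) (auto, measurable)
    moreover have "(\<lambda>a. dist (s (Suc n) a) (f a)) =
      (\<lambda>a. min (dist (e n) (f a)) (dist (s n a) (f a)))"
      by (auto simp: sS min_def fun_eq_iff)
    ultimately show ?case by (simp add: sS [abs_def])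
  qed
  have le0: "dist (s n a) (f a) \<le> norm (f a)" for n a
    by (induction n) (auto simp: s0 sS dist_norm)
  have anti: "dist (s m a) (f a) \<le> dist (s n a) (f a)" if "n \<le> m" for n m a
    using that by (induction m rule: dec_induct) (auto simp: sS)
  have le_e: "dist (s n a) (f a) \<le> dist (e k) (f a)" if "k < n" for k n a
    using anti[of "Suc k" n a] that by (simp add: sS split: if_splits)
  have conv: "(\<lambda>i. s i a) \<longlonglongrightarrow> f a" if a: "a \<in> space M" for a
  proof (rule metric_LIMSEQ_I)
    fix r :: real assume "0 < r"
    have "f a \<in> closure D" using D(2) a by auto
    then obtain y where "y \<in> D" "dist y (f a) < r"
      using \<open>0 < r\<close> closure_approachable by blast
    then obtain k where "dist (e k) (f a) < r"
      using e_range by (metis insertI2 rangeE)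
    then have "\<forall>n\<ge>Suc k. dist (s n a) (f a) < r"
      using le_e by (meson Suc_le_eq order_le_less_trans)
    then show "\<exists>no. \<forall>n\<ge>no. dist (s n a) (f a) < r" by blast
  qed
  have "norm (s n a) \<le> 2 * norm (f a)" for n a
    using le0[of n a] norm_triangle_ineq[of "s n a - f a" "f a"] by (simp add: dist_norm)
  then show ?thesis
    using simp_meas conv by blast
qed

text \<open>The everywhere form of Pettis' theorem. Closure under limits and compositions becomes a
  matter of uniting countable sets.\<close>

lemma bochner_measurable_iff_separable_range:
  fixes f :: "'a \<Rightarrow> 'x::real_normed_vector"
  shows "bochner_measurable M f \<longleftrightarrow>
    f \<in> borel_measurable M \<and> (\<exists>D. countable D \<and> f ` space M \<subseteq> closure D)"
proof
  assume "bochner_measurable M f"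
  then obtain s where s: "\<And>i. simple_function M (s i)"
    "\<And>a. a \<in> space M \<Longrightarrow> (\<lambda>i. s i a) \<longlonglongrightarrow> f a"
    unfolding bochner_measurable_def by blast
  have "f \<in> borel_measurable M"
    by (rule borel_measurable_LIMSEQ_metric[OF _ s(2)])
       (auto intro: borel_measurable_simple_function s(1))
  moreover have "f a \<in> closure (\<Union>i. s i ` space M)" if "a \<in> space M" for a
    unfolding closure_sequential using that s(2)[OF that] by (intro exI[of _ "\<lambda>i. s i a"]) auto
  moreover have "countable (\<Union>i. s i ` space M)"
    using s(1) by (auto intro!: countable_UN simp: simple_function_def countable_finite)
  ultimately show "f \<in> borel_measurable M \<and> (\<exists>D. countable D \<and> f ` space M \<subseteq> closure D)"
    by blast
next
  assume f: "f \<in> borel_measurable M \<and> (\<exists>D. countable D \<and> f ` space M \<subseteq> closure D)"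
  then obtain D where "countable D" "f ` space M \<subseteq> closure D" by blast
  from simple_approximation_of_separable_range[OF conjunct1[OF f] this]
  show "bochner_measurable M f"
    unfolding bochner_measurable_def by (elim ex_forward) simp
qed

lemma bochner_measurableI:
  "f \<in> borel_measurable M \<Longrightarrow> countable D \<Longrightarrow> (\<And>a. a \<in> space M \<Longrightarrow> f a \<in> closure D) \<Longrightarrow>
    bochner_measurable M f"
  unfolding bochner_measurable_iff_separable_range by (intro conjI exI[of _ D]) auto

lemma bochner_measurable_separable:
  assumes "bochner_measurable M f"
  obtains D where "countable D" "\<And>a. a \<in> space M \<Longrightarrow> f a \<in> closure D"
proof -
  from assms obtain D where "countable D" "f ` space M \<subseteq> closure D"
    unfolding bochner_measurable_iff_separable_range by (elim conjE exE)
  then show thesis by (intro that[of D]) auto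
qed

lemma bochner_measurable_borel: "bochner_measurable M f \<Longrightarrow> f \<in> borel_measurable M"
  by (simp add: bochner_measurable_iff_separable_range)

lemma bochner_measurable_norm_approximation:
  assumes "bochner_measurable M f"
  obtains s where "\<And>i. simple_function M (s i)" "\<And>a. a \<in> space M \<Longrightarrow> (\<lambda>i. s i a) \<longlonglongrightarrow> f a"
    "\<And>i a. a \<in> space M \<Longrightarrow> norm (s i a) \<le> 2 * norm (f a)"
proof -
  have "\<exists>s. (\<forall>i. simple_function M (s i)) \<and> (\<forall>a\<in>space M. (\<lambda>i. s i a) \<longlonglongrightarrow> f a) \<and>
             (\<forall>i. \<forall>a\<in>space M. norm (s i a) \<le> 2 * norm (f a))"
    using assms simple_approximation_of_separable_range[of f M]
    unfolding bochner_measurable_iff_separable_range by metis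
  then show thesis using that by metis
qed

section \<open>Closure properties of Bochner measurability\<close>

lemma bochner_measurable_simple: "simple_function M f \<Longrightarrow> bochner_measurable M f"
  unfolding bochner_measurable_def by (intro exI[of _ "\<lambda>i. f"]) auto

lemma bochner_measurable_const: "bochner_measurable M (\<lambda>a. c)"
  by (rule bochner_measurable_simple) simp

lemma bochner_measurable_cong:
  "(\<And>a. a \<in> space M \<Longrightarrow> f a = g a) \<Longrightarrow> bochner_measurable M f \<longleftrightarrow> bochner_measurable M g"
  unfolding bochner_measurable_def by simp

lemma bochner_measurable_limit:
  fixes f :: "'a \<Rightarrow> 'x::real_normed_vector"
  assumes s: "\<And>i. bochner_measurable M (s i)"
    and lim: "\<And>a. a \<in> space M \<Longrightarrow> (\<lambda>i. s i a) \<longlonglongrightarrow> f a"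
  shows "bochner_measurable M f"
proof -
  have "\<forall>i. \<exists>D. countable D \<and> (\<forall>a\<in>space M. s i a \<in> closure D)"
    using bochner_measurable_separable[OF s] by (intro allI) metis
  then obtain D where D: "\<And>i. countable (D i)" "\<And>i a. a \<in> space M \<Longrightarrow> s i a \<in> closure (D i)"
    by metis
  have "f a \<in> closure (\<Union>i. D i)" if a: "a \<in> space M" for a
  proof -
    have "s i a \<in> closure (\<Union>i. D i)" for i
      using D(2)[OF a, of i] closure_mono[of "D i" "\<Union>i. D i"] by auto
    then show ?thesis
      using lim[OF a] by (meson closed_closure closed_sequentially)
  qed
  moreover have "countable (\<Union>i. D i)" using D by auto
  moreover have "f \<in> borel_measurable M"
    by (rule borel_measurable_LIMSEQ_metric[OF bochner_measurable_borel[OF s] lim])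
  ultimately show ?thesis
    by (intro bochner_measurableI)
qed

lemma bochner_measurable_compose:
  assumes "bochner_measurable M f" "m \<in> N \<rightarrow>\<^sub>M M"
  shows "bochner_measurable N (\<lambda>p. f (m p))"
proof -
  obtain D where D: "countable D" "\<And>a. a \<in> space M \<Longrightarrow> f a \<in> closure D"
    using bochner_measurable_separable[OF assms(1)] by metis
  have "(\<lambda>p. f (m p)) \<in> borel_measurable N"
    by (rule measurable_compose[OF assms(2) bochner_measurable_borel[OF assms(1)]])
  then show ?thesis
    using D measurable_space[OF assms(2)] by (intro bochner_measurableI[of _ _ D]) auto
qed

text \<open>On each of the finitely many level sets of \<open>y\<close> the second argument of
  \<open>g\<close> is constant.\<close>

lemma measurable_compose_simple:
  assumes y: "simple_function M y" and g: "\<And>v. v \<in> y ` space M \<Longrightarrow> (\<lambda>a. g a v) \<in> M \<rightarrow>\<^sub>M N"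
  shows "(\<lambda>a. g a (y a)) \<in> M \<rightarrow>\<^sub>M N"
proof (rule measurable_compose_countable'[where I = "y ` space M" and f = "\<lambda>v a. g a v"])
  show "y \<in> M \<rightarrow>\<^sub>M count_space (y ` space M)"
    using y by (auto simp: simple_function_def measurable_count_space_eq2)
  show "countable (y ` space M)"
    using y by (simp add: simple_function_def countable_finite)
qed (rule g)

lemma bochner_measurable_compose_simple:
  fixes g :: "'a \<Rightarrow> 'y \<Rightarrow> 'x::real_normed_vector"
  assumes y: "simple_function M y" and g: "\<And>v. bochner_measurable M (\<lambda>a. g a v)"
  shows "bochner_measurable M (\<lambda>a. g a (y a))"
proof -
  have "\<forall>v. \<exists>D. countable D \<and> (\<forall>a\<in>space M. g a v \<in> closure D)"
    using bochner_measurable_separable[OF g] by (intro allI) metis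
  then obtain D where D: "\<And>v. countable (D v)" "\<And>v a. a \<in> space M \<Longrightarrow> g a v \<in> closure (D v)"
    by metis
  have "g a (y a) \<in> closure (\<Union>v\<in>y ` space M. D v)" if "a \<in> space M" for a
    using D(2)[OF that, of "y a"] that closure_mono[of "D (y a)" "\<Union>v\<in>y ` space M. D v"] by auto
  moreover have "countable (\<Union>v\<in>y ` space M. D v)"
    using y D(1) by (intro countable_UN) (auto simp: simple_function_def countable_finite)
  moreover have "(\<lambda>a. g a (y a)) \<in> borel_measurable M"
    by (rule measurable_compose_simple[OF y]) (rule bochner_measurable_borel[OF g])
  ultimately show ?thesis
    by (intro bochner_measurableI)
qed

text \<open>Simple functions are substituted for \<open>y\<close> first, and continuity in the
  second argument carries the result to the limit. Sums, scalar multiples and the substitution of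
  measurable arguments into \<Phi>, \<open>f\<close>, the projections and \<open>V\<close> are all
  instances.\<close>

lemma bochner_measurable_caratheodory:
  fixes g :: "'a \<Rightarrow> 'y::real_normed_vector \<Rightarrow> 'x::real_normed_vector"
  assumes y: "bochner_measurable M y" and g: "\<And>v. bochner_measurable M (\<lambda>a. g a v)"
    and cont: "\<And>a. a \<in> space M \<Longrightarrow> continuous_on UNIV (g a)"
  shows "bochner_measurable M (\<lambda>a. g a (y a))"
proof -
  obtain s where s: "\<And>i. simple_function M (s i)" "\<And>a. a \<in> space M \<Longrightarrow> (\<lambda>i. s i a) \<longlonglongrightarrow> y a"
    using y unfolding bochner_measurable_def by blast
  show ?thesis
  proof (rule bochner_measurable_limit)
    show "bochner_measurable M (\<lambda>a. g a (s i a))" for i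
      by (rule bochner_measurable_compose_simple[OF s(1) g])
    show "(\<lambda>i. g a (s i a)) \<longlonglongrightarrow> g a (y a)" if "a \<in> space M" for a
      using continuous_on_tendsto_compose[OF cont[OF that] s(2)[OF that]] by simp
  qed
qed

lemma bochner_measurable_add:
  assumes "bochner_measurable M f" "bochner_measurable M g"
  shows "bochner_measurable M (\<lambda>a. f a + g a)"
proof -
  have "bochner_measurable M (\<lambda>a. v + g a)" for v
    by (rule bochner_measurable_caratheodory[where g = "\<lambda>a w. v + w", OF assms(2)])
       (auto intro: bochner_measurable_const continuous_intros)
  then show ?thesis
    by (intro bochner_measurable_caratheodory[where g = "\<lambda>a v. v + g a", OF assms(1)])
       (auto intro: continuous_intros)
qed

lemma bochner_measurable_real:
  fixes f :: "'a \<Rightarrow> real"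
  assumes "f \<in> borel_measurable M"
  shows "bochner_measurable M f"
  unfolding bochner_measurable_def
  using borel_measurable_implies_sequence_metric[OF assms, of 0] by blast

lemma bochner_measurable_scaleR:
  assumes "c \<in> borel_measurable M" "bochner_measurable M f"
  shows "bochner_measurable M (\<lambda>a. c a *\<^sub>R f a)"
proof -
  have "bochner_measurable M (\<lambda>a. r *\<^sub>R f a)" for r
    by (rule bochner_measurable_caratheodory[where g = "\<lambda>a w. r *\<^sub>R w", OF assms(2)])
       (auto intro: bochner_measurable_const continuous_intros)
  then show ?thesis
    by (intro bochner_measurable_caratheodory[where g = "\<lambda>a r. r *\<^sub>R f a",
          OF bochner_measurable_real[OF assms(1)]])
       (auto intro: continuous_intros)
qed

lemma bochner_measurable_diff:
  assumes "bochner_measurable M f" "bochner_measurable M g"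
  shows "bochner_measurable M (\<lambda>a. f a - g a)"
  using bochner_measurable_add[OF assms(1) bochner_measurable_scaleR[of "\<lambda>_. -1", OF _ assms(2)]]
  by simp

lemma bochner_measurable_sum:
  assumes "\<And>i. i \<in> I \<Longrightarrow> bochner_measurable M (f i)"
  shows "bochner_measurable M (\<lambda>a. \<Sum>i\<in>I. f i a)"
  using assms
  by (induction I rule: infinite_finite_induct)
     (auto intro: bochner_measurable_const bochner_measurable_add)

lemma bochner_measurable_indicator:
  assumes "bochner_measurable M f" "Measurable.pred M P"
  shows "bochner_measurable M (\<lambda>a. if P a then f a else 0)"
proof -
  have "(\<lambda>a. (if P a then 1 else 0) :: real) \<in> borel_measurable M"
    using assms(2) by measurable
  from bochner_measurable_scaleR[OF this assms(1)]
  show ?thesis by (rule back_subst[of "bochner_measurable M"]) auto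
qed

section \<open>Bochner and Henstock-Kurzweil integrals\<close>

lemma has_integral_exhausting_boxes:
  fixes f :: "'n::euclidean_space \<Rightarrow> 'x::banach"
  assumes "(f has_integral v) S" "0 < e"
  obtains B where "0 < B" "\<And>a b. ball 0 B \<subseteq> cbox a b \<Longrightarrow>
    norm (integral (cbox a b) (\<lambda>x. if x \<in> S then f x else 0) - v) < e"
proof -
  have "\<exists>B>0. \<forall>a b. ball 0 B \<subseteq> cbox a b \<longrightarrow>
      norm (integral (cbox a b) (\<lambda>x. if x \<in> S then f x else 0) - v) < e"
    using assms by (simp add: has_integral_alt')
  then show thesis using that by blast
qed

lemma has_integral_gauge:
  assumes "(f has_integral v) (cbox a b)" "0 < e"
  shows "\<exists>\<gamma>. gauge \<gamma> \<and> (\<forall>\<D>. \<D> tagged_division_of cbox a b \<longrightarrow> \<gamma> fine \<D> \<longrightarrow>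
    norm ((\<Sum>(x,K)\<in>\<D>. measure lborel K *\<^sub>R f x) - v) < e)"
  using assms(1)[unfolded has_integral, rule_format, OF assms(2)] by (simp only: imp_conjL)

text \<open>\<open>G\<close> dominates the error \<open>f - s\<close> pointwise and has a small
  integral, so the Riemann sums of \<open>f\<close> and \<open>s\<close> differ little on every
  sufficiently fine division. This carries gauge integrability from simple to Bochner integrable
  functions.\<close>

lemma has_integral_approximation:
  fixes f :: "'n::euclidean_space \<Rightarrow> 'x::banach"
  assumes approx: "\<And>e. 0 < e \<Longrightarrow> \<exists>s w G I. (s has_integral w) UNIV \<and> (G has_integral I) UNIV \<and>
      I < e \<and> (\<forall>x. norm (f x - s x) \<le> G x) \<and> norm (w - v) < e"
  shows "(f has_integral v) UNIV"
proof -
  have int_box: "G integrable_on cbox a b" "integral (cbox a b) G \<le> I"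
    if "(G has_integral I) UNIV" "\<And>x. 0 \<le> G x" for G :: "'n \<Rightarrow> real" and I a b
  proof -
    show "G integrable_on cbox a b"
      using that(1) integrable_on_subcbox has_integral_integrable by blast
    then show "integral (cbox a b) G \<le> I"
      using that by (intro has_integral_subset_le[of "cbox a b" UNIV G])
        (auto simp: integrable_integral)
  qed
  have int_f: "f integrable_on cbox a b" for a b
    unfolding integrable_Cauchy
  proof (intro allI impI)
    fix e :: real assume "0 < e"
    then obtain s w G I where s: "(s has_integral w) UNIV" "(G has_integral I) UNIV"
      "I < e / 8" "\<And>x. norm (f x - s x) \<le> G x"
      using approx[of "e / 8"] by auto
    have G0: "0 \<le> G x" for x using s(4)[of x] norm_ge_zero order_trans by blast
    have e8: "0 < e / 8" using \<open>0 < e\<close> by simp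
    have si: "s integrable_on cbox a b"
      using s(1) integrable_on_subcbox has_integral_integrable by blast
    obtain g1 where g1: "gauge g1" "\<forall>\<D>. \<D> tagged_division_of cbox a b \<longrightarrow> g1 fine \<D> \<longrightarrow>
        norm ((\<Sum>(x,K)\<in>\<D>. measure lborel K *\<^sub>R s x) - integral (cbox a b) s) < e / 8"
      using has_integral_gauge[OF integrable_integral[OF si] e8] by (elim exE conjE)
    obtain g2 where g2: "gauge g2" "\<forall>\<D>. \<D> tagged_division_of cbox a b \<longrightarrow> g2 fine \<D> \<longrightarrow>
        norm ((\<Sum>(x,K)\<in>\<D>. measure lborel K *\<^sub>R G x) - integral (cbox a b) G) < e / 8"
      using has_integral_gauge[OF integrable_integral[OF int_box(1)[OF s(2) G0, of a b]] e8]
      by (elim exE conjE)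
    \<comment> \<open>Two divisions are not compared directly: each has its Riemann sum of
      \<open>f\<close> near the same number, the integral of \<open>s\<close>.\<close>
    have near: "norm ((\<Sum>(x,K)\<in>\<D>. measure lborel K *\<^sub>R f x) - integral (cbox a b) s) < e / 2"
      if D: "\<D> tagged_division_of cbox a b" "(\<lambda>x. g1 x \<inter> g2 x) fine \<D>" for \<D>
    proof -
      have fine: "g1 fine \<D>" "g2 fine \<D>" using D(2) by (auto simp: fine_Int)
      have "norm ((\<Sum>(x,K)\<in>\<D>. measure lborel K *\<^sub>R f x) - (\<Sum>(x,K)\<in>\<D>. measure lborel K *\<^sub>R s x)) =
          norm (\<Sum>(x,K)\<in>\<D>. measure lborel K *\<^sub>R (f x - s x))"
        by (simp add: sum_subtractf[symmetric] split_def scaleR_diff_right)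
      also have "\<dots> \<le> (\<Sum>(x,K)\<in>\<D>. norm (measure lborel K *\<^sub>R (f x - s x)))"
        by (rule order_trans[OF norm_sum]) (simp add: split_def)
      also have "\<dots> \<le> (\<Sum>(x,K)\<in>\<D>. measure lborel K *\<^sub>R G x)"
        by (intro sum_mono) (auto intro!: mult_left_mono s(4))
      also have "\<dots> < integral (cbox a b) G + e / 8"
        using g2(2)[rule_format, OF D(1) fine(2)] unfolding real_norm_def by linarith
      also have "\<dots> < e / 8 + e / 8"
        using int_box(2)[OF s(2) G0, of a b] s(3) by simp
      finally show ?thesis
        using g1(2)[rule_format, OF D(1) fine(1)]
          norm_triangle_ineq[of "(\<Sum>(x,K)\<in>\<D>. measure lborel K *\<^sub>R f x) - (\<Sum>(x,K)\<in>\<D>. measure lborel K *\<^sub>R s x)"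
            "(\<Sum>(x,K)\<in>\<D>. measure lborel K *\<^sub>R s x) - integral (cbox a b) s"] \<open>0 < e\<close>
        by simp
    qed
    show "\<exists>\<gamma>. gauge \<gamma> \<and> (\<forall>\<D>1 \<D>2. \<D>1 tagged_division_of cbox a b \<and> \<gamma> fine \<D>1 \<and>
        \<D>2 tagged_division_of cbox a b \<and> \<gamma> fine \<D>2 \<longrightarrow>
        norm ((\<Sum>(x,K)\<in>\<D>1. measure lborel K *\<^sub>R f x) - (\<Sum>(x,K)\<in>\<D>2. measure lborel K *\<^sub>R f x)) < e)"
    proof (intro exI[of _ "\<lambda>x. g1 x \<inter> g2 x"] conjI allI impI)
      show "gauge (\<lambda>x. g1 x \<inter> g2 x)" using g1(1) g2(1) by (rule gauge_Int)
    next
      fix \<D>1 \<D>2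
      assume "\<D>1 tagged_division_of cbox a b \<and> (\<lambda>x. g1 x \<inter> g2 x) fine \<D>1 \<and>
        \<D>2 tagged_division_of cbox a b \<and> (\<lambda>x. g1 x \<inter> g2 x) fine \<D>2"
      then show "norm ((\<Sum>(x,K)\<in>\<D>1. measure lborel K *\<^sub>R f x) - (\<Sum>(x,K)\<in>\<D>2. measure lborel K *\<^sub>R f x)) < e"
        using near[of \<D>1] near[of \<D>2] norm_diff_triangle_less[of _ "integral (cbox a b) s" "e / 2" _ "e / 2"]
        by (simp add: norm_minus_commute)
    qed
  qed
  show ?thesis
    unfolding has_integral_alt'
  proof (intro conjI allI impI)
    show "(\<lambda>x. if x \<in> UNIV then f x else 0) integrable_on cbox a b" for a b
      using int_f by simp
  next
    fix e :: real assume "0 < e"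
    then obtain s w G I where s: "(s has_integral w) UNIV" "(G has_integral I) UNIV"
      "I < e / 4" "\<And>x. norm (f x - s x) \<le> G x" "norm (w - v) < e / 4"
      using approx[of "e / 4"] by auto
    have G0: "0 \<le> G x" for x using s(4)[of x] norm_ge_zero order_trans by blast
    \<comment> \<open>The radius found for \<open>s\<close> serves \<open>f\<close> as well, since
      on every box their integrals differ by at most that of \<open>G\<close>.\<close>
    obtain B where B: "B > 0" "\<And>a b. ball 0 B \<subseteq> cbox a b \<Longrightarrow> norm (integral (cbox a b) s - w) < e / 4"
      using has_integral_exhausting_boxes[OF s(1), of "e / 4"] \<open>0 < e\<close> by auto
    show "\<exists>B>0. \<forall>a b. ball 0 B \<subseteq> cbox a b \<longrightarrow>
        norm (integral (cbox a b) (\<lambda>x. if x \<in> UNIV then f x else 0) - v) < e"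
    proof (intro exI[of _ B] conjI allI impI B(1))
      fix a b :: 'n assume sub: "ball 0 B \<subseteq> cbox a b"
      have si: "s integrable_on cbox a b"
        using s(1) integrable_on_subcbox has_integral_integrable by blast
      have "norm (integral (cbox a b) f - integral (cbox a b) s) =
          norm (integral (cbox a b) (\<lambda>x. f x - s x))"
        by (simp add: integral_diff[OF int_f si])
      also have "\<dots> \<le> integral (cbox a b) G"
        using integrable_diff[OF int_f si] int_box(1)[OF s(2) G0] s(4)
        by (rule integral_norm_bound_integral)
      also have "\<dots> < e / 4" using int_box(2)[OF s(2) G0, of a b] s(3) by simp
      finally have "norm (integral (cbox a b) f - w) < e / 4 + e / 4"
        using B(2)[OF sub] by (rule norm_diff_triangle_less)
      then have "norm (integral (cbox a b) f - v) < e / 4 + e / 4 + e / 4"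
        using s(5) by (rule norm_diff_triangle_less)
      then show "norm (integral (cbox a b) (\<lambda>x. if x \<in> UNIV then f x else 0) - v) < e"
        using \<open>0 < e\<close> by simp
    qed
  qed
qed

lemma has_integral_simple_bochner:
  fixes s :: "'n::euclidean_space \<Rightarrow> 'x::real_normed_vector"
  assumes "Bochner_Integration.simple_bochner_integrable lebesgue s"
  shows "(s has_integral Bochner_Integration.simple_bochner_integral lebesgue s) UNIV"
proof -
  have s: "simple_function lebesgue s" "emeasure lebesgue {y. s y \<noteq> 0} \<noteq> \<infinity>"
    using assms by (auto elim: simple_bochner_integrable.cases)
  have fin: "finite (range s)" using simple_functionD(1)[OF s(1)] by simp
  have meas: "{x. s x = y} \<in> sets lebesgue" for y
    using simple_functionD(2)[OF s(1), of "{y}"] by (simp add: vimage_def)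
  have "((\<lambda>x. indicat_real {x. s x = y} x *\<^sub>R y) has_integral
      measure lebesgue {x. s x = y} *\<^sub>R y) UNIV" for y
  \<comment> \<open>Only nonzero values are guaranteed level sets of finite measure; the summand of
    the value 0 vanishes.\<close>
  proof (cases "y = 0")
    case False
    have "{x. s x \<noteq> 0} = - {x. s x = 0}" by auto
    then have "{x. s x \<noteq> 0} \<in> sets lebesgue"
      using sets.compl_sets[OF meas[of 0]] by (simp add: Compl_eq_Diff_UNIV)
    then have "emeasure lebesgue {x. s x = y} \<le> emeasure lebesgue {y. s y \<noteq> 0}"
      using False by (intro emeasure_mono) auto
    then have "{x. s x = y} \<in> lmeasurable"
      using meas s(2) by (intro fmeasurableI) (auto simp: top_unique less_top[symmetric])
    then show ?thesis
      using lmeasurable_iff_indicator_has_integral by (intro has_integral_scaleR_left) blast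
  qed simp
  then have "((\<lambda>x. \<Sum>y\<in>range s. indicat_real {x. s x = y} x *\<^sub>R y) has_integral
      (\<Sum>y\<in>range s. measure lebesgue {x. s x = y} *\<^sub>R y)) UNIV"
    by (intro has_integral_sum fin)
  moreover have "(\<Sum>y\<in>range s. indicat_real {x. s x = y} x *\<^sub>R y) = s x" for x
  proof -
    have "(\<Sum>y\<in>range s. indicat_real {x. s x = y} x *\<^sub>R y) =
        (\<Sum>y\<in>range s. if s x = y then y else 0)"
      by (intro sum.cong) (auto simp: indicator_def)
    also have "\<dots> = s x" using fin by (subst sum.delta') auto
    finally show ?thesis .
  qed
  ultimately show ?thesis
    by (simp add: simple_bochner_integral_def)
qed

text \<open>For each fixed value of \<open>s\<close> the expression is a continuous function of
  \<open>f a\<close>, so no measurability of a difference of vector-valued functions enters.\<close>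

lemma borel_measurable_norm_diff_simple:
  fixes f s :: "'a \<Rightarrow> 'x::real_normed_vector"
  assumes f: "f \<in> borel_measurable M" and s: "simple_function M s"
  shows "(\<lambda>a. norm (f a - s a)) \<in> borel_measurable M"
  by (rule measurable_compose_simple[OF s, of "\<lambda>a v. norm (f a - v)"])
     (intro borel_measurable_continuous_on[OF _ f] continuous_intros)

lemma ennreal_tendsto_zero_small:
  fixes X :: "nat \<Rightarrow> ennreal"
  assumes "X \<longlonglongrightarrow> 0" "0 < e"
  shows "\<forall>\<^sub>F n in sequentially. X n < ennreal e"
  using order_tendstoD(2)[OF assms(1), of "ennreal e"] assms(2) by simp

lemma has_integral_of_nn_integral_less:
  fixes g :: "'n::euclidean_space \<Rightarrow> real"
  assumes "g \<in> borel_measurable lebesgue" "\<And>x. 0 \<le> g x"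
    "(\<integral>\<^sup>+x. ennreal (g x) \<partial>lebesgue) < ennreal e"
  shows "\<exists>I<e. (g has_integral I) UNIV"
proof -
  define I where "I = enn2real (\<integral>\<^sup>+x. ennreal (g x) \<partial>lebesgue)"
  have I: "(\<integral>\<^sup>+x. ennreal (g x) \<partial>lebesgue) = ennreal I"
    unfolding I_def using assms(3) by (intro ennreal_enn2real[symmetric]) (metis ennreal_less_top less_top order_less_trans)
  have "0 \<le> I" by (simp add: I_def)
  then show ?thesis
    using assms I has_integral_iff_nn_integral_lebesgue[of g I] by (auto simp: ennreal_less_iff)
qed

text \<open>After extension by zero, the simple functions of the Bochner integral meet the
  approximation criterion with the majorant \<open>norm (f' a - s' i a)\<close>.\<close>

lemma has_bochner_int_imp_has_integral:
  fixes f :: "'n::euclidean_space \<Rightarrow> 'x::banach"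
  assumes "has_bochner_int (lebesgue_on S) f v" and S: "S \<in> sets lebesgue"
  shows "(f has_integral v) S"
proof -
  have S': "S \<inter> space lebesgue \<in> sets lebesgue" using S by simp
  obtain s where f: "f \<in> borel_measurable (lebesgue_on S)"
    and s: "\<And>i. Bochner_Integration.simple_bochner_integrable (lebesgue_on S) (s i)"
    and lim: "(\<lambda>i. \<integral>\<^sup>+a. ennreal (norm (f a - s i a)) \<partial>lebesgue_on S) \<longlonglongrightarrow> 0"
      "(\<lambda>i. Bochner_Integration.simple_bochner_integral (lebesgue_on S) (s i)) \<longlonglongrightarrow> v"
    using assms(1) unfolding has_bochner_int_def by blast
  define f' where "f' x = indicat_real S x *\<^sub>R f x" for x
  define s' where "s' i x = indicat_real S x *\<^sub>R s i x" for i x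
  have f': "f' \<in> borel_measurable lebesgue"
    using f borel_measurable_restrict_space_iff[OF S', of f] by (simp add: f'_def [abs_def])
  have s'_int: "Bochner_Integration.simple_bochner_integrable lebesgue (s' i)" for i
    using s simple_bochner_integrable_restrict_space[OF S', of "s i"] by (simp add: s'_def [abs_def])
  then have s'_simple: "simple_function lebesgue (s' i)" for i
    by (auto elim: simple_bochner_integrable.cases)
  have sbi: "Bochner_Integration.simple_bochner_integral (lebesgue_on S) (s i) =
      Bochner_Integration.simple_bochner_integral lebesgue (s' i)" for i
    using simple_bochner_integral_restrict_space[OF S' s, of i] by (simp add: s'_def [abs_def])
  have nn: "(\<integral>\<^sup>+a. ennreal (norm (f a - s i a)) \<partial>lebesgue_on S) =
      (\<integral>\<^sup>+a. ennreal (norm (f' a - s' i a)) \<partial>lebesgue)" for i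
    unfolding nn_integral_restrict_space[OF S']
    by (intro nn_integral_cong) (auto simp: f'_def s'_def indicator_def)
  have "(f' has_integral v) UNIV"
  proof (rule has_integral_approximation)
    fix e :: real assume e: "0 < e"
    have "\<forall>\<^sub>F i in sequentially. (\<integral>\<^sup>+a. ennreal (norm (f' a - s' i a)) \<partial>lebesgue) < ennreal e"
      using ennreal_tendsto_zero_small[OF lim(1) e] by (simp add: nn)
    moreover have "\<forall>\<^sub>F i in sequentially.
        norm (Bochner_Integration.simple_bochner_integral lebesgue (s' i) - v) < e"
      using tendstoD[OF lim(2) e] by (simp add: sbi dist_norm)
    ultimately have "\<forall>\<^sub>F i in sequentially.
        (\<integral>\<^sup>+a. ennreal (norm (f' a - s' i a)) \<partial>lebesgue) < ennreal e \<and>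
        norm (Bochner_Integration.simple_bochner_integral lebesgue (s' i) - v) < e"
      by (rule eventually_conj)
    then obtain i where i: "(\<integral>\<^sup>+a. ennreal (norm (f' a - s' i a)) \<partial>lebesgue) < ennreal e"
        "norm (Bochner_Integration.simple_bochner_integral lebesgue (s' i) - v) < e"
      using eventually_happens'[OF sequentially_bot] by blast
    from has_integral_of_nn_integral_less[OF borel_measurable_norm_diff_simple[OF f' s'_simple] norm_ge_zero i(1)]
    obtain I where "I < e" "((\<lambda>a. norm (f' a - s' i a)) has_integral I) UNIV" by blast
    then show "\<exists>s w G I. (s has_integral w) UNIV \<and> (G has_integral I) UNIV \<and>
        I < e \<and> (\<forall>x. norm (f' x - s x) \<le> G x) \<and> norm (w - v) < e"
      using has_integral_simple_bochner[OF s'_int[of i]] i(2)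
      by (intro exI[of _ "s' i"] exI[of _ "\<lambda>a. norm (f' a - s' i a)"] exI) auto
  qed
  moreover have "f' = (\<lambda>x. if x \<in> S then f x else 0)" by (auto simp: f'_def)
  ultimately show ?thesis by (simp add: has_integral_restrict_UNIV)
qed

section \<open>Bochner integrable functions on subsets of the line\<close>

text \<open>Measurability is demanded for \<open>borel\<close> on the whole line, so that it is
  independent of \<open>S\<close> and stable under translations; only the finiteness of the norm
  integral is local.\<close>

definition bint :: "real set \<Rightarrow> (real \<Rightarrow> 'x::real_normed_vector) \<Rightarrow> bool" where
  "bint S g \<longleftrightarrow> bochner_measurable borel g \<and> (\<integral>\<^sup>+r\<in>S. ennreal (norm (g r)) \<partial>lebesgue) < \<infinity>"

lemma bint_measurable: "bint S g \<Longrightarrow> bochner_measurable borel g"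
  by (simp add: bint_def)

lemma lebesgue_measurable_of_borel: "f \<in> borel_measurable borel \<Longrightarrow> f \<in> borel_measurable lebesgue"
  by (simp add: measurable_completion)

lemma norm_lebesgue_measurable:
  fixes g :: "real \<Rightarrow> 'x::real_normed_vector"
  assumes "bochner_measurable borel g"
  shows "(\<lambda>r. norm (g r)) \<in> borel_measurable lebesgue"
  by (intro lebesgue_measurable_of_borel
      borel_measurable_continuous_on[OF _ bochner_measurable_borel[OF assms]] continuous_intros)

text \<open>Approximants bounded by \<open>2 * norm (g r)\<close> converge in mean by dominated
  convergence; their integrals are then a Cauchy sequence, and completeness supplies the
  value.\<close>

lemma bint_has_bochner_int:
  fixes g :: "real \<Rightarrow> 'x::banach"
  assumes g: "bint S g" and S: "S \<in> sets borel"
  shows "\<exists>v. has_bochner_int (lebesgue_on S) g v"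
proof -
  have S'': "S \<in> sets lebesgue" using S by simp
  then have S': "S \<inter> space lebesgue \<in> sets lebesgue" by simp
  have fin: "(\<integral>\<^sup>+r. ennreal (norm (g r)) \<partial>lebesgue_on S) < \<infinity>"
    using g by (simp add: bint_def nn_integral_restrict_space[OF S'])
  have gm: "g \<in> borel_measurable borel"
    using bochner_measurable_borel[OF bint_measurable[OF g]] .
  have gS: "g \<in> borel_measurable (lebesgue_on S)"
    using measurable_restrict_space1[OF lebesgue_measurable_of_borel[OF gm]] .
  obtain s where s: "\<And>i. simple_function borel (s i)" "\<And>a. (\<lambda>i. s i a) \<longlonglongrightarrow> g a"
    "\<And>i a. norm (s i a) \<le> 2 * norm (g a)"
    using bochner_measurable_norm_approximation[OF bint_measurable[OF g]] by (metis space_borel UNIV_I)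
  have sS: "simple_function (lebesgue_on S) (s i)" for i
  proof -
    have "s i \<in> lebesgue_on S \<rightarrow>\<^sub>M count_space UNIV"
      using s(1)[of i] by (intro measurable_restrict_space1 measurable_completion)
        (auto simp: simple_function_eq_measurable measurable_def)
    then show ?thesis
      using s(1)[of i] unfolding simple_function_eq_measurable
      by (auto intro: finite_subset[of _ "range (s i)"])
  qed
  have ng: "(\<lambda>r. norm (g r)) \<in> borel_measurable (lebesgue_on S)"
    by (rule measurable_restrict_space1[OF norm_lebesgue_measurable[OF bint_measurable[OF g]]])
  have fin2: "(\<integral>\<^sup>+r. ennreal (c * norm (g r)) \<partial>lebesgue_on S) < \<infinity>" if "0 \<le> c" for c
    using that ng fin by (simp add: ennreal_mult' nn_integral_cmult ennreal_mult_less_top)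
  have sbi: "Bochner_Integration.simple_bochner_integrable (lebesgue_on S) (s i)" for i
  proof (rule simple_bochner_integrableI_bounded[OF sS])
    have "(\<integral>\<^sup>+r. ennreal (norm (s i r)) \<partial>lebesgue_on S) \<le> (\<integral>\<^sup>+r. ennreal (2 * norm (g r)) \<partial>lebesgue_on S)"
      by (intro nn_integral_mono ennreal_leI s(3))
    then show "(\<integral>\<^sup>+r. ennreal (norm (s i r)) \<partial>lebesgue_on S) < \<infinity>"
      using fin2[of 2] by (simp add: le_less_trans)
  qed
  have lim: "(\<lambda>i. \<integral>\<^sup>+r. ennreal (norm (g r - s i r)) \<partial>lebesgue_on S) \<longlonglongrightarrow> 0"
  proof -
    have "(\<lambda>i. \<integral>\<^sup>+r. ennreal (norm (g r - s i r)) \<partial>lebesgue_on S) \<longlonglongrightarrow> (\<integral>\<^sup>+r. 0 \<partial>lebesgue_on S)"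
    proof (rule nn_integral_dominated_convergence[where w = "\<lambda>r. ennreal (3 * norm (g r))"])
      show "(\<lambda>r. ennreal (norm (g r - s i r))) \<in> borel_measurable (lebesgue_on S)" for i
        using borel_measurable_norm_diff_simple[OF gS sS] by measurable
      show "(\<lambda>r. ennreal (3 * norm (g r))) \<in> borel_measurable (lebesgue_on S)"
        using ng by measurable
      show "AE r in lebesgue_on S. ennreal (norm (g r - s i r)) \<le> ennreal (3 * norm (g r))" for i
        using norm_triangle_ineq4[of "g r" "s i r" for r] s(3)[of i]
        by (intro AE_I2 ennreal_leI) (smt (verit))
      have "(\<lambda>i. ennreal (norm (g r - s i r))) \<longlonglongrightarrow> ennreal (norm (g r - g r))" for r
        by (intro tendsto_intros s(2))
      then show "AE r in lebesgue_on S. (\<lambda>i. ennreal (norm (g r - s i r))) \<longlonglongrightarrow> 0"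
        by simp
    qed (use fin2[of 3] in auto)
    then show ?thesis by simp
  qed
  define J where "J i = Bochner_Integration.simple_bochner_integral (lebesgue_on S) (s i)" for i
  have "Cauchy J"
  proof (rule CauchyI)
    fix e :: real assume e: "0 < e"
    obtain N where N: "\<And>n. n \<ge> N \<Longrightarrow> (\<integral>\<^sup>+r. ennreal (norm (g r - s n r)) \<partial>lebesgue_on S) < ennreal (e / 2)"
      using ennreal_tendsto_zero_small[OF lim, of "e / 2"] e by (auto simp: eventually_sequentially)
    have "norm (J m - J n) < e" if mn: "m \<ge> N" "n \<ge> N" for m n
    proof -
      have d: "Bochner_Integration.simple_bochner_integrable (lebesgue_on S) (\<lambda>x. s m x - s n x)"
        by (rule simple_bochner_integrable_compose2) (auto intro: sbi)
      have "ennreal (norm (J m - J n)) \<le>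
          ennreal (Bochner_Integration.simple_bochner_integral (lebesgue_on S) (\<lambda>x. norm (s m x - s n x)))"
        unfolding J_def simple_bochner_integral_diff[OF sbi sbi, symmetric]
        by (intro ennreal_leI simple_bochner_integral_norm_bound d)
      also have "\<dots> = (\<integral>\<^sup>+x. norm (s m x - s n x) \<partial>lebesgue_on S)"
        using simple_bochner_integrable_compose2[of "\<lambda>x y. norm (x - y)" _ "s m" "s n"] sbi
        by (intro simple_bochner_integral_eq_nn_integral) auto
      also have "\<dots> \<le> (\<integral>\<^sup>+x. ennreal (norm (g x - s m x)) + ennreal (norm (g x - s n x)) \<partial>lebesgue_on S)"
        using norm_triangle_ineq4[of "g x - s n x" "g x - s m x" for x]
        by (intro nn_integral_mono) (simp flip: ennreal_plus add: norm_minus_commute add.commute)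
      also have "\<dots> = (\<integral>\<^sup>+x. ennreal (norm (g x - s m x)) \<partial>lebesgue_on S) +
          (\<integral>\<^sup>+x. ennreal (norm (g x - s n x)) \<partial>lebesgue_on S)"
        by (intro nn_integral_add measurable_compose[OF borel_measurable_norm_diff_simple[OF gS sS]]
              measurable_ennreal)
      also have "\<dots> < ennreal (e / 2) + ennreal (e / 2)"
        using N mn by (intro add_strict_mono) auto
      also have "\<dots> = ennreal e" using e by (simp flip: ennreal_plus)
      finally show ?thesis using e by (simp add: ennreal_less_iff)
    qed
    then show "\<exists>N. \<forall>m\<ge>N. \<forall>n\<ge>N. norm (J m - J n) < e" by blast
  qed
  then obtain v where "J \<longlonglongrightarrow> v" using Cauchy_convergent_iff convergent_def by blast
  then show ?thesis
    unfolding has_bochner_int_def J_def using gS sbi lim by blast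
qed

lemma bint_integrable_on:
  fixes g :: "real \<Rightarrow> 'x::banach"
  assumes "bint S g" "S \<in> sets borel"
  shows "g integrable_on S"
  using bint_has_bochner_int[OF assms] has_bochner_int_imp_has_integral[of S g] assms(2)
  by (auto simp: integrable_on_def)

text \<open>One simple approximant at mean distance below 1 already has a finite norm integral,
  which the triangle inequality transfers to \<open>g\<close>.\<close>

lemma has_bochner_int_imp_bint:
  fixes g :: "real \<Rightarrow> 'x::banach"
  assumes g: "bochner_measurable borel g" and S: "S \<in> sets borel"
    and h: "has_bochner_int (lebesgue_on S) g v"
  shows "bint S g"
proof -
  have S': "S \<inter> space lebesgue \<in> sets lebesgue" using S by simp
  obtain s where gS: "g \<in> borel_measurable (lebesgue_on S)"
    and s: "\<And>i. Bochner_Integration.simple_bochner_integrable (lebesgue_on S) (s i)"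
    and lim: "(\<lambda>i. \<integral>\<^sup>+a. ennreal (norm (g a - s i a)) \<partial>lebesgue_on S) \<longlonglongrightarrow> 0"
    using h unfolding has_bochner_int_def by blast
  obtain i where i: "(\<integral>\<^sup>+a. ennreal (norm (g a - s i a)) \<partial>lebesgue_on S) < ennreal 1"
    using eventually_happens'[OF sequentially_bot ennreal_tendsto_zero_small[OF lim, of 1]] by auto
  have si: "simple_function (lebesgue_on S) (s i)"
    using s by (auto elim: simple_bochner_integrable.cases)
  have "(\<integral>\<^sup>+a. ennreal (norm (s i a)) \<partial>lebesgue_on S) =
      ennreal (Bochner_Integration.simple_bochner_integral (lebesgue_on S) (\<lambda>a. norm (s i a)))"
    using simple_bochner_integrable_compose2[of "\<lambda>x y. norm x" _ "s i" "s i"] s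
    by (intro simple_bochner_integral_eq_nn_integral[symmetric]) auto
  then have fin_s: "(\<integral>\<^sup>+a. ennreal (norm (s i a)) \<partial>lebesgue_on S) < \<infinity>" by simp
  have [measurable]: "(\<lambda>a. norm (s i a)) \<in> borel_measurable (lebesgue_on S)"
    using si by (intro borel_measurable_simple_function) (auto intro: simple_function_compose1)
  have [measurable]: "(\<lambda>a. norm (g a - s i a)) \<in> borel_measurable (lebesgue_on S)"
    by (rule borel_measurable_norm_diff_simple[OF gS si])
  have "(\<integral>\<^sup>+a. ennreal (norm (g a)) \<partial>lebesgue_on S) \<le>
      (\<integral>\<^sup>+a. ennreal (norm (g a - s i a)) + ennreal (norm (s i a)) \<partial>lebesgue_on S)"
    using norm_triangle_ineq[of "g a - s i a" "s i a" for a]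
    by (intro nn_integral_mono) (simp flip: ennreal_plus)
  also have "\<dots> = (\<integral>\<^sup>+a. ennreal (norm (g a - s i a)) \<partial>lebesgue_on S) +
      (\<integral>\<^sup>+a. ennreal (norm (s i a)) \<partial>lebesgue_on S)"
    by (rule nn_integral_add) measurable
  also have "\<dots> < \<infinity>" using i fin_s by (auto simp: less_top[symmetric] dest: order_less_trans)
  finally show ?thesis
    using g by (simp add: bint_def nn_integral_restrict_space[OF S'])
qed

lemma bint_subset: "bint S g \<Longrightarrow> T \<subseteq> S \<Longrightarrow> bint T g"
proof -
  assume "bint S g" "T \<subseteq> S"
  moreover from \<open>T \<subseteq> S\<close> have "(\<integral>\<^sup>+r\<in>T. ennreal (norm (g r)) \<partial>lebesgue) \<le> (\<integral>\<^sup>+r\<in>S. ennreal (norm (g r)) \<partial>lebesgue)"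
    by (intro nn_integral_mono) (auto simp: indicator_def)
  ultimately show "bint T g" by (auto simp: bint_def intro: le_less_trans)
qed

lemma bint_Un:
  assumes "bint S g" "bint T g" "S \<in> sets borel" "T \<in> sets borel"
  shows "bint (S \<union> T) g"
proof -
  note [measurable] = norm_lebesgue_measurable[OF bint_measurable[OF assms(1)]]
  have [measurable]: "S \<in> sets lebesgue" "T \<in> sets lebesgue" using assms by auto
  have "(\<integral>\<^sup>+r\<in>S \<union> T. ennreal (norm (g r)) \<partial>lebesgue) \<le>
      (\<integral>\<^sup>+r. ennreal (norm (g r)) * indicator S r + ennreal (norm (g r)) * indicator T r \<partial>lebesgue)"
    by (intro nn_integral_mono) (auto simp: indicator_def)
  also have "\<dots> = (\<integral>\<^sup>+r\<in>S. ennreal (norm (g r)) \<partial>lebesgue) + (\<integral>\<^sup>+r\<in>T. ennreal (norm (g r)) \<partial>lebesgue)"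
    by (rule nn_integral_add) measurable
  also have "\<dots> < \<infinity>" using assms by (auto simp: bint_def)
  finally show ?thesis using assms by (simp add: bint_def)
qed

text \<open>As \<open>k\<close> may fail to be measurable, the factor \<open>m\<close> is pulled out on the side of \<open>g\<close>.\<close>

lemma nn_integral_le_cmult:
  assumes g: "g \<in> borel_measurable M" and "0 \<le> m" and le: "\<And>x. g x \<le> ennreal m * k x"
    and k: "(\<integral>\<^sup>+x. k x \<partial>M) \<le> B"
  shows "(\<integral>\<^sup>+x. g x \<partial>M) \<le> ennreal m * B"
proof (cases "m = 0")
  case True
  then have "g x = 0" for x using le[of x] by simp
  then show ?thesis by simp
next
  case False
  then have m: "0 < m" using \<open>0 \<le> m\<close> by simp
  have eq: "ennreal m * (ennreal (1 / m) * y) = y" for y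
    using m by (simp add: mult.assoc[symmetric] ennreal_mult[symmetric])
  have "(\<integral>\<^sup>+x. g x \<partial>M) = (\<integral>\<^sup>+x. ennreal m * (ennreal (1 / m) * g x) \<partial>M)" by (simp add: eq)
  also have "\<dots> = ennreal m * (\<integral>\<^sup>+x. ennreal (1 / m) * g x \<partial>M)"
    using g by (intro nn_integral_cmult) measurable
  also have "\<dots> \<le> ennreal m * (\<integral>\<^sup>+x. k x \<partial>M)"
  proof (intro mult_left_mono nn_integral_mono)
    fix x
    have "ennreal (1 / m) * g x \<le> ennreal (1 / m) * (ennreal m * k x)"
      by (intro mult_left_mono le) simp
    also have "\<dots> = k x" using m by (simp add: mult.assoc[symmetric] ennreal_mult[symmetric])
    finally show "ennreal (1 / m) * g x \<le> k x" .
  qed simp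
  also have "\<dots> \<le> ennreal m * B" by (intro mult_left_mono k) simp
  finally show ?thesis .
qed

lemma norm_integral_le_nn_integral:
  fixes g :: "real \<Rightarrow> 'x::banach"
  assumes g: "bint S g" and S: "S \<in> sets borel"
  shows "ennreal (norm (integral S g)) \<le> (\<integral>\<^sup>+r\<in>S. ennreal (norm (g r)) \<partial>lebesgue)"
proof -
  note [measurable] = norm_lebesgue_measurable[OF bint_measurable[OF g]]
  have [measurable]: "S \<in> sets lebesgue" using S by auto
  define I where "I = enn2real (\<integral>\<^sup>+r\<in>S. ennreal (norm (g r)) \<partial>lebesgue)"
  have I: "(\<integral>\<^sup>+r\<in>S. ennreal (norm (g r)) \<partial>lebesgue) = ennreal I"
    unfolding I_def using g by (intro ennreal_enn2real[symmetric]) (auto simp: bint_def less_top)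
  have "0 \<le> I" by (simp add: I_def)
  have "((\<lambda>r. if r \<in> S then norm (g r) else 0) has_integral I) UNIV"
  proof (subst has_integral_iff_nn_integral_lebesgue)
    have "(\<integral>\<^sup>+r. ennreal (if r \<in> S then norm (g r) else 0) \<partial>lebesgue) =
        (\<integral>\<^sup>+r\<in>S. ennreal (norm (g r)) \<partial>lebesgue)"
      by (intro nn_integral_cong) (auto simp: indicator_def)
    then show "(\<lambda>r. if r \<in> S then norm (g r) else 0) \<in> borel_measurable lebesgue \<and>
        (\<integral>\<^sup>+r. ennreal (if r \<in> S then norm (g r) else 0) \<partial>lebesgue) = ennreal I \<and> 0 \<le> I"
      using I \<open>0 \<le> I\<close> by (auto, measurable)
  qed simp
  then have "((\<lambda>r. norm (g r)) has_integral I) S" by (simp add: has_integral_restrict_UNIV)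
  then have "norm (integral S g) \<le> I"
    using integral_norm_bound_integral[OF bint_integrable_on[OF g S], of "\<lambda>r. norm (g r)"]
    by (auto simp: has_integral_iff)
  then show ?thesis by (simp add: I ennreal_leI)
qed

text \<open>The form in which the two constants enter: \<open>k\<close> is one of the three kernels,
  \<open>B\<close> bounds its integral, and \<open>m\<close> bounds a trajectory, or a difference of
  two, relative to \<alpha>c.\<close>

lemma bint_bound:
  fixes g :: "real \<Rightarrow> 'x::banach"
  assumes g: "bochner_measurable borel g" and S: "S \<in> sets borel" and "0 \<le> m" "0 \<le> B"
    and le: "\<And>r. r \<in> S \<Longrightarrow> norm (g r) \<le> m * k r"
    and k: "(\<integral>\<^sup>+r\<in>S. ennreal (k r) \<partial>lebesgue) \<le> ennreal B"
  shows "bint S g" "norm (integral S g) \<le> m * B"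
    "(\<integral>\<^sup>+r\<in>S. ennreal (norm (g r)) \<partial>lebesgue) \<le> ennreal (m * B)"
proof -
  note [measurable] = norm_lebesgue_measurable[OF g]
  have [measurable]: "S \<in> sets lebesgue" using S by auto
  have "(\<integral>\<^sup>+r\<in>S. ennreal (norm (g r)) \<partial>lebesgue) \<le> ennreal m * ennreal B"
    by (rule nn_integral_le_cmult[OF _ \<open>0 \<le> m\<close> _ k])
       (use le \<open>0 \<le> m\<close> in \<open>auto simp: indicator_def ennreal_mult'[symmetric] intro!: ennreal_leI\<close>)
  then show nn: "(\<integral>\<^sup>+r\<in>S. ennreal (norm (g r)) \<partial>lebesgue) \<le> ennreal (m * B)"
    using assms by (simp add: ennreal_mult)
  then show "bint S g"
    using g by (auto simp: bint_def intro: le_less_trans)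
  then show "norm (integral S g) \<le> m * B"
    using order_trans[OF norm_integral_le_nn_integral[OF _ S] nn] assms
    by (simp add: ennreal_le_iff)
qed

lemma bint_dominated:
  assumes h: "bint S h" and g: "bochner_measurable borel g" and S: "S \<in> sets borel" and "0 \<le> m"
    and le: "\<And>r. r \<in> S \<Longrightarrow> norm (g r) \<le> m * norm (h r)"
  shows "bint S g"
proof -
  note [measurable] = norm_lebesgue_measurable[OF g] norm_lebesgue_measurable[OF bint_measurable[OF h]]
  have [measurable]: "S \<in> sets lebesgue" using S by auto
  have "(\<integral>\<^sup>+r\<in>S. ennreal (norm (g r)) \<partial>lebesgue) \<le> ennreal m * (\<integral>\<^sup>+r\<in>S. ennreal (norm (h r)) \<partial>lebesgue)"
    by (rule nn_integral_le_cmult[OF _ \<open>0 \<le> m\<close> _ order_refl])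
       (use le \<open>0 \<le> m\<close> in \<open>auto simp: indicator_def ennreal_mult'[symmetric] intro!: ennreal_leI\<close>)
  also have "\<dots> < \<infinity>" using h by (simp add: bint_def ennreal_mult_less_top)
  finally show ?thesis using g by (simp add: bint_def)
qed

lemma bint_add:
  assumes "bint S g" "bint S h" "S \<in> sets borel"
  shows "bint S (\<lambda>r. g r + h r)"
proof -
  note [measurable] = norm_lebesgue_measurable[OF bint_measurable[OF assms(1)]]
    norm_lebesgue_measurable[OF bint_measurable[OF assms(2)]]
  have [measurable]: "S \<in> sets lebesgue" using assms by auto
  have "(\<integral>\<^sup>+r\<in>S. ennreal (norm (g r + h r)) \<partial>lebesgue) \<le>
      (\<integral>\<^sup>+r. ennreal (norm (g r)) * indicator S r + ennreal (norm (h r)) * indicator S r \<partial>lebesgue)"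
    by (intro nn_integral_mono)
       (auto simp: indicator_def norm_triangle_ineq simp flip: ennreal_plus)
  also have "\<dots> = (\<integral>\<^sup>+r\<in>S. ennreal (norm (g r)) \<partial>lebesgue) + (\<integral>\<^sup>+r\<in>S. ennreal (norm (h r)) \<partial>lebesgue)"
    by (rule nn_integral_add) measurable
  also have "\<dots> < \<infinity>" using assms by (auto simp: bint_def)
  finally show ?thesis
    using assms by (simp add: bint_def bochner_measurable_add)
qed

lemma bint_linear:
  assumes T: "bounded_linear T" and g: "bint S g" and S: "S \<in> sets borel"
  shows "bint S (\<lambda>r. T (g r))"
proof -
  have "bochner_measurable borel (\<lambda>r. T (g r))"
    by (rule bochner_measurable_caratheodory[where g = "\<lambda>_. T", OF bint_measurable[OF g]])
       (auto intro: bochner_measurable_const bounded_linear.continuous_on[OF T])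
  then show ?thesis
    using bint_dominated[OF g _ S onorm_pos_le[OF T]] onorm[OF T] by blast
qed

lemma bint_diff:
  assumes "bint S g" "bint S h" "S \<in> sets borel"
  shows "bint S (\<lambda>r. g r - h r)"
  using bint_add[OF assms(1) bint_linear[OF bounded_linear_minus[OF bounded_linear_ident] assms(2,3)] assms(3)]
  by simp

lemma integral_bounded_linear:
  fixes g :: "real \<Rightarrow> 'x::banach" and T :: "'x \<Rightarrow> 'y::banach"
  assumes "bounded_linear T" "bint S g" "S \<in> sets borel"
  shows "integral S (\<lambda>r. T (g r)) = T (integral S g)"
  using integral_linear[OF bint_integrable_on[OF assms(2,3)] assms(1)] by (simp add: o_def)

section \<open>Translations and half lines\<close>

lemma has_integral_shift:
  fixes g :: "real \<Rightarrow> 'x::banach"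
  assumes "(g has_integral v) S"
  shows "((\<lambda>r. g (r + c)) has_integral v) {r. r + c \<in> S}"
proof -
  define G where "G r = (if r \<in> S then g r else 0)" for r
  have G: "(G has_integral v) UNIV"
    using assms by (simp add: G_def [abs_def] has_integral_restrict_UNIV)
  have shift: "((\<lambda>r. G (r + c)) has_integral integral {a + c..b + c} G) {a..b}" for a b
  proof -
    have "G integrable_on {a + c..b + c}"
      using G by (metis box_real(2) has_integral_integrable integrable_on_subcbox subset_UNIV)
    then have "((G \<circ> (+) c) has_integral integral {a + c..b + c} G) {a..b}"
      unfolding has_integral_shift_Icc_real by (rule integrable_integral)
    then show ?thesis by (simp add: o_def add.commute)
  qed
  have "((\<lambda>r. G (r + c)) has_integral v) UNIV"
    unfolding has_integral_alt'
  proof (intro conjI allI impI)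
    show "(\<lambda>r. if r \<in> UNIV then G (r + c) else 0) integrable_on cbox a b" for a b
      using shift[of a b] by (auto simp: integrable_on_def)
  next
    fix e :: real assume "0 < e"
    then obtain B where B: "B > 0" "\<And>a b. ball 0 B \<subseteq> cbox a b \<Longrightarrow> norm (integral (cbox a b) G - v) < e"
      using has_integral_exhausting_boxes[OF G \<open>0 < e\<close>] by auto
    show "\<exists>B>0. \<forall>a b. ball 0 B \<subseteq> cbox a b \<longrightarrow>
        norm (integral (cbox a b) (\<lambda>r. if r \<in> UNIV then G (r + c) else 0) - v) < e"
    \<comment> \<open>A box containing the ball enlarged by \<open>\<bar>c\<bar>\<close> still
      contains \<open>ball 0 B\<close> after translation by \<open>c\<close>.\<close>
    proof (intro exI[of _ "B + \<bar>c\<bar>"] conjI allI impI)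
      fix a b :: real assume sub: "ball 0 (B + \<bar>c\<bar>) \<subseteq> cbox a b"
      have "x \<in> {a + c..b + c}" if "x \<in> ball 0 B" for x
      proof -
        have "x - c \<in> ball 0 (B + \<bar>c\<bar>)" using that by auto
        then have "x - c \<in> cbox a b" using sub by blast
        then show ?thesis by auto
      qed
      then have "norm (integral (cbox (a + c) (b + c)) G - v) < e" by (intro B(2)) auto
      then show "norm (integral (cbox a b) (\<lambda>r. if r \<in> UNIV then G (r + c) else 0) - v) < e"
        using integral_unique[OF shift[of a b]] by simp
    qed (use B in simp)
  qed
  moreover have "(\<lambda>r. G (r + c)) = (\<lambda>r. if r \<in> {r. r + c \<in> S} then g (r + c) else 0)"
    by (auto simp: G_def)
  ultimately show ?thesis
    using has_integral_restrict_UNIV[of "{r. r + c \<in> S}" "\<lambda>r. g (r + c)" v] by simp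
qed

lemma bint_shift:
  fixes g :: "real \<Rightarrow> 'x::banach"
  assumes g: "bint S g" and S: "S \<in> sets borel"
  shows "bint {r. r + c \<in> S} (\<lambda>r. g (r + c))"
    "integral {r. r + c \<in> S} (\<lambda>r. g (r + c)) = integral S g"
proof -
  note [measurable] = norm_lebesgue_measurable[OF bint_measurable[OF g]]
  have [measurable]: "S \<in> sets lebesgue" using S by auto
  have "(\<integral>\<^sup>+r\<in>{r. r + c \<in> S}. ennreal (norm (g (r + c))) \<partial>lebesgue) =
      (\<integral>\<^sup>+r. ennreal (norm (g (c + 1 * r))) * indicator S (c + 1 * r) \<partial>lebesgue)"
    by (intro nn_integral_cong) (auto simp: indicator_def add.commute)
  also have "\<dots> = (\<integral>\<^sup>+r\<in>S. ennreal (norm (g r)) \<partial>lebesgue)"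
    by (subst nn_integral_real_affine_lebesgue[of _ 1 c]) auto
  finally have "(\<integral>\<^sup>+r\<in>{r. r + c \<in> S}. ennreal (norm (g (r + c))) \<partial>lebesgue) < \<infinity>"
    using g by (simp add: bint_def)
  moreover have "bochner_measurable borel (\<lambda>r. g (r + c))"
    by (rule bochner_measurable_compose[OF bint_measurable[OF g]]) measurable
  ultimately show "bint {r. r + c \<in> S} (\<lambda>r. g (r + c))" by (simp add: bint_def)
  show "integral {r. r + c \<in> S} (\<lambda>r. g (r + c)) = integral S g"
    using has_integral_shift[OF integrable_integral[OF bint_integrable_on[OF g S]]]
    by (rule integral_unique)
qed

text \<open>Convergence along the integers suffices, because it is compared with boundary terms
  taken along the same sequence.\<close>

lemma integral_half_line_limits:
  fixes g :: "real \<Rightarrow> 'x::banach"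
  shows "bint {..0} g \<Longrightarrow> (\<lambda>n. integral {- real n..0} g) \<longlonglongrightarrow> integral {..0} g"
    and "bint {0..} g \<Longrightarrow> (\<lambda>n. integral {0..real n} g) \<longlonglongrightarrow> integral {0..} g"
proof -
  have lim: "(\<lambda>n. integral (S \<inter> {- real n..real n}) g) \<longlonglongrightarrow> integral S g"
    if g: "bint S g" "S \<in> sets borel" for S
  proof (rule LIMSEQ_I)
    fix e :: real assume "0 < e"
    then obtain B where B: "B > 0" "\<And>a b. ball 0 B \<subseteq> cbox a b \<Longrightarrow>
        norm (integral (cbox a b) (\<lambda>x. if x \<in> S then g x else 0) - integral S g) < e"
      using has_integral_exhausting_boxes[OF integrable_integral[OF bint_integrable_on[OF g]] \<open>0 < e\<close>]
      by blast
    obtain N where N: "B \<le> real N" using real_arch_simple by blast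
    have "norm (integral (S \<inter> {- real n..real n}) g - integral S g) < e" if n: "n \<ge> N" for n
    proof -
      have "ball 0 B \<subseteq> cbox (- real n) (real n)"
        using N n by (auto simp: abs_less_iff)
      from B(2)[OF this] show ?thesis
        by (simp add: integral_restrict_Int Int_commute)
    qed
    then show "\<exists>N. \<forall>n\<ge>N. norm (integral (S \<inter> {- real n..real n}) g - integral S g) < e" by blast
  qed
  have "{..0} \<inter> {- real n..real n} = {- real n..0}" "{0..} \<inter> {- real n..real n} = {0..real n}" for n
    by auto
  then show "bint {..0} g \<Longrightarrow> (\<lambda>n. integral {- real n..0} g) \<longlonglongrightarrow> integral {..0} g"
    and "bint {0..} g \<Longrightarrow> (\<lambda>n. integral {0..real n} g) \<longlonglongrightarrow> integral {0..} g"
    using lim[of "{..0}"] lim[of "{0..}"] by simp_all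
qed

section \<open>Oriented integrals of locally integrable functions\<close>

text \<open>At least one of the two intervals has at most one point, so this is the oriented integral.\<close>

definition oint :: "real \<Rightarrow> real \<Rightarrow> (real \<Rightarrow> 'x::banach) \<Rightarrow> 'x" where
  "oint a b g = integral {a..b} g - integral {b..a} g"

definition locally_bint :: "(real \<Rightarrow> 'x::real_normed_vector) \<Rightarrow> bool" where
  "locally_bint g \<longleftrightarrow> (\<forall>a b. bint {a..b} g)"

lemma locally_bintD: "locally_bint g \<Longrightarrow> bint {a..b} g"
  by (simp add: locally_bint_def)

text \<open>The kernel bound for \<sigma> and the definition of a mild solution speak only of
  intervals with 0 as an end point.\<close>

lemma locally_bintI_symmetric:
  assumes "\<And>t. bint {min 0 t..max 0 t} g"
  shows "locally_bint g"
  unfolding locally_bint_def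
proof (intro allI)
  fix a b :: real
  have "bint ({min 0 (min a b)..max 0 (min a b)} \<union> {min 0 (max a b)..max 0 (max a b)}) g"
    using assms by (intro bint_Un) auto
  then show "bint {a..b} g" by (rule bint_subset) auto
qed

lemma locally_bint_linear:
  "bounded_linear T \<Longrightarrow> locally_bint g \<Longrightarrow> locally_bint (\<lambda>r. T (g r))"
  by (simp add: locally_bint_def bint_linear)

lemma locally_bint_diff:
  "locally_bint g \<Longrightarrow> locally_bint h \<Longrightarrow> locally_bint (\<lambda>r. g r - h r)"
  by (simp add: locally_bint_def bint_diff)

lemma locally_bint_shift:
  fixes g :: "real \<Rightarrow> 'x::banach"
  assumes "locally_bint g"
  shows "locally_bint (\<lambda>r. g (r + c))"
  unfolding locally_bint_def
proof (intro allI)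
  fix a b
  have "{r. r + c \<in> {a + c..b + c}} = {a..b}" by auto
  then show "bint {a..b} (\<lambda>r. g (r + c))"
    using bint_shift(1)[OF locally_bintD[OF assms, of "a + c" "b + c"], of c] by simp
qed

lemma oint_le: "a \<le> b \<Longrightarrow> oint a b g = integral {a..b} g"
  by (cases "a = b") (auto simp: oint_def)

lemma oint_ge: "b \<le> a \<Longrightarrow> oint a b g = - integral {b..a} g"
  by (cases "a = b") (auto simp: oint_def)

text \<open>Over a common left end point \<open>m\<close> the orientation disappears, and additivity
  of the oriented integral becomes cancellation.\<close>

lemma oint_base:
  assumes g: "locally_bint g" and "m \<le> a" "m \<le> b"
  shows "oint a b g = integral {m..b} g - integral {m..a} g"
proof -
  have comb: "integral {m..x} g + integral {x..y} g = integral {m..y} g" if "m \<le> x" "x \<le> y" for x y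
    using that by (intro Henstock_Kurzweil_Integration.integral_combine
        bint_integrable_on[OF locally_bintD[OF g]]) auto
  show ?thesis
  proof (cases "a \<le> b")
    case True
    then show ?thesis using comb[of a b] assms(2) by (simp add: oint_le algebra_simps)
  next
    case False
    then show ?thesis using comb[of b a] assms(3)
      by (simp add: oint_ge algebra_simps)
  qed
qed

lemma oint_combine:
  assumes "locally_bint g"
  shows "oint a b g + oint b c g = oint a c g"
  using oint_base[OF assms, of "min a (min b c)"] by simp

lemma oint_linear:
  assumes "bounded_linear T" "locally_bint g"
  shows "oint a b (\<lambda>r. T (g r)) = T (oint a b g)"
  by (simp add: oint_def integral_bounded_linear[OF assms(1) locally_bintD[OF assms(2)]]
      linear_diff[OF bounded_linear.linear[OF assms(1)]])

lemma oint_diff: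
  assumes "locally_bint g" "locally_bint h"
  shows "oint a b (\<lambda>r. g r - h r) = oint a b g - oint a b h"
  by (simp add: oint_def integral_diff bint_integrable_on[OF locally_bintD[OF assms(1)]]
      bint_integrable_on[OF locally_bintD[OF assms(2)]])

lemma oint_add:
  assumes "locally_bint g" "locally_bint h"
  shows "oint a b (\<lambda>r. g r + h r) = oint a b g + oint a b h"
  by (simp add: oint_def integral_add bint_integrable_on[OF locally_bintD[OF assms(1)]]
      bint_integrable_on[OF locally_bintD[OF assms(2)]])

lemma oint_shift:
  assumes g: "locally_bint g"
  shows "oint a b (\<lambda>r. g (r + c)) = oint (a + c) (b + c) g"
proof -
  have "integral {x..y} (\<lambda>r. g (r + c)) = integral {x + c..y + c} g" for x y
  proof -
    have "{r. r + c \<in> {x + c..y + c}} = {x..y}" by auto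
    then show ?thesis
      using bint_shift(2)[OF locally_bintD[OF g, of "x + c" "y + c"], of c] by simp
  qed
  then show ?thesis by (simp add: oint_def)
qed

lemma norm_oint: "norm (oint a b g) = norm (integral {min a b..max a b} g)"
  by (cases "a \<le> b") (auto simp: oint_le oint_ge)

lemma oint_bounded:
  assumes "locally_bint g"
  shows "\<exists>B\<ge>0. \<forall>t\<in>{-T..T}. norm (oint 0 t g) \<le> B"
proof -
  define I where "I = (\<integral>\<^sup>+r\<in>{-T..T}. ennreal (norm (g r)) \<partial>lebesgue)"
  have fin: "I < top" using locally_bintD[OF assms, of "-T" T] by (simp add: bint_def I_def)
  have "norm (oint 0 t g) \<le> enn2real I" if t: "t \<in> {-T..T}" for t
  proof -
    have "ennreal (norm (oint 0 t g)) \<le> (\<integral>\<^sup>+r\<in>{min 0 t..max 0 t}. ennreal (norm (g r)) \<partial>lebesgue)"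
      unfolding norm_oint by (intro norm_integral_le_nn_integral locally_bintD[OF assms]) simp
    also have "\<dots> \<le> I"
      unfolding I_def using t by (intro nn_integral_mono) (auto simp: indicator_def)
    also have "I = ennreal (enn2real I)" using fin by simp
    finally show ?thesis by (simp add: ennreal_le_iff)
  qed
  then show ?thesis by (intro exI[of _ "enn2real I"]) auto
qed

text \<open>The link between the notion in the definition of a mild solution and the calculus of
  \<open>oint\<close>. Uniqueness of the Bochner value is inherited from the gauge integral.\<close>

lemma has_oriented_int_iff:
  fixes g :: "real \<Rightarrow> 'x::banach"
  assumes g: "bochner_measurable borel g"
  shows "has_oriented_int g a b v \<longleftrightarrow> bint {min a b..max a b} g \<and> oint a b g = v"
proof -
  have *: "has_bochner_int (lebesgue_on {c..d}) g w \<longleftrightarrow> bint {c..d} g \<and> integral {c..d} g = w"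
    for c d w
  proof
    assume "has_bochner_int (lebesgue_on {c..d}) g w"
    then show "bint {c..d} g \<and> integral {c..d} g = w"
      using has_bochner_int_imp_bint[OF g] integral_unique[OF has_bochner_int_imp_has_integral, of "{c..d}" g w]
      by auto
  next
    assume r: "bint {c..d} g \<and> integral {c..d} g = w"
    then obtain w' where w': "has_bochner_int (lebesgue_on {c..d}) g w'"
      using bint_has_bochner_int[of "{c..d}" g] by auto
    then have "w' = w" using r integral_unique[OF has_bochner_int_imp_has_integral[OF w']] by auto
    then show "has_bochner_int (lebesgue_on {c..d}) g w" using w' by simp
  qed
  show ?thesis
    unfolding has_oriented_int_def * by (auto simp: oint_le oint_ge min_def max_def)
qed

lemma integral_half_line_diff:
  fixes g :: "real \<Rightarrow> 'x::banach"
  assumes "locally_bint g"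
  shows "bint {..a} g \<Longrightarrow> bint {..b} g \<Longrightarrow> integral {..b} g - integral {..a} g = oint a b g"
    and "bint {a..} g \<Longrightarrow> bint {b..} g \<Longrightarrow> integral {a..} g - integral {b..} g = oint a b g"
proof -
  note int = bint_integrable_on[OF locally_bintD[OF assms]]
  have lo: "integral {..y} g = integral {..x} g + integral {x..y} g"
    if "bint {..x} g" "x \<le> y" for x y
  proof -
    have "integral ({..x} \<union> {x..y}) g = integral {..x} g + integral {x..y} g"
    proof (rule Henstock_Kurzweil_Integration.integral_Un)
      have "{..x} \<inter> {x..y} = {x}" using that(2) by auto
      then show "negligible ({..x} \<inter> {x..y})" by simp
    qed (use bint_integrable_on[OF that(1)] int in auto)
    moreover have "{..x} \<union> {x..y} = {..y}" using that(2) by auto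
    ultimately show ?thesis by simp
  qed
  have hi: "integral {x..} g = integral {x..y} g + integral {y..} g"
    if "bint {y..} g" "x \<le> y" for x y
  proof -
    have "integral ({x..y} \<union> {y..}) g = integral {x..y} g + integral {y..} g"
    proof (rule Henstock_Kurzweil_Integration.integral_Un)
      have "{x..y} \<inter> {y..} = {y}" using that(2) by auto
      then show "negligible ({x..y} \<inter> {y..})" by simp
    qed (use bint_integrable_on[OF that(1)] int in auto)
    moreover have "{x..y} \<union> {y..} = {x..}" using that(2) by auto
    ultimately show ?thesis by simp
  qed
  show "integral {..b} g - integral {..a} g = oint a b g" if "bint {..a} g" "bint {..b} g"
  proof (cases "a \<le> b")
    case True
    then show ?thesis using lo[OF that(1) True] oint_le[OF True, of g] by (metis add_diff_cancel_left')
  next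
    case False
    then have "b \<le> a" by simp
    from lo[OF that(2) this] oint_ge[OF this, of g] show ?thesis by (metis minus_diff_eq add_diff_cancel_left')
  qed
  show "integral {a..} g - integral {b..} g = oint a b g" if "bint {a..} g" "bint {b..} g"
  proof (cases "a \<le> b")
    case True
    then show ?thesis using hi[OF that(2) True] oint_le[OF True, of g] by (metis add_diff_cancel_right')
  next
    case False
    then have "b \<le> a" by simp
    from hi[OF that(1) this] oint_ge[OF this, of g] show ?thesis by (metis minus_diff_eq add_diff_cancel_right')
  qed
qed

subsection \<open>Integrals depending on a parameter\<close>

text \<open>The bound by \<open>2 * norm (h r)\<close> is the one delivered by the simple
  approximation, so that a multiple of \<open>norm (h r)\<close> is the dominating function.\<close>

lemma bint_dominated_convergence:
  fixes h :: "real \<Rightarrow> 'x::banach"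
  assumes h: "bint S h" and S: "S \<in> sets borel" and s: "\<And>i. bochner_measurable borel (s i)"
    and lim: "\<And>r. (\<lambda>i. s i r) \<longlonglongrightarrow> h r" and le: "\<And>i r. norm (s i r) \<le> 2 * norm (h r)"
  shows "(\<lambda>i. integral S (s i)) \<longlonglongrightarrow> integral S h"
proof -
  have sb: "bint S (s i)" for i using bint_dominated[OF h s S, of 2] le by auto
  note [measurable] = norm_lebesgue_measurable[OF bint_measurable[OF h]]
    norm_lebesgue_measurable[OF bint_measurable[OF bint_diff[OF h sb S]]]
  have [measurable]: "S \<in> sets lebesgue" using S by auto
  have "(\<lambda>i. \<integral>\<^sup>+r\<in>S. ennreal (norm (h r - s i r)) \<partial>lebesgue) \<longlonglongrightarrow> (\<integral>\<^sup>+(r::real). 0 \<partial>lebesgue)"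
  proof (rule nn_integral_dominated_convergence[where w = "\<lambda>r. ennreal 3 * (ennreal (norm (h r)) * indicator S r)"])
    show "AE r in lebesgue. ennreal (norm (h r - s i r)) * indicator S r
        \<le> ennreal 3 * (ennreal (norm (h r)) * indicator S r)" for i
    proof (intro AE_I2)
      fix r
      have "norm (h r - s i r) \<le> 3 * norm (h r)"
        using norm_triangle_ineq4[of "h r" "s i r"] le[of i r] by simp
      then show "ennreal (norm (h r - s i r)) * indicator S r
          \<le> ennreal 3 * (ennreal (norm (h r)) * indicator S r)"
        by (auto simp: indicator_def ennreal_mult'[symmetric] simp del: ennreal_numeral intro!: ennreal_leI)
    qed
    have "(\<integral>\<^sup>+r. ennreal 3 * (ennreal (norm (h r)) * indicator S r) \<partial>lebesgue) =
        ennreal 3 * (\<integral>\<^sup>+r\<in>S. ennreal (norm (h r)) \<partial>lebesgue)"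
      by (rule nn_integral_cmult) measurable
    then show "(\<integral>\<^sup>+r. ennreal 3 * (ennreal (norm (h r)) * indicator S r) \<partial>lebesgue) < \<infinity>"
      using h by (simp add: bint_def ennreal_mult_less_top)
    show "AE r in lebesgue. (\<lambda>i. ennreal (norm (h r - s i r)) * indicator S r) \<longlonglongrightarrow> 0"
    proof (intro AE_I2)
      fix r
      have "(\<lambda>i. ennreal (norm (h r - s i r))) \<longlonglongrightarrow> ennreal (norm (h r - h r))"
        by (intro tendsto_intros lim)
      then show "(\<lambda>i. ennreal (norm (h r - s i r)) * indicator S r) \<longlonglongrightarrow> 0"
        by (auto simp: indicator_def)
    qed
  qed measurable
  then have nn: "(\<lambda>i. \<integral>\<^sup>+r\<in>S. ennreal (norm (h r - s i r)) \<partial>lebesgue) \<longlonglongrightarrow> 0" by simp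
  have bnd: "ennreal (norm (integral S (s i) - integral S h)) \<le>
      (\<integral>\<^sup>+r\<in>S. ennreal (norm (h r - s i r)) \<partial>lebesgue)" for i
    using norm_integral_le_nn_integral[OF bint_diff[OF h sb S, of i] S]
    by (simp add: integral_diff[OF bint_integrable_on[OF h S] bint_integrable_on[OF sb S]]
        norm_minus_commute)
  show ?thesis
  proof (rule LIMSEQ_I)
    fix e :: real assume e: "0 < e"
    have "\<forall>\<^sub>F i in sequentially. norm (integral S (s i) - integral S h) < e"
      using ennreal_tendsto_zero_small[OF nn e]
    proof eventually_elim
      case (elim i)
      then have "ennreal (norm (integral S (s i) - integral S h)) < ennreal e"
        using bnd[of i] by (rule le_less_trans[rotated])
      then show ?case using e by (simp add: ennreal_less_iff)
    qed
    then show "\<exists>N. \<forall>n\<ge>N. norm (integral S (s n) - integral S h) < e"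
      by (simp add: eventually_sequentially)
  qed
qed

text \<open>The integral is a finite combination of the values of \<open>s\<close>, with the
  measures of the sections of its level sets as coefficients; these depend measurably on
  \<open>p\<close> because \<open>lborel\<close> is sigma-finite.\<close>

lemma bochner_measurable_integral_simple:
  fixes s :: "'a \<times> real \<Rightarrow> 'x::banach"
  assumes s: "simple_function (N \<Otimes>\<^sub>M borel) s"
    and b: "\<And>p. p \<in> space N \<Longrightarrow> bint UNIV (\<lambda>r. s (p, r))"
  shows "bochner_measurable N (\<lambda>p. integral UNIV (\<lambda>r. s (p, r)))"
proof -
  define R where "R = s ` space (N \<Otimes>\<^sub>M (borel :: real measure))"
  have finR: "finite R" using s by (simp add: simple_function_def R_def)
  define Q where "Q v = s -` {v} \<inter> space (N \<Otimes>\<^sub>M (borel :: real measure))" for v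
  have Q: "Q v \<in> sets (N \<Otimes>\<^sub>M lborel)" for v
    using simple_functionD(2)[OF s, of "{v}"] sets_pair_measure_cong[of N N lborel "borel :: real measure"]
    by (simp add: Q_def)
  have int: "integral UNIV (\<lambda>r. s (p, r)) = (\<Sum>v\<in>R. measure lborel (Pair p -` Q v) *\<^sub>R v)"
    if p: "p \<in> space N" for p
  proof -
    have Qp: "Pair p -` Q v = {r. s (p, r) = v}" for v
      using p by (auto simp: Q_def space_pair_measure)
    have "Pair p -` Q v \<in> sets borel" for v
      using sets_Pair1[OF Q[of v], of p] by simp
    then have Qm: "{r. s (p, r) = v} \<in> sets borel" for v by (simp add: Qp)
    have sub: "range (\<lambda>r. s (p, r)) \<subseteq> R" using p by (auto simp: R_def space_pair_measure)
    have "simple_function lebesgue (\<lambda>r. s (p, r))"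
      unfolding simple_function_def
      using finite_subset[OF sub finR] Qm by (auto simp: vimage_def)
    moreover have "(\<integral>\<^sup>+r. ennreal (norm (s (p, r))) \<partial>lebesgue) < \<infinity>"
      using b[OF p] by (simp add: bint_def)
    ultimately have "Bochner_Integration.simple_bochner_integrable lebesgue (\<lambda>r. s (p, r))"
      by (rule simple_bochner_integrableI_bounded)
    from has_integral_simple_bochner[OF this]
    have "integral UNIV (\<lambda>r. s (p, r)) =
        (\<Sum>v\<in>range (\<lambda>r. s (p, r)). measure lebesgue {r. s (p, r) = v} *\<^sub>R v)"
      by (simp add: integral_unique simple_bochner_integral_def)
    also have "\<dots> = (\<Sum>v\<in>range (\<lambda>r. s (p, r)). measure lborel (Pair p -` Q v) *\<^sub>R v)"
      using Qm by (simp add: Qp)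
    also have "\<dots> = (\<Sum>v\<in>R. measure lborel (Pair p -` Q v) *\<^sub>R v)"
    \<comment> \<open>Summing over \<open>R\<close> instead of the values attained over
      \<open>p\<close> makes the index set independent of \<open>p\<close>; the new sections are
      empty.\<close>
    proof (rule sum.mono_neutral_left[OF finR sub], intro ballI)
      fix v assume "v \<in> R - range (\<lambda>r. s (p, r))"
      then have "{r. s (p, r) = v} = {}" by auto
      then show "measure lborel (Pair p -` Q v) *\<^sub>R v = 0" by (simp add: Qp)
    qed
    finally show ?thesis .
  qed
  have "(\<lambda>p. measure lborel (Pair p -` Q v)) \<in> borel_measurable N" for v
    unfolding measure_def using lborel.measurable_emeasure_Pair[OF Q] by measurable
  then have "bochner_measurable N (\<lambda>p. \<Sum>v\<in>R. measure lborel (Pair p -` Q v) *\<^sub>R v)"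
    by (intro bochner_measurable_sum bochner_measurable_scaleR bochner_measurable_const)
  then show ?thesis
    using bochner_measurable_cong[OF int, of N] by simp
qed

lemma bochner_measurable_section:
  assumes "bochner_measurable (N \<Otimes>\<^sub>M L) h" "p \<in> space N"
  shows "bochner_measurable L (\<lambda>r. h (p, r))"
  by (rule bochner_measurable_compose[OF assms(1)]) (use assms(2) in measurable)

text \<open>The measurability part of Fubini's theorem for Bochner integrals. Product approximants
  dominated by \<open>2 * norm (h p r)\<close> allow dominated convergence in every section.\<close>

lemma bochner_measurable_integral:
  fixes h :: "'a \<Rightarrow> real \<Rightarrow> 'x::banach"
  assumes h: "bochner_measurable (N \<Otimes>\<^sub>M borel) (\<lambda>(p, r). h p r)"
    and b: "\<And>p. p \<in> space N \<Longrightarrow> bint UNIV (h p)"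
  shows "bochner_measurable N (\<lambda>p. integral UNIV (h p))"
proof -
  obtain s where s: "\<And>i. simple_function (N \<Otimes>\<^sub>M borel) (s i)"
    "\<And>q. q \<in> space (N \<Otimes>\<^sub>M borel) \<Longrightarrow> (\<lambda>i. s i q) \<longlonglongrightarrow> (case q of (p, r) \<Rightarrow> h p r)"
    "\<And>i q. q \<in> space (N \<Otimes>\<^sub>M borel) \<Longrightarrow> norm (s i q) \<le> 2 * norm (case q of (p, r) \<Rightarrow> h p r)"
    using bochner_measurable_norm_approximation[OF h] by metis
  have sb: "bochner_measurable borel (\<lambda>r. s i (p, r))" if "p \<in> space N" for i p
    by (rule bochner_measurable_section[OF bochner_measurable_simple[OF s(1)] that])
  show ?thesis
  proof (rule bochner_measurable_limit)
    show "bochner_measurable N (\<lambda>p. integral UNIV (\<lambda>r. s i (p, r)))" for i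
    proof (rule bochner_measurable_integral_simple[OF s(1)])
      show "bint UNIV (\<lambda>r. s i (p, r))" if p: "p \<in> space N" for p
        using bint_dominated[OF b[OF p] sb[OF p, of i], of 2] s(3)[of "(p, _)" i] p
        by (auto simp: space_pair_measure)
    qed
    show "(\<lambda>i. integral UNIV (\<lambda>r. s i (p, r))) \<longlonglongrightarrow> integral UNIV (h p)" if p: "p \<in> space N" for p
      using bint_dominated_convergence[OF b[OF p] _ sb[OF p]] s(2,3)[of "(p, _)"] p
      by (auto simp: space_pair_measure)
  qed
qed

lemma bochner_measurable_set_integral:
  fixes h :: "'a \<Rightarrow> real \<Rightarrow> 'x::banach"
  assumes h: "bochner_measurable (N \<Otimes>\<^sub>M borel) (\<lambda>(p, r). h p r)"
    and S: "Measurable.pred (N \<Otimes>\<^sub>M borel) (\<lambda>(p, r). r \<in> S p)"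
    and b: "\<And>p. p \<in> space N \<Longrightarrow> bint (S p) (h p)"
  shows "bochner_measurable N (\<lambda>p. integral (S p) (h p))"
proof -
  have m: "bochner_measurable (N \<Otimes>\<^sub>M borel) (\<lambda>(p, r). if r \<in> S p then h p r else 0)"
    by (rule back_subst[of "bochner_measurable _", OF bochner_measurable_indicator[OF h S]]) auto
  have "bint UNIV (\<lambda>r. if r \<in> S p then h p r else 0)" if p: "p \<in> space N" for p
  proof -
    have "(\<integral>\<^sup>+r. ennreal (norm (if r \<in> S p then h p r else 0)) \<partial>lebesgue) =
        (\<integral>\<^sup>+r\<in>S p. ennreal (norm (h p r)) \<partial>lebesgue)"
      by (intro nn_integral_cong) (auto simp: indicator_def)
    then show ?thesis
      using b[OF p] bochner_measurable_section[OF m p] by (simp add: bint_def)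
  qed
  from bochner_measurable_integral[OF m this] show ?thesis
    by (simp add: integral_restrict_UNIV)
qed

section \<open>Lipschitz and contraction constants\<close>

lemma Lip_bounds:
  fixes g :: "'x::real_normed_vector \<Rightarrow> 'y::real_normed_vector"
  assumes "L-lipschitz_on UNIV g"
  shows "0 \<le> Lip g" and "norm (g x - g y) \<le> Lip g * norm (x - y)"
proof -
  have ne: "{L. L-lipschitz_on UNIV g} \<noteq> {}" using assms by auto
  show "0 \<le> Lip g"
    unfolding Lip_def by (rule cInf_greatest[OF ne]) (auto simp: lipschitz_on_def)
  show "norm (g x - g y) \<le> Lip g * norm (x - y)"
  proof (cases "x = y")
    case False
    have "norm (g x - g y) / norm (x - y) \<le> Lip g"
      unfolding Lip_def
    proof (rule cInf_greatest[OF ne])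
      fix L' assume "L' \<in> {L. L-lipschitz_on UNIV g}"
      then have "norm (g x - g y) \<le> L' * norm (x - y)"
        by (auto simp: lipschitz_on_def dist_norm)
      then show "norm (g x - g y) / norm (x - y) \<le> L'"
        using False by (simp add: divide_le_eq)
    qed
    then show ?thesis using False by (simp add: divide_le_eq)
  qed simp
qed

lemma geometric_limit:
  fixes s :: "nat \<Rightarrow> 'x::banach"
  assumes step: "\<And>n. norm (s (Suc n) - s n) \<le> c * q ^ n" and q: "0 \<le> q" "q < 1"
  shows "s \<longlonglongrightarrow> lim s" and "norm (lim s - s n) \<le> c * q ^ n / (1 - q)"
proof -
  have "summable (\<lambda>n. s (Suc n) - s n)"
    by (rule summable_comparison_test'[where g = "\<lambda>n. c * q ^ n" and N = 0])
       (use step q in \<open>auto intro!: summable_mult summable_geometric\<close>)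
  then have "convergent (\<lambda>n. \<Sum>k<n. s (Suc k) - s k)" by (simp add: summable_iff_convergent)
  then have "convergent (\<lambda>n. s n - s 0)" by (simp add: sum_lessThan_telescope)
  from convergent_add[OF this convergent_const[of "s 0"]] have "convergent s" by simp
  then show s: "s \<longlonglongrightarrow> lim s" by (simp add: convergent_LIMSEQ_iff)
  have c: "0 \<le> c" using order_trans[OF norm_ge_zero step[of 0]] by simp
  \<comment> \<open>The factor \<open>1 - q ^ k\<close> of the finite geometric sum makes the
    induction close and is dropped afterwards.\<close>
  have "norm (s (n + k) - s n) \<le> c * q ^ n * (1 - q ^ k) / (1 - q)" for k
  proof (induction k)
    case (Suc k)
    have "norm (s (n + Suc k) - s n) \<le> norm (s (Suc (n + k)) - s (n + k)) + norm (s (n + k) - s n)"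
      using norm_triangle_ineq[of "s (Suc (n + k)) - s (n + k)" "s (n + k) - s n"] by simp
    also have "\<dots> \<le> c * q ^ (n + k) + c * q ^ n * (1 - q ^ k) / (1 - q)"
      using step[of "n + k"] Suc by simp
    also have "\<dots> = c * q ^ n * (1 - q ^ Suc k) / (1 - q)"
      using q by (simp add: field_simps power_add)
    finally show ?case .
  qed simp
  also have "c * q ^ n * (1 - q ^ k) / (1 - q) \<le> c * q ^ n / (1 - q)" for k
    using c q by (intro divide_right_mono mult_left_le) auto
  finally have bd: "norm (s (n + k) - s n) \<le> c * q ^ n / (1 - q)" for k .
  have "(\<lambda>k. norm (s (n + k) - s n)) \<longlonglongrightarrow> norm (lim s - s n)"
    using LIMSEQ_ignore_initial_segment[OF s, of n] by (intro tendsto_intros) (simp add: add.commute)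
  then show "norm (lim s - s n) \<le> c * q ^ n / (1 - q)"
    by (rule Lim_bounded[where M = 0]) (use bd in auto)
qed

text \<open>The equation for \<open>L\<close> is linear with solution
  \<open>(1 + N) / (1 - s * (1 + N))\<close>. Then \<open>t * L \<le> N\<close> turns into
  \<open>(t + s * N) * (1 + N) \<le> N\<close>. Since \<open>1 + s * L = L / (1 + N)\<close>, it
  also yields \<open>(1 + s * L) * t \<le> N / (1 + N)\<close>, so the last inequality follows from
  \<open>s * (1 + N)^2 < 1\<close>.\<close>

lemma contraction_constants:
  fixes s t :: real
  assumes "0 < s" "0 < t" "s + t < 1 / 2"
  obtains N L where "0 < N" "N < 1" "0 < L" "L = (1 + N) * (1 + s * L)" "t * L \<le> N"
    "(1 + N) * s + (1 + s * L) * t < 1"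
proof -
  \<comment> \<open>The first inequality is \<open>s N\<^sup>2 - (1 - s - t) N + t \<le> 0\<close>. If \<open>t < s\<close>, take for \<open>N\<close> the geometric mean
    \<open>sqrt (t / s)\<close> of the roots, otherwise \<open>N / (1 + N) = s + t\<close>.\<close>
  have "\<exists>N. 0 < N \<and> N < 1 \<and> (t + s * N) * (1 + N) \<le> N \<and> s * (1 + N)^2 < 1"
  proof (cases "t < s")
    case True
    define a b where "a = sqrt s" and "b = sqrt t"
    have ab: "0 < b" "b < a" "s = a^2" "t = b^2" using assms True by (auto simp: a_def b_def)
    \<comment> \<open>Thus \<open>(a + b)^2 \<le> 2 * (s + t) < 1\<close>: this is where the bound
      1/2 enters in this case.\<close>
    have amgm: "2 * (a * b) \<le> s + t"
      using sum_squares_bound[of a b] by (simp add: ab(3,4))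
    have e1: "(t + s * (b / a)) * (1 + b / a) = (b / a) * (a + b)^2"
      using ab by (simp add: field_simps power2_eq_square)
    have "(a + b)^2 = s + t + 2 * (a * b)" by (simp add: ab(3,4) power2_sum)
    then have lt1: "(a + b)^2 < 1" using amgm assms(3) by linarith
    then have "(b / a) * (a + b)^2 \<le> b / a" using ab by (intro mult_left_le) auto
    moreover have "s * (1 + b / a)^2 = (a + b)^2"
      using ab by (simp add: field_simps power2_eq_square)
    ultimately show ?thesis
      using ab e1 lt1 by (intro exI[of _ "b / a"]) auto
  next
    case False
    define p where "p = s + t"
    define N where "N = p / (1 - p)"
    have p: "0 < p" "p < 1 / 2" "s \<le> p / 2" using assms False by (auto simp: p_def)
    then have N: "0 < N" "N < 1" "1 + N = 1 / (1 - p)" by (auto simp: N_def field_simps)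
    have "(t + s * N) * (1 + N) \<le> p * (1 + N)"
      using N assms by (intro mult_right_mono) (auto simp: p_def mult_left_le)
    also have "\<dots> = N" by (simp add: N(3)) (simp add: N_def)
    finally have "(t + s * N) * (1 + N) \<le> N" .
    moreover have "s * (1 + N)^2 < 1"
    proof -
      \<comment> \<open>As \<open>s\<close> is the smaller summand,
        \<open>s \<le> p / 2 < 1 / 4\<close>.\<close>
      have "(1 / 2) * (1 / 2) < (1 - p) * (1 - p)" using p by (intro mult_strict_mono) auto
      then have "s < (1 - p)^2" using p by (simp add: power2_eq_square)
      then show ?thesis using p by (simp add: N(3) power_divide divide_less_eq)
    qed
    ultimately show ?thesis using N by blast
  qed
  then obtain N where N: "0 < N" "N < 1" "(t + s * N) * (1 + N) \<le> N" "s * (1 + N)^2 < 1" by blast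
  define D where "D = 1 - s * (1 + N)"
  have "s * (1 + N) < 1"
    using N assms by (smt (verit) mult_le_cancel_left1 mult_left_mono power2_eq_square mult.assoc)
  then have D: "0 < D" by (simp add: D_def)
  define L where "L = (1 + N) / D"
  have L: "0 < L" "L * D = 1 + N" using D N by (auto simp: L_def)
  have Leq: "L = (1 + N) * (1 + s * L)"
    using L(2) by (simp add: D_def algebra_simps)
  have tL: "t * L \<le> N"
  proof -
    have "t * (1 + N) \<le> N * D" using N(3) by (simp add: D_def algebra_simps)
    then show ?thesis using D by (simp add: L_def divide_le_eq)
  qed
  have C: "1 + s * L = L / (1 + N)" using Leq N by (simp add: field_simps)
  have "(1 + s * L) * t \<le> N / (1 + N)"
    unfolding C using tL N by (simp add: divide_right_mono mult.commute)
  moreover have "(1 + N) * s < 1 / (1 + N)"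
    using N by (simp add: less_divide_eq power2_eq_square mult.commute mult.left_commute)
  moreover have "N / (1 + N) + 1 / (1 + N) = 1" using N by (simp add: field_simps)
  ultimately have "(1 + N) * s + (1 + s * L) * t < 1" by linarith
  then show thesis using that N L Leq tL by blast
qed

section \<open>The Lyapunov-Perron operator\<close>

text \<open>Here \<sigma> and \<tau> are real majorants of the two suprema, so that both can be
  positive even if a supremum is 0.\<close>

locale trichotomy_perturbation =
  fixes M :: "'w measure" and \<theta> :: "real \<Rightarrow> 'w \<Rightarrow> 'w"
    and \<Phi> :: "real \<Rightarrow> 'w \<Rightarrow> 'x \<Rightarrow> 'x::banach"
    and \<alpha>c \<alpha>s \<alpha>u :: "real \<Rightarrow> 'w \<Rightarrow> real"
    and Pc Ps Pu f :: "'w \<Rightarrow> 'x \<Rightarrow> 'x"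
    and \<sigma> \<tau> N L :: real
  assumes ds: "measure_preserving_ds M \<theta>"
    and lin: "bochner_linear_rds M \<theta> \<Phi>"
    and tri: "trichotomy M \<theta> \<Phi> \<alpha>c \<alpha>s \<alpha>u Pc Ps Pu"
    and pert: "f \<in> perturbations M \<theta> \<alpha>c \<alpha>s \<alpha>u"
    and sigma_le: "sigma_const M \<theta> \<alpha>c f \<le> ennreal \<sigma>"
    and tau_le: "tau_const M \<theta> \<alpha>c \<alpha>s \<alpha>u f \<le> ennreal \<tau>"
    and bounds: "0 < \<sigma>" "0 < \<tau>" "0 < N" "N < 1" "0 < L" "L = (1 + N) * (1 + \<sigma> * L)"
      "\<tau> * L \<le> N" "(1 + N) * \<sigma> + (1 + \<sigma> * L) * \<tau> < 1"
begin

section \<open>Elementary facts about the system, the projections and the perturbation\<close>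

lemma theta_measurable: "(\<lambda>(t, \<omega>). \<theta> t \<omega>) \<in> borel \<Otimes>\<^sub>M M \<rightarrow>\<^sub>M M"
  using ds by (simp add: measure_preserving_ds_def)

lemma theta_space[simp]: "\<omega> \<in> space M \<Longrightarrow> \<theta> t \<omega> \<in> space M"
  using measurable_space[OF theta_measurable, of "(t, \<omega>)"] by (simp add: space_pair_measure)

lemma theta_0[simp]: "\<omega> \<in> space M \<Longrightarrow> \<theta> 0 \<omega> = \<omega>"
  using ds by (simp add: measure_preserving_ds_def)

lemma theta_add: "\<omega> \<in> space M \<Longrightarrow> \<theta> t (\<theta> s \<omega>) = \<theta> (t + s) \<omega>"
  using ds by (simp add: measure_preserving_ds_def)

lemma Phi_linear: "\<omega> \<in> space M \<Longrightarrow> bounded_linear (\<Phi> t \<omega>)"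
  using lin by (simp add: bochner_linear_rds_def)

lemmas Phi_plus = linear_add[OF bounded_linear.linear[OF Phi_linear]]
  and Phi_minus = linear_diff[OF bounded_linear.linear[OF Phi_linear]]
  and Phi_zero = linear_0[OF bounded_linear.linear[OF Phi_linear]]

lemma Phi_0: "\<omega> \<in> space M \<Longrightarrow> \<Phi> 0 \<omega> x = x"
  using lin by (simp add: bochner_linear_rds_def bochner_rds_def)

lemma Phi_add: "\<omega> \<in> space M \<Longrightarrow> \<Phi> t (\<theta> s \<omega>) (\<Phi> s \<omega> x) = \<Phi> (t + s) \<omega> x"
  using lin by (simp add: bochner_linear_rds_def bochner_rds_def)

lemma ac_pos: "\<omega> \<in> space M \<Longrightarrow> 0 < \<alpha>c t \<omega>"
  using tri by (simp add: trichotomy_def)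

lemma as_pos: "\<omega> \<in> space M \<Longrightarrow> 0 \<le> t \<Longrightarrow> 0 < \<alpha>s t \<omega>"
  using tri by (simp add: trichotomy_def)

lemma au_pos: "\<omega> \<in> space M \<Longrightarrow> t \<le> 0 \<Longrightarrow> 0 < \<alpha>u t \<omega>"
  using tri by (simp add: trichotomy_def)

lemma P_projections:
  assumes "P \<in> {Pc, Ps, Pu}"
  shows "bochner_projections M P" "\<omega> \<in> space M \<Longrightarrow> bounded_linear (P \<omega>)"
    "\<omega> \<in> space M \<Longrightarrow> P \<omega> (P \<omega> x) = P \<omega> x"
    "\<omega> \<in> space M \<Longrightarrow> P (\<theta> t \<omega>) (\<Phi> t \<omega> x) = \<Phi> t \<omega> (P \<omega> x)"
proof -
  show "bochner_projections M P" using tri assms unfolding trichotomy_def by blast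
  then show "\<omega> \<in> space M \<Longrightarrow> bounded_linear (P \<omega>)" "\<omega> \<in> space M \<Longrightarrow> P \<omega> (P \<omega> x) = P \<omega> x"
    by (auto simp: bochner_projections_def fun_eq_iff)
  have "\<forall>t. \<forall>\<omega>\<in>space M. P (\<theta> t \<omega>) \<circ> \<Phi> t \<omega> = \<Phi> t \<omega> \<circ> P \<omega>"
    using tri assms unfolding trichotomy_def by blast
  then show "\<omega> \<in> space M \<Longrightarrow> P (\<theta> t \<omega>) (\<Phi> t \<omega> x) = \<Phi> t \<omega> (P \<omega> x)"
    by (auto simp: fun_eq_iff)
qed

lemma P_sum: "\<omega> \<in> space M \<Longrightarrow> Pc \<omega> x + Ps \<omega> x + Pu \<omega> x = x"
  using tri by (simp add: trichotomy_def)

lemma Pc_Ps: "\<omega> \<in> space M \<Longrightarrow> Pc \<omega> (Ps \<omega> x) = 0"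
  using tri by (simp add: trichotomy_def)

text \<open>Applying \<open>Pc\<close> to the decomposition of \<open>x\<close> leaves only this
  term besides \<open>Pc \<omega> x\<close>.\<close>

lemma Pc_Pu: "\<omega> \<in> space M \<Longrightarrow> Pc \<omega> (Pu \<omega> x) = 0"
proof -
  assume \<omega>: "\<omega> \<in> space M"
  note Pc = P_projections[of Pc, simplified]
  interpret bounded_linear "Pc \<omega>" using Pc(2)[OF \<omega>] .
  have "Pc \<omega> x = Pc \<omega> (Pc \<omega> x + Ps \<omega> x + Pu \<omega> x)" using P_sum[OF \<omega>] by simp
  then show ?thesis by (simp add: add Pc(3)[OF \<omega>] Pc_Ps[OF \<omega>])
qed

lemma onorm_bounds:
  assumes "\<omega> \<in> space M"
  shows "norm (\<Phi> t \<omega> (Pc \<omega> x)) \<le> \<alpha>c t \<omega> * norm x"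
    "0 \<le> t \<Longrightarrow> norm (\<Phi> t \<omega> (Ps \<omega> x)) \<le> \<alpha>s t \<omega> * norm x"
    "t \<le> 0 \<Longrightarrow> norm (\<Phi> t \<omega> (Pu \<omega> x)) \<le> \<alpha>u t \<omega> * norm x"
proof -
  have *: "norm (\<Phi> t \<omega> (P \<omega> x)) \<le> a * norm x"
    if "P \<in> {Pc, Ps, Pu}" "onorm (\<Phi> t \<omega> \<circ> P \<omega>) \<le> a" for P a
  proof -
    have "bounded_linear (\<Phi> t \<omega> \<circ> P \<omega>)"
      unfolding o_def using bounded_linear_compose[OF Phi_linear P_projections(2)] that(1) assms by blast
    from onorm[OF this, of x] show ?thesis
      using mult_right_mono[OF that(2) norm_ge_zero[of x]] by (simp add: o_def)
  qed
  show "norm (\<Phi> t \<omega> (Pc \<omega> x)) \<le> \<alpha>c t \<omega> * norm x"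
    by (rule *) (use tri assms in \<open>simp_all add: trichotomy_def\<close>)
  show "0 \<le> t \<Longrightarrow> norm (\<Phi> t \<omega> (Ps \<omega> x)) \<le> \<alpha>s t \<omega> * norm x"
    by (rule *) (use tri assms in \<open>simp_all add: trichotomy_def\<close>)
  show "t \<le> 0 \<Longrightarrow> norm (\<Phi> t \<omega> (Pu \<omega> x)) \<le> \<alpha>u t \<omega> * norm x"
    by (rule *) (use tri assms in \<open>simp_all add: trichotomy_def\<close>)
qed

lemma f_0: "\<omega> \<in> space M \<Longrightarrow> f \<omega> 0 = 0"
  using pert by (simp add: perturbations_def)

lemma f_lipschitz:
  assumes "\<omega> \<in> space M"
  shows "0 \<le> Lip (f \<omega>)" "norm (f \<omega> x - f \<omega> y) \<le> Lip (f \<omega>) * norm (x - y)"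
    "continuous_on UNIV (f \<omega>)"
proof -
  obtain K where K: "K-lipschitz_on UNIV (f \<omega>)" using pert assms by (auto simp: perturbations_def)
  show "0 \<le> Lip (f \<omega>)" "norm (f \<omega> x - f \<omega> y) \<le> Lip (f \<omega>) * norm (x - y)"
    using Lip_bounds[OF K] by auto
  show "continuous_on UNIV (f \<omega>)" using lipschitz_on_continuous_on[OF K] .
qed

text \<open>The evolution from time \<open>r\<close> to time \<open>t\<close> along the orbit of \<open>\<omega>\<close>.\<close>

definition W :: "'w \<Rightarrow> real \<Rightarrow> real \<Rightarrow> 'x \<Rightarrow> 'x" where
  "W \<omega> t r = \<Phi> (t - r) (\<theta> r \<omega>)"

lemma W_linear: "\<omega> \<in> space M \<Longrightarrow> bounded_linear (W \<omega> t r)"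
  by (simp add: W_def Phi_linear)

lemmas W_plus = linear_add[OF bounded_linear.linear[OF W_linear]]
  and W_minus = linear_diff[OF bounded_linear.linear[OF W_linear]]
  and W_zero = linear_0[OF bounded_linear.linear[OF W_linear]]

lemma W_refl[simp]: "\<omega> \<in> space M \<Longrightarrow> W \<omega> t t x = x"
  by (simp add: W_def Phi_0)

lemma W_trans: "\<omega> \<in> space M \<Longrightarrow> W \<omega> t s (W \<omega> s r x) = W \<omega> t r x"
  using Phi_add[of "\<theta> r \<omega>" "t - s" "s - r" x] by (simp add: W_def theta_add)

lemma W_shift: "\<omega> \<in> space M \<Longrightarrow> W (\<theta> s \<omega>) t r = W \<omega> (t + s) (r + s)"
  by (simp add: W_def theta_add)

lemma W_0: "\<omega> \<in> space M \<Longrightarrow> W \<omega> t 0 = \<Phi> t \<omega>"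
  by (simp add: W_def)

section \<open>Families of operators commuting with the linear flow\<close>

definition invariant_family :: "('w \<Rightarrow> 'x \<Rightarrow> 'x) \<Rightarrow> bool" where
  "invariant_family P \<longleftrightarrow> (\<forall>x. bochner_measurable M (\<lambda>\<omega>. P \<omega> x)) \<and>
    (\<forall>\<omega>\<in>space M. bounded_linear (P \<omega>)) \<and>
    (\<forall>\<omega>\<in>space M. \<forall>t x. P (\<theta> t \<omega>) (\<Phi> t \<omega> x) = \<Phi> t \<omega> (P \<omega> x))"

lemma invariant_families:
  "invariant_family Pc" "invariant_family Ps" "invariant_family Pu" "invariant_family (\<lambda>_ x. x)"
  using P_projections
  by (auto simp: invariant_family_def bochner_projections_def bochner_measurable_const)

lemma invariant_family_linear: "invariant_family P \<Longrightarrow> \<omega> \<in> space M \<Longrightarrow> bounded_linear (P \<omega>)"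
  by (simp add: invariant_family_def)

lemma invariant_family_W:
  "invariant_family P \<Longrightarrow> \<omega> \<in> space M \<Longrightarrow> P (\<theta> t \<omega>) (W \<omega> t r x) = W \<omega> t r (P (\<theta> r \<omega>) x)"
proof -
  assume P: "invariant_family P" and \<omega>: "\<omega> \<in> space M"
  then have "P (\<theta> (t - r) (\<theta> r \<omega>)) (\<Phi> (t - r) (\<theta> r \<omega>) x) = \<Phi> (t - r) (\<theta> r \<omega>) (P (\<theta> r \<omega>) x)"
    using theta_space[OF \<omega>] by (simp add: invariant_family_def)
  then show ?thesis using \<omega> by (simp add: W_def theta_add)
qed

section \<open>Measurability of the data along measurable arguments\<close>

lemma measurable_theta:
  assumes "a \<in> borel_measurable K" "w \<in> K \<rightarrow>\<^sub>M M"
  shows "(\<lambda>p. \<theta> (a p) (w p)) \<in> K \<rightarrow>\<^sub>M M"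
proof -
  have "(\<lambda>p. (a p, w p)) \<in> K \<rightarrow>\<^sub>M borel \<Otimes>\<^sub>M M" using assms by measurable
  from measurable_compose[OF this theta_measurable] show ?thesis by simp
qed

lemma measurable_Phi:
  assumes "a \<in> borel_measurable K" "w \<in> K \<rightarrow>\<^sub>M M" "bochner_measurable K y"
  shows "bochner_measurable K (\<lambda>p. \<Phi> (a p) (w p) (y p))"
proof (rule bochner_measurable_caratheodory[where g = "\<lambda>p. \<Phi> (a p) (w p)", OF assms(3)])
  have m: "(\<lambda>p. (a p, w p)) \<in> K \<rightarrow>\<^sub>M borel \<Otimes>\<^sub>M M" using assms by measurable
  have "bochner_measurable (borel \<Otimes>\<^sub>M M) (\<lambda>(t, \<omega>). \<Phi> t \<omega> v)" for v
    using lin by (simp add: bochner_linear_rds_def bochner_rds_def)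
  from bochner_measurable_compose[OF this m]
  show "bochner_measurable K (\<lambda>p. \<Phi> (a p) (w p) v)" for v by simp
  show "continuous_on UNIV (\<Phi> (a p) (w p))" if "p \<in> space K" for p
    using bounded_linear.continuous_on[OF Phi_linear[OF measurable_space[OF assms(2) that]] continuous_on_id]
    by simp
qed

lemma measurable_family:
  assumes P: "invariant_family P" and "w \<in> K \<rightarrow>\<^sub>M M" "bochner_measurable K y"
  shows "bochner_measurable K (\<lambda>p. P (w p) (y p))"
proof (rule bochner_measurable_caratheodory[where g = "\<lambda>p. P (w p)", OF assms(3)])
  show "bochner_measurable K (\<lambda>p. P (w p) v)" for v
    using P by (intro bochner_measurable_compose[OF _ assms(2)]) (simp add: invariant_family_def)
  show "continuous_on UNIV (P (w p))" if "p \<in> space K" for p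
    using bounded_linear.continuous_on[OF invariant_family_linear[OF P measurable_space[OF assms(2) that]]
        continuous_on_id] by simp
qed

lemma measurable_f:
  assumes "w \<in> K \<rightarrow>\<^sub>M M" "bochner_measurable K y"
  shows "bochner_measurable K (\<lambda>p. f (w p) (y p))"
proof (rule bochner_measurable_caratheodory[where g = "\<lambda>p. f (w p)", OF assms(2)])
  show "bochner_measurable K (\<lambda>p. f (w p) v)" for v
    using pert by (intro bochner_measurable_compose[OF _ assms(1)]) (simp add: perturbations_def)
qed (use f_lipschitz(3) measurable_space[OF assms(1)] in auto)

section \<open>The variation of constants integrand\<close>

text \<open>The \<open>P\<close>-component of the Duhamel integrand along \<open>u\<close>,
  transported from time \<open>r\<close> to the target time \<open>t\<close>.\<close>

definition G :: "('w \<Rightarrow> 'x \<Rightarrow> 'x) \<Rightarrow> 'w \<Rightarrow> real \<Rightarrow> (real \<Rightarrow> 'x) \<Rightarrow> real \<Rightarrow> 'x" where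
  "G P \<omega> t u r = W \<omega> t r (P (\<theta> r \<omega>) (f (\<theta> r \<omega>) (u r)))"

lemma measurable_G:
  assumes "invariant_family P" "w \<in> K \<rightarrow>\<^sub>M M" "a \<in> borel_measurable K" "b \<in> borel_measurable K"
    and y: "bochner_measurable K (\<lambda>p. u p (b p))"
  shows "bochner_measurable K (\<lambda>p. G P (w p) (a p) (u p) (b p))"
  unfolding G_def W_def
  by (rule measurable_Phi measurable_theta measurable_family[OF assms(1)] measurable_f y assms
      borel_measurable_diff)+

lemma measurable_G_section:
  assumes "invariant_family P" "\<omega> \<in> space M" "bochner_measurable borel u"
  shows "bochner_measurable borel (G P \<omega> t u)"
  by (rule measurable_G[OF assms(1), of "\<lambda>_. \<omega>" borel "\<lambda>_. t" "\<lambda>r. r" "\<lambda>_. u"])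
     (use assms in auto)

text \<open>Changing the target time is a bounded linear map that does not depend on
  \<open>r\<close>; integrability for one target time therefore gives it for all, and the integrals
  correspond under \<open>W\<close>.\<close>

lemma G_trans: "\<omega> \<in> space M \<Longrightarrow> W \<omega> t s (G P \<omega> s u r) = G P \<omega> t u r"
  by (simp add: G_def W_trans)

lemma G_shift: "\<omega> \<in> space M \<Longrightarrow> G P (\<theta> s \<omega>) t (\<lambda>r. u (r + s)) r = G P \<omega> (t + s) u (r + s)"
  by (simp add: G_def W_shift theta_add)

lemma G_family:
  assumes "invariant_family P" "\<omega> \<in> space M"
  shows "G P \<omega> t u r = P (\<theta> t \<omega>) (G (\<lambda>_ x. x) \<omega> t u r)"
  using invariant_family_W[OF assms] by (simp add: G_def)

lemma G_zero: "invariant_family P \<Longrightarrow> \<omega> \<in> space M \<Longrightarrow> G P \<omega> t (\<lambda>_. 0) r = 0"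
  by (simp add: G_def f_0 linear_0[OF bounded_linear.linear[OF invariant_family_linear]]
      W_zero)

abbreviation Lc :: "'w \<Rightarrow> real \<Rightarrow> real \<Rightarrow> real" where
  "Lc \<omega> t r \<equiv> \<alpha>c (t - r) (\<theta> r \<omega>) * Lip (f (\<theta> r \<omega>))"

lemma G_bounds:
  assumes \<omega>: "\<omega> \<in> space M"
  shows "norm (G Pc \<omega> t u r - G Pc \<omega> t v r)
      \<le> Lc \<omega> t r * norm (u r - v r)"
    "r \<le> t \<Longrightarrow> norm (G Ps \<omega> t u r - G Ps \<omega> t v r)
      \<le> \<alpha>s (t - r) (\<theta> r \<omega>) * Lip (f (\<theta> r \<omega>)) * norm (u r - v r)"
    "t \<le> r \<Longrightarrow> norm (G Pu \<omega> t u r - G Pu \<omega> t v r)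
      \<le> \<alpha>u (t - r) (\<theta> r \<omega>) * Lip (f (\<theta> r \<omega>)) * norm (u r - v r)"
proof -
  define z where "z = f (\<theta> r \<omega>) (u r) - f (\<theta> r \<omega>) (v r)"
  have z: "norm z \<le> Lip (f (\<theta> r \<omega>)) * norm (u r - v r)"
    unfolding z_def using f_lipschitz(2) \<omega> by simp
  have eq: "G P \<omega> t u r - G P \<omega> t v r = \<Phi> (t - r) (\<theta> r \<omega>) (P (\<theta> r \<omega>) z)"
    if P: "invariant_family P" for P
    by (simp add: G_def W_def z_def \<omega>
        linear_diff[OF bounded_linear.linear[OF invariant_family_linear[OF P theta_space[OF \<omega>]]]]
        Phi_minus[OF theta_space[OF \<omega>]])
  have *: "a * norm z \<le> a * Lip (f (\<theta> r \<omega>)) * norm (u r - v r)" if "0 < a" for a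
    using mult_left_mono[OF z, of a] that by (simp add: mult.assoc)
  note \<omega>' = theta_space[OF \<omega>, of r]
  show "norm (G Pc \<omega> t u r - G Pc \<omega> t v r)
      \<le> Lc \<omega> t r * norm (u r - v r)"
    unfolding eq[OF invariant_families(1)]
    by (rule order_trans[OF onorm_bounds(1)[OF \<omega>'] *[OF ac_pos[OF \<omega>']]])
  show "r \<le> t \<Longrightarrow> norm (G Ps \<omega> t u r - G Ps \<omega> t v r)
      \<le> \<alpha>s (t - r) (\<theta> r \<omega>) * Lip (f (\<theta> r \<omega>)) * norm (u r - v r)"
    unfolding eq[OF invariant_families(2)]
    by (rule order_trans[OF onorm_bounds(2)[OF \<omega>'] *[OF as_pos[OF \<omega>']]]) auto
  show "t \<le> r \<Longrightarrow> norm (G Pu \<omega> t u r - G Pu \<omega> t v r)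
      \<le> \<alpha>u (t - r) (\<theta> r \<omega>) * Lip (f (\<theta> r \<omega>)) * norm (u r - v r)"
    unfolding eq[OF invariant_families(3)]
    by (rule order_trans[OF onorm_bounds(3)[OF \<omega>'] *[OF au_pos[OF \<omega>']]]) auto
qed

section \<open>Kernel estimates from the two constants\<close>

definition kc :: "'w \<Rightarrow> real \<Rightarrow> real \<Rightarrow> real" where
  "kc \<omega> t r = Lc \<omega> t r * \<alpha>c r \<omega>"

abbreviation ks :: "'w \<Rightarrow> real \<Rightarrow> real" where
  "ks \<omega> r \<equiv> \<alpha>s (- r) (\<theta> r \<omega>) * Lip (f (\<theta> r \<omega>)) * \<alpha>c r \<omega>"

abbreviation ku :: "'w \<Rightarrow> real \<Rightarrow> real" where
  "ku \<omega> r \<equiv> \<alpha>u (- r) (\<theta> r \<omega>) * Lip (f (\<theta> r \<omega>)) * \<alpha>c r \<omega>"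

lemma sigma_bound:
  assumes \<omega>: "\<omega> \<in> space M"
  shows "(\<integral>\<^sup>+r\<in>{min 0 t..max 0 t}. ennreal (kc \<omega> t r) \<partial>lebesgue) \<le> ennreal (\<sigma> * \<alpha>c t \<omega>)"
proof -
  define I where "I = (\<integral>\<^sup>+r\<in>{min 0 t..max 0 t}. ennreal (kc \<omega> t r) \<partial>lebesgue)"
  have "ennreal (1 / \<alpha>c t \<omega>) * I \<le> sigma_const M \<theta> \<alpha>c f"
    unfolding sigma_const_def I_def kc_def
    by (rule SUP_upper2[of "(t, \<omega>)"]) (use \<omega> in auto)
  then have le: "ennreal (1 / \<alpha>c t \<omega>) * I \<le> ennreal \<sigma>" using sigma_le by (rule order_trans)
  have "I = ennreal (\<alpha>c t \<omega>) * (ennreal (1 / \<alpha>c t \<omega>) * I)"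
    using ac_pos[OF \<omega>, of t] by (simp add: mult.assoc[symmetric] ennreal_mult[symmetric])
  also have "\<dots> \<le> ennreal (\<alpha>c t \<omega>) * ennreal \<sigma>" by (intro mult_left_mono le) simp
  also have "\<dots> = ennreal (\<sigma> * \<alpha>c t \<omega>)"
    using ac_pos[OF \<omega>, of t] bounds(1) by (simp add: ennreal_mult[symmetric] mult.commute)
  finally show ?thesis by (simp add: I_def)
qed

text \<open>The supremum bounds only the sum of the two integrals. The splitting of \<tau> into
  \<open>Bs\<close> and \<open>Bu\<close> thus depends on \<omega>, and the parts are recombined in
  \<open>Ksu_diff\<close>.\<close>

lemma tau_bound:
  assumes \<omega>: "\<omega> \<in> space M"
  shows "\<exists>Bs Bu. 0 \<le> Bs \<and> 0 \<le> Bu \<and> Bs + Bu \<le> \<tau> \<and>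
    (\<integral>\<^sup>+r\<in>{..0}. ennreal (ks \<omega> r) \<partial>lebesgue) \<le> ennreal Bs \<and>
    (\<integral>\<^sup>+r\<in>{0..}. ennreal (ku \<omega> r) \<partial>lebesgue) \<le> ennreal Bu"
proof -
  define S where "S = (\<integral>\<^sup>+r\<in>{..0}. ennreal (ks \<omega> r) \<partial>lebesgue)"
  define U where "U = (\<integral>\<^sup>+r\<in>{0..}. ennreal (ku \<omega> r) \<partial>lebesgue)"
  have "S + U \<le> tau_const M \<theta> \<alpha>c \<alpha>s \<alpha>u f"
    unfolding tau_const_def S_def U_def by (rule SUP_upper[OF \<omega>])
  then have le: "S + U \<le> ennreal \<tau>" using tau_le by (rule order_trans)
  then have "S + U < top" by (rule le_less_trans) simp
  then have S: "S = ennreal (enn2real S)" and U: "U = ennreal (enn2real U)" by auto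
  have "ennreal (enn2real S + enn2real U) \<le> ennreal \<tau>" using le S U by (simp add: ennreal_plus)
  then have "enn2real S + enn2real U \<le> \<tau>" using bounds(2) by (simp add: ennreal_le_iff del: ennreal_plus)
  then show ?thesis
    using S U unfolding S_def[symmetric] U_def[symmetric]
    by (intro exI[of _ "enn2real S"] exI[of _ "enn2real U"]) simp
qed

lemma Gc_bint:
  assumes \<omega>: "\<omega> \<in> space M" and u: "bochner_measurable borel u" and m: "0 \<le> m"
    and le: "\<And>r. r \<in> {min 0 t..max 0 t} \<Longrightarrow> norm (u r) \<le> m * \<alpha>c r \<omega>"
  shows "bint {min 0 t..max 0 t} (G Pc \<omega> t u)"
proof (rule bint_bound(1)[where m = m and k = "kc \<omega> t", OF _ _ m _ _ sigma_bound[OF \<omega>]])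
  show "bochner_measurable borel (G Pc \<omega> t u)"
    by (rule measurable_G_section[OF invariant_families(1) \<omega> u])
  show "0 \<le> \<sigma> * \<alpha>c t \<omega>" using ac_pos[OF \<omega>, of t] bounds(1) by simp
  fix r assume r: "r \<in> {min 0 t..max 0 t}"
  have "norm (G Pc \<omega> t u r) \<le> Lc \<omega> t r * norm (u r)"
    using G_bounds(1)[OF \<omega>, of t u r "\<lambda>_. 0"] by (simp add: G_zero[OF invariant_families(1) \<omega>])
  also have "\<dots> \<le> Lc \<omega> t r * (m * \<alpha>c r \<omega>)"
    using le[OF r] ac_pos[of "\<theta> r \<omega>" "t - r"] f_lipschitz(1)[of "\<theta> r \<omega>"] \<omega> by (intro mult_left_mono) auto
  finally show "norm (G Pc \<omega> t u r) \<le> m * kc \<omega> t r" by (simp add: kc_def mult_ac)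
qed auto

lemma norm_oint_kc:
  assumes \<omega>: "\<omega> \<in> space M" and g: "locally_bint g" and m: "0 \<le> m"
    and le: "\<And>r. r \<in> {min 0 t..max 0 t} \<Longrightarrow> norm (g r) \<le> m * kc \<omega> t r"
  shows "norm (oint 0 t g) \<le> m * (\<sigma> * \<alpha>c t \<omega>)"
  unfolding norm_oint
proof (rule bint_bound(2)[where m = m and k = "kc \<omega> t", OF _ _ m _ le sigma_bound[OF \<omega>]])
  show "bochner_measurable borel g" using bint_measurable[OF locally_bintD[OF g, of 0 0]] .
  show "0 \<le> \<sigma> * \<alpha>c t \<omega>" using ac_pos[OF \<omega>, of t] bounds(1) by simp
qed auto

text \<open>Boundedness in the weighted sup norm with weight \<alpha>c. The bound \<open>m\<close>
  is a parameter, which spares the supremum.\<close>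

definition trajectory :: "'w \<Rightarrow> real \<Rightarrow> (real \<Rightarrow> 'x) \<Rightarrow> bool" where
  "trajectory \<omega> m u \<longleftrightarrow> 0 \<le> m \<and> bochner_measurable borel u \<and> (\<forall>r. norm (u r) \<le> m * \<alpha>c r \<omega>)"

text \<open>In the hypothesis the target time moves with the end point of the interval;
  \<open>W\<close> brings all of them to one target time.\<close>

lemma locally_bint_G:
  assumes \<omega>: "\<omega> \<in> space M" and b: "\<And>t. bint {min 0 t..max 0 t} (G P \<omega> t u)"
  shows "locally_bint (G P \<omega> t u)"
proof (rule locally_bintI_symmetric)
  fix s show "bint {min 0 s..max 0 s} (G P \<omega> t u)"
    using bint_linear[OF W_linear[OF \<omega>] b, of s t s] by (simp add: G_trans[OF \<omega>])
qed

lemma trajectory_Gc: "\<omega> \<in> space M \<Longrightarrow> trajectory \<omega> m u \<Longrightarrow> locally_bint (G Pc \<omega> t u)"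
  by (rule locally_bint_G) (auto simp: trajectory_def intro!: Gc_bint)

text \<open>Variation of constants at time 0 with initial times minus infinity in the stable and
  plus infinity in the unstable directions, both boundary terms being set to 0.\<close>

definition Ksu :: "'w \<Rightarrow> (real \<Rightarrow> 'x) \<Rightarrow> 'x" where
  "Ksu \<omega> u = integral {..0} (G Ps \<omega> 0 u) - integral {0..} (G Pu \<omega> 0 u)"

lemma Ksu_diff:
  assumes \<omega>: "\<omega> \<in> space M" and u: "trajectory \<omega> m1 u" and v: "trajectory \<omega> m2 v"
    and m: "0 \<le> m" and le: "\<And>r. norm (u r - v r) \<le> m * \<alpha>c r \<omega>"
  shows "bint {..0} (G Ps \<omega> 0 u)" "bint {0..} (G Pu \<omega> 0 u)"
    "norm (Ksu \<omega> u - Ksu \<omega> v) \<le> \<tau> * m"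
proof -
  obtain Bs Bu where B: "0 \<le> Bs" "0 \<le> Bu" "Bs + Bu \<le> \<tau>" and nn:
    "(\<integral>\<^sup>+r\<in>{..0}. ennreal (ks \<omega> r) \<partial>lebesgue) \<le> ennreal Bs"
    "(\<integral>\<^sup>+r\<in>{0..}. ennreal (ku \<omega> r) \<partial>lebesgue) \<le> ennreal Bu"
    using tau_bound[OF \<omega>] by (elim exE conjE)
  have bm: "bochner_measurable borel (\<lambda>r. G P \<omega> 0 u' r - G P \<omega> 0 v' r)"
    if "trajectory \<omega> m1' u'" "trajectory \<omega> m2' v'" "invariant_family P" for m1' m2' u' v' P
    using that by (intro bochner_measurable_diff measurable_G_section \<omega>) (auto simp: trajectory_def)
  have les: "norm (G Ps \<omega> 0 u' r - G Ps \<omega> 0 v' r) \<le>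
      m' * (ks \<omega> r)"
    if "norm (u' r - v' r) \<le> m' * \<alpha>c r \<omega>" "r \<in> {..0}" for u' v' m' r
  proof -
    have "norm (G Ps \<omega> 0 u' r - G Ps \<omega> 0 v' r) \<le> \<alpha>s (- r) (\<theta> r \<omega>) * Lip (f (\<theta> r \<omega>)) * norm (u' r - v' r)"
      using G_bounds(2)[OF \<omega>, of r 0 u' v'] that(2) by simp
    also have "\<dots> \<le> \<alpha>s (- r) (\<theta> r \<omega>) * Lip (f (\<theta> r \<omega>)) * (m' * \<alpha>c r \<omega>)"
      using that as_pos[of "\<theta> r \<omega>" "-r"] f_lipschitz(1)[of "\<theta> r \<omega>"] \<omega> by (intro mult_left_mono) auto
    finally show ?thesis by (simp add: mult_ac)
  qed
  have leu: "norm (G Pu \<omega> 0 u' r - G Pu \<omega> 0 v' r) \<le>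
      m' * (ku \<omega> r)"
    if "norm (u' r - v' r) \<le> m' * \<alpha>c r \<omega>" "r \<in> {0..}" for u' v' m' r
  proof -
    have "norm (G Pu \<omega> 0 u' r - G Pu \<omega> 0 v' r) \<le> \<alpha>u (- r) (\<theta> r \<omega>) * Lip (f (\<theta> r \<omega>)) * norm (u' r - v' r)"
      using G_bounds(3)[OF \<omega>, of 0 r u' v'] that(2) by simp
    also have "\<dots> \<le> \<alpha>u (- r) (\<theta> r \<omega>) * Lip (f (\<theta> r \<omega>)) * (m' * \<alpha>c r \<omega>)"
      using that au_pos[of "\<theta> r \<omega>" "-r"] f_lipschitz(1)[of "\<theta> r \<omega>"] \<omega> by (intro mult_left_mono) auto
    finally show ?thesis by (simp add: mult_ac)
  qed
  have b: "bint {..0} (G Ps \<omega> 0 u')" "bint {0..} (G Pu \<omega> 0 u')" if u': "trajectory \<omega> m' u'" for m' u'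
  proof -
    \<comment> \<open>Comparison with the zero trajectory, along which \<open>G\<close> vanishes,
      turns the difference estimates into integrability.\<close>
    have 0: "trajectory \<omega> 0 (\<lambda>_. 0)" using ac_pos[OF \<omega>]
      by (simp add: trajectory_def bochner_measurable_const)
    have m': "0 \<le> m'" "\<And>r. norm (u' r - 0) \<le> m' * \<alpha>c r \<omega>" using u' by (auto simp: trajectory_def)
    show "bint {..0} (G Ps \<omega> 0 u')"
      using bint_bound(1)[OF bm[OF u' 0 invariant_families(2)] _ m'(1) B(1) les[OF m'(2)] nn(1)]
      by (simp add: G_zero[OF invariant_families(2) \<omega>])
    show "bint {0..} (G Pu \<omega> 0 u')"
      using bint_bound(1)[OF bm[OF u' 0 invariant_families(3)] _ m'(1) B(2) leu[OF m'(2)] nn(2)]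
      by (simp add: G_zero[OF invariant_families(3) \<omega>])
  qed
  show "bint {..0} (G Ps \<omega> 0 u)" "bint {0..} (G Pu \<omega> 0 u)" using b[OF u] by auto
  have "Ksu \<omega> u - Ksu \<omega> v = integral {..0} (\<lambda>r. G Ps \<omega> 0 u r - G Ps \<omega> 0 v r)
      - integral {0..} (\<lambda>r. G Pu \<omega> 0 u r - G Pu \<omega> 0 v r)"
    unfolding Ksu_def using b[OF u] b[OF v] by (simp add: integral_diff bint_integrable_on)
  then have "norm (Ksu \<omega> u - Ksu \<omega> v) \<le> norm (integral {..0} (\<lambda>r. G Ps \<omega> 0 u r - G Ps \<omega> 0 v r))
      + norm (integral {0..} (\<lambda>r. G Pu \<omega> 0 u r - G Pu \<omega> 0 v r))"
    by (simp add: norm_triangle_ineq4)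
  also have "\<dots> \<le> m * Bs + m * Bu"
    using bint_bound(2)[OF bm[OF u v invariant_families(2)] _ m B(1) les[OF le] nn(1)]
      bint_bound(2)[OF bm[OF u v invariant_families(3)] _ m B(2) leu[OF le] nn(2)]
    by (intro add_mono) auto
  also have "\<dots> \<le> \<tau> * m"
    using mult_left_mono[OF B(3) m] by (simp add: algebra_simps)
  finally show "norm (Ksu \<omega> u - Ksu \<omega> v) \<le> \<tau> * m" .
qed

section \<open>The operator and its Lipschitz estimates\<close>

text \<open>Lipschitz constant of \<open>X\<close> relative to \<alpha>c: 1 comes from the linear
  flow and \<open>\<sigma> * L\<close> from the integral.\<close>

definition C :: real where "C = 1 + \<sigma> * L"

lemma C_bounds: "0 < C" "(1 + N) * C = L" "\<tau> * L \<le> N" "1 \<le> C"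
  using bounds by (auto simp: C_def add_pos_pos)

lemma Pc_facts:
  assumes "\<omega> \<in> space M"
  shows "Pc \<omega> (Pc \<omega> x) = Pc \<omega> x" "Pc \<omega> 0 = 0" "Pc \<omega> (x + y) = Pc \<omega> x + Pc \<omega> y"
    "Pc \<omega> (x - y) = Pc \<omega> x - Pc \<omega> y"
  using P_projections(3)[of Pc] linear_0 linear_add linear_diff
    bounded_linear.linear[OF P_projections(2)[of Pc]] assms by blast+

text \<open>The parameter \<xi> runs through the whole space, but a flow with the Lipschitz bound
  below depends on \<open>Pc \<omega> \<xi>\<close> only. This avoids maps on subspaces varying with
  \<omega>.\<close>

definition X :: "(real \<Rightarrow> 'w \<Rightarrow> 'x \<Rightarrow> 'x) \<Rightarrow> real \<Rightarrow> 'w \<Rightarrow> 'x \<Rightarrow> 'x" where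
  "X V t \<omega> \<xi> = \<Phi> t \<omega> (Pc \<omega> \<xi>) + oint 0 t (G Pc \<omega> t (\<lambda>r. V r \<omega> \<xi>))"

definition Y :: "(real \<Rightarrow> 'w \<Rightarrow> 'x \<Rightarrow> 'x) \<Rightarrow> 'w \<Rightarrow> 'x \<Rightarrow> 'x" where
  "Y V \<omega> \<xi> = Ksu \<omega> (\<lambda>r. V r \<omega> \<xi>)"

definition LP :: "(real \<Rightarrow> 'w \<Rightarrow> 'x \<Rightarrow> 'x) \<Rightarrow> real \<Rightarrow> 'w \<Rightarrow> 'x \<Rightarrow> 'x" where
  "LP V t \<omega> \<xi> = X V t \<omega> \<xi> + Y V (\<theta> t \<omega>) (X V t \<omega> \<xi>)"

text \<open>Measurability is required in \<open>t\<close> only, because \<open>\<Psi>\<close> need not be continuous in the initial value and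
  so its orbits on an invariant section are not known to be jointly measurable.\<close>

definition lipschitz_flow :: "(real \<Rightarrow> 'w \<Rightarrow> 'x \<Rightarrow> 'x) \<Rightarrow> bool" where
  "lipschitz_flow V \<longleftrightarrow> (\<forall>\<omega>\<in>space M.
     (\<forall>\<xi>. bochner_measurable borel (\<lambda>t. V t \<omega> \<xi>)) \<and> (\<forall>t. V t \<omega> 0 = 0) \<and>
     (\<forall>t \<xi> \<xi>'. norm (V t \<omega> \<xi> - V t \<omega> \<xi>') \<le> L * \<alpha>c t \<omega> * norm (Pc \<omega> (\<xi> - \<xi>'))))"

lemma lipschitz_flowD:
  assumes "lipschitz_flow V" "\<omega> \<in> space M"
  shows "V t \<omega> 0 = 0" "norm (V t \<omega> \<xi> - V t \<omega> \<xi>') \<le> L * \<alpha>c t \<omega> * norm (Pc \<omega> (\<xi> - \<xi>'))"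
    "trajectory \<omega> (L * norm (Pc \<omega> \<xi>)) (\<lambda>r. V r \<omega> \<xi>)"
proof -
  show 0: "V t \<omega> 0 = 0" and l: "norm (V t \<omega> \<xi> - V t \<omega> \<xi>') \<le> L * \<alpha>c t \<omega> * norm (Pc \<omega> (\<xi> - \<xi>'))"
    for t \<xi>' using assms by (auto simp: lipschitz_flow_def)
  have "norm (V t \<omega> \<xi>) \<le> L * norm (Pc \<omega> \<xi>) * \<alpha>c t \<omega>" for t
    using l[of t 0] by (simp add: 0 mult_ac)
  then show "trajectory \<omega> (L * norm (Pc \<omega> \<xi>)) (\<lambda>r. V r \<omega> \<xi>)"
    using assms bounds(5) by (auto simp: trajectory_def lipschitz_flow_def)
qed

lemma Pc_oint:
  assumes "\<omega> \<in> space M" "locally_bint (G Pc \<omega> t u)"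
  shows "Pc (\<theta> t \<omega>) (oint 0 t (G Pc \<omega> t u)) = oint 0 t (G Pc \<omega> t u)"
proof -
  have "Pc (\<theta> t \<omega>) (G Pc \<omega> t u r) = G Pc \<omega> t u r" for r
    using assms by (simp add: G_def invariant_family_W[OF invariant_families(1)] Pc_facts)
  then show ?thesis
    using oint_linear[OF P_projections(2)[of Pc] assms(2), of "\<theta> t \<omega>" 0 t] assms(1) by simp
qed

lemma Pc_X:
  assumes "lipschitz_flow V" "\<omega> \<in> space M"
  shows "Pc (\<theta> t \<omega>) (X V t \<omega> \<xi>) = X V t \<omega> \<xi>"
proof -
  have "Pc (\<theta> t \<omega>) (\<Phi> t \<omega> (Pc \<omega> \<xi>)) = \<Phi> t \<omega> (Pc \<omega> \<xi>)"
    using P_projections(4)[of Pc] assms(2) by (simp add: Pc_facts)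
  then show ?thesis
    using Pc_oint[OF assms(2) trajectory_Gc[OF assms(2) lipschitz_flowD(3)[OF assms]]]
    by (simp add: X_def Pc_facts assms(2))
qed

lemma Y_components:
  assumes "lipschitz_flow V" and \<omega>: "\<omega> \<in> space M"
  shows "Ps \<omega> (integral {..0} (G Ps \<omega> 0 (\<lambda>r. V r \<omega> \<xi>))) = integral {..0} (G Ps \<omega> 0 (\<lambda>r. V r \<omega> \<xi>))"
    "Pu \<omega> (integral {0..} (G Pu \<omega> 0 (\<lambda>r. V r \<omega> \<xi>))) = integral {0..} (G Pu \<omega> 0 (\<lambda>r. V r \<omega> \<xi>))"
    "Pc \<omega> (Y V \<omega> \<xi>) = 0"
proof -
  note tr = lipschitz_flowD(3)[OF assms, of \<xi>]
  have b: "bint {..0} (G Ps \<omega> 0 (\<lambda>r. V r \<omega> \<xi>))" "bint {0..} (G Pu \<omega> 0 (\<lambda>r. V r \<omega> \<xi>))"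
    by (rule Ksu_diff(1,2)[OF \<omega> tr tr order_refl]; simp add: ac_pos[OF \<omega>])+
  have id: "P \<omega> (G P \<omega> 0 u r) = G P \<omega> 0 u r" if "P \<in> {Ps, Pu}" for P u r
  proof -
    have P: "invariant_family P" "P \<in> {Pc, Ps, Pu}" using that invariant_families by auto
    show ?thesis
      using invariant_family_W[OF P(1) \<omega>, of 0] P_projections(3)[OF P(2)] \<omega> by (simp add: G_def)
  qed
  show s: "Ps \<omega> (integral {..0} (G Ps \<omega> 0 (\<lambda>r. V r \<omega> \<xi>))) = integral {..0} (G Ps \<omega> 0 (\<lambda>r. V r \<omega> \<xi>))"
    using integral_bounded_linear[OF P_projections(2)[of Ps, OF _ \<omega>] b(1)] id[of Ps] by simp
  show u: "Pu \<omega> (integral {0..} (G Pu \<omega> 0 (\<lambda>r. V r \<omega> \<xi>))) = integral {0..} (G Pu \<omega> 0 (\<lambda>r. V r \<omega> \<xi>))"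
    using integral_bounded_linear[OF P_projections(2)[of Pu, OF _ \<omega>] b(2)] id[of Pu] by simp
  have "Pc \<omega> (integral {..0} (G Ps \<omega> 0 (\<lambda>r. V r \<omega> \<xi>))) = 0"
    by (subst s[symmetric]) (rule Pc_Ps[OF \<omega>])
  moreover have "Pc \<omega> (integral {0..} (G Pu \<omega> 0 (\<lambda>r. V r \<omega> \<xi>))) = 0"
    by (subst u[symmetric]) (rule Pc_Pu[OF \<omega>])
  ultimately show "Pc \<omega> (Y V \<omega> \<xi>) = 0"
    by (simp add: Y_def Ksu_def Pc_facts[OF \<omega>])
qed

text \<open>One estimate for two purposes: with \<open>V = V'\<close> it gives the Lipschitz bound,
  with \<open>\<xi> = \<xi>'\<close> the contraction. The linear terms are removed so that only an
  integral is estimated.\<close>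

lemma X_diff:
  assumes V: "lipschitz_flow V" "lipschitz_flow V'" and \<omega>: "\<omega> \<in> space M" and m: "0 \<le> m"
    and le: "\<And>r. norm (V r \<omega> \<xi> - V' r \<omega> \<xi>') \<le> m * \<alpha>c r \<omega>"
  shows "norm ((X V t \<omega> \<xi> - \<Phi> t \<omega> (Pc \<omega> \<xi>)) - (X V' t \<omega> \<xi>' - \<Phi> t \<omega> (Pc \<omega> \<xi>'))) \<le> \<sigma> * m * \<alpha>c t \<omega>"
proof -
  note lb = trajectory_Gc[OF \<omega> lipschitz_flowD(3)[OF V(1) \<omega>]]
    trajectory_Gc[OF \<omega> lipschitz_flowD(3)[OF V(2) \<omega>]]
  have "norm (oint 0 t (\<lambda>r. G Pc \<omega> t (\<lambda>r. V r \<omega> \<xi>) r - G Pc \<omega> t (\<lambda>r. V' r \<omega> \<xi>') r)) \<le> m * (\<sigma> * \<alpha>c t \<omega>)"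
  proof (rule norm_oint_kc[OF \<omega> locally_bint_diff[OF lb] m])
    fix r
    have "norm (G Pc \<omega> t (\<lambda>r. V r \<omega> \<xi>) r - G Pc \<omega> t (\<lambda>r. V' r \<omega> \<xi>') r)
        \<le> Lc \<omega> t r * norm (V r \<omega> \<xi> - V' r \<omega> \<xi>')"
      by (rule G_bounds(1)[OF \<omega>])
    also have "\<dots> \<le> Lc \<omega> t r * (m * \<alpha>c r \<omega>)"
      using le[of r] ac_pos[of "\<theta> r \<omega>" "t - r"] f_lipschitz(1)[of "\<theta> r \<omega>"] \<omega> by (intro mult_left_mono) auto
    finally show "norm (G Pc \<omega> t (\<lambda>r. V r \<omega> \<xi>) r - G Pc \<omega> t (\<lambda>r. V' r \<omega> \<xi>') r) \<le> m * kc \<omega> t r"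
      by (simp add: kc_def mult_ac)
  qed
  then show ?thesis by (simp add: X_def oint_diff[OF lb] mult_ac)
qed

lemma Phi_Pc_bound:
  "\<omega> \<in> space M \<Longrightarrow> norm (\<Phi> t \<omega> (Pc \<omega> \<xi>) - \<Phi> t \<omega> (Pc \<omega> \<xi>')) \<le> \<alpha>c t \<omega> * norm (Pc \<omega> (\<xi> - \<xi>'))"
  using onorm_bounds(1)[of \<omega> t "Pc \<omega> (\<xi> - \<xi>')"]
  by (simp add: Pc_facts Phi_minus)

lemma X_lipschitz:
  assumes V: "lipschitz_flow V" and \<omega>: "\<omega> \<in> space M"
  shows "norm (X V t \<omega> \<xi> - X V t \<omega> \<xi>') \<le> C * \<alpha>c t \<omega> * norm (Pc \<omega> (\<xi> - \<xi>'))"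
proof -
  have "norm ((X V t \<omega> \<xi> - \<Phi> t \<omega> (Pc \<omega> \<xi>)) - (X V t \<omega> \<xi>' - \<Phi> t \<omega> (Pc \<omega> \<xi>')))
      \<le> \<sigma> * (L * norm (Pc \<omega> (\<xi> - \<xi>'))) * \<alpha>c t \<omega>"
    using lipschitz_flowD(2)[OF V \<omega>] bounds(5)
    by (intro X_diff[OF V V \<omega>]) (auto simp: mult_ac)
  moreover have "norm (X V t \<omega> \<xi> - X V t \<omega> \<xi>') \<le>
      norm ((X V t \<omega> \<xi> - \<Phi> t \<omega> (Pc \<omega> \<xi>)) - (X V t \<omega> \<xi>' - \<Phi> t \<omega> (Pc \<omega> \<xi>')))
      + norm (\<Phi> t \<omega> (Pc \<omega> \<xi>) - \<Phi> t \<omega> (Pc \<omega> \<xi>'))"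
    by (rule order_trans[OF _ norm_triangle_ineq]) simp
  ultimately show ?thesis
    using Phi_Pc_bound[OF \<omega>, of t \<xi> \<xi>'] by (simp add: C_def algebra_simps)
qed

lemma Y_lipschitz:
  assumes V: "lipschitz_flow V" and \<omega>: "\<omega> \<in> space M"
  shows "norm (Y V \<omega> \<xi> - Y V \<omega> \<xi>') \<le> N * norm (Pc \<omega> (\<xi> - \<xi>'))"
proof -
  have "norm (Y V \<omega> \<xi> - Y V \<omega> \<xi>') \<le> \<tau> * (L * norm (Pc \<omega> (\<xi> - \<xi>')))"
    unfolding Y_def using lipschitz_flowD(2)[OF V \<omega>] bounds(5)
    by (intro Ksu_diff(3)[OF \<omega> lipschitz_flowD(3)[OF V \<omega>] lipschitz_flowD(3)[OF V \<omega>]])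
       (auto simp: mult_ac)
  also have "\<dots> \<le> N * norm (Pc \<omega> (\<xi> - \<xi>'))"
    using mult_right_mono[OF C_bounds(3), of "norm (Pc \<omega> (\<xi> - \<xi>'))"] by (simp add: mult_ac)
  finally show ?thesis .
qed

lemma XY_0:
  assumes V: "lipschitz_flow V" and \<omega>: "\<omega> \<in> space M"
  shows "X V t \<omega> 0 = 0" "Y V \<omega> 0 = 0"
proof -
  have "(\<lambda>r. V r \<omega> 0) = (\<lambda>_. 0)" using lipschitz_flowD(1)[OF V \<omega>] by auto
  then show "X V t \<omega> 0 = 0" "Y V \<omega> 0 = 0"
    using G_zero[OF invariant_families(1) \<omega>] G_zero[OF invariant_families(2) \<omega>]
      G_zero[OF invariant_families(3) \<omega>]
    by (simp_all add: X_def Y_def Ksu_def oint_def Pc_facts[OF \<omega>]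
        Phi_zero[OF \<omega>] cong: integral_cong)
qed

lemma LP_lipschitz:
  assumes V: "lipschitz_flow V" and \<omega>: "\<omega> \<in> space M"
  shows "norm (LP V t \<omega> \<xi> - LP V t \<omega> \<xi>') \<le> L * \<alpha>c t \<omega> * norm (Pc \<omega> (\<xi> - \<xi>'))"
    "LP V t \<omega> 0 = 0"
proof -
  note \<omega>' = theta_space[OF \<omega>, of t]
  have "norm (LP V t \<omega> \<xi> - LP V t \<omega> \<xi>') \<le> norm (X V t \<omega> \<xi> - X V t \<omega> \<xi>')
      + norm (Y V (\<theta> t \<omega>) (X V t \<omega> \<xi>) - Y V (\<theta> t \<omega>) (X V t \<omega> \<xi>'))"
    unfolding LP_def by (rule order_trans[OF _ norm_triangle_ineq]) (simp add: algebra_simps)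
  also have "\<dots> \<le> norm (X V t \<omega> \<xi> - X V t \<omega> \<xi>') + N * norm (X V t \<omega> \<xi> - X V t \<omega> \<xi>')"
    using Y_lipschitz[OF V \<omega>', of "X V t \<omega> \<xi>" "X V t \<omega> \<xi>'"] by (simp add: Pc_facts[OF \<omega>'] Pc_X[OF V \<omega>])
  also have "\<dots> = (1 + N) * norm (X V t \<omega> \<xi> - X V t \<omega> \<xi>')" by (simp add: algebra_simps)
  also have "\<dots> \<le> (1 + N) * (C * \<alpha>c t \<omega> * norm (Pc \<omega> (\<xi> - \<xi>')))"
    using X_lipschitz[OF V \<omega>] bounds(3) by (intro mult_left_mono) auto
  also have "\<dots> = L * \<alpha>c t \<omega> * norm (Pc \<omega> (\<xi> - \<xi>'))" by (simp only: mult.assoc[symmetric] C_bounds(2))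
  finally show "norm (LP V t \<omega> \<xi> - LP V t \<omega> \<xi>') \<le> L * \<alpha>c t \<omega> * norm (Pc \<omega> (\<xi> - \<xi>'))" .
  show "LP V t \<omega> 0 = 0" by (simp add: LP_def XY_0[OF V] \<omega>)
qed

section \<open>Contraction and uniqueness of the fixed point\<close>

definition q :: real where "q = (1 + N) * \<sigma> + C * \<tau>"

lemma q_bounds: "0 \<le> q" "q < 1"
  using bounds C_bounds by (auto simp: q_def C_def)

lemma X_contraction:
  assumes V: "lipschitz_flow V" "lipschitz_flow V'" and m: "0 \<le> m" and \<omega>: "\<omega> \<in> space M"
    and le: "\<And>r. norm (V r \<omega> \<xi> - V' r \<omega> \<xi>) \<le> m * \<alpha>c r \<omega> * norm (Pc \<omega> \<xi>)"
  shows "norm (X V t \<omega> \<xi> - X V' t \<omega> \<xi>) \<le> \<sigma> * m * \<alpha>c t \<omega> * norm (Pc \<omega> \<xi>)"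
  using X_diff[OF V \<omega>, of "m * norm (Pc \<omega> \<xi>)" \<xi> \<xi> t] le m by (simp add: mult_ac)

lemma Y_contraction:
  assumes V: "lipschitz_flow V" "lipschitz_flow V'" and m: "0 \<le> m" and \<omega>: "\<omega> \<in> space M"
    and le: "\<And>r. norm (V r \<omega> \<xi> - V' r \<omega> \<xi>) \<le> m * \<alpha>c r \<omega> * norm (Pc \<omega> \<xi>)"
  shows "norm (Y V \<omega> \<xi> - Y V' \<omega> \<xi>) \<le> \<tau> * m * norm (Pc \<omega> \<xi>)"
  using Ksu_diff(3)[OF \<omega> lipschitz_flowD(3)[OF V(1) \<omega>, of \<xi>] lipschitz_flowD(3)[OF V(2) \<omega>, of \<xi>],
      of "m * norm (Pc \<omega> \<xi>)"] le m by (simp add: Y_def mult_ac)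

text \<open>The distance \<open>m\<close> has to be valid over every base point, since
  \<open>Y\<close> is evaluated over \<open>\<theta> t \<omega>\<close>.\<close>

lemma LP_contraction:
  assumes V: "lipschitz_flow V" "lipschitz_flow V'" and m: "0 \<le> m"
    and le: "\<And>r \<omega> \<xi>. \<omega> \<in> space M \<Longrightarrow> norm (V r \<omega> \<xi> - V' r \<omega> \<xi>) \<le> m * \<alpha>c r \<omega> * norm (Pc \<omega> \<xi>)"
    and \<omega>: "\<omega> \<in> space M"
  shows "norm (LP V t \<omega> \<xi> - LP V' t \<omega> \<xi>) \<le> q * m * \<alpha>c t \<omega> * norm (Pc \<omega> \<xi>)"
proof -
  note \<omega>' = theta_space[OF \<omega>, of t]
  let ?x = "X V t \<omega> \<xi>" and ?x' = "X V' t \<omega> \<xi>" and ?n = "\<alpha>c t \<omega> * norm (Pc \<omega> \<xi>)"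
  have x: "norm (?x - ?x') \<le> \<sigma> * m * ?n"
    using X_contraction[OF V m \<omega> le[OF \<omega>]] by (simp add: mult_ac)
  have y1: "norm (Y V (\<theta> t \<omega>) ?x - Y V (\<theta> t \<omega>) ?x') \<le> N * norm (?x - ?x')"
    using Y_lipschitz[OF V(1) \<omega>', of ?x ?x'] by (simp add: Pc_facts[OF \<omega>'] Pc_X[OF V(1) \<omega>] Pc_X[OF V(2) \<omega>])
  have x': "norm ?x' \<le> C * ?n"
    using X_lipschitz[OF V(2) \<omega>, of t \<xi> 0] by (simp add: XY_0[OF V(2) \<omega>] mult_ac)
  have "norm (Y V (\<theta> t \<omega>) ?x' - Y V' (\<theta> t \<omega>) ?x') \<le> \<tau> * m * norm ?x'"
    using Y_contraction[OF V m \<omega>' le[OF \<omega>'], of ?x'] by (simp add: Pc_X[OF V(2) \<omega>])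
  also have "\<dots> \<le> \<tau> * m * (C * ?n)" using x' m bounds(2) by (intro mult_left_mono) auto
  finally have y2: "norm (Y V (\<theta> t \<omega>) ?x' - Y V' (\<theta> t \<omega>) ?x') \<le> \<tau> * m * (C * ?n)" .
  \<comment> \<open>The inserted term \<open>Y V (\<theta> t \<omega>) ?x'\<close> separates the
    change of argument, which costs \<open>N\<close> times the difference of the centre parts, from
    the change of flow, which costs \<tau>. These produce the two summands of
    \<open>q\<close>.\<close>
  have "norm (LP V t \<omega> \<xi> - LP V' t \<omega> \<xi>) \<le> norm (?x - ?x') +
      (norm (Y V (\<theta> t \<omega>) ?x - Y V (\<theta> t \<omega>) ?x') + norm (Y V (\<theta> t \<omega>) ?x' - Y V' (\<theta> t \<omega>) ?x'))"
    unfolding LP_def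
    by (rule order_trans[OF _ order_trans[OF norm_triangle_ineq add_left_mono[OF norm_triangle_ineq]]])
      (simp add: algebra_simps)
  also have "\<dots> \<le> (1 + N) * norm (?x - ?x') + \<tau> * m * (C * ?n)"
    using y1 y2 by (simp add: algebra_simps)
  also have "\<dots> \<le> (1 + N) * (\<sigma> * m * ?n) + \<tau> * m * (C * ?n)"
    using x bounds(3) by (intro add_right_mono mult_left_mono) auto
  also have "\<dots> = q * m * \<alpha>c t \<omega> * norm (Pc \<omega> \<xi>)" by (simp add: q_def algebra_simps)
  finally show ?thesis .
qed

text \<open>Any two flows of the class are at weighted distance at most \<open>2 * L\<close>, and
  each application of the operator multiplies the bound by \<open>q\<close>. It is stated for
  \<open>lipschitz_flow\<close> so as to cover the orbits on an arbitrary invariant section.\<close>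

lemma LP_fixed_point_unique:
  assumes V: "lipschitz_flow V" "lipschitz_flow V'"
    and fixed: "\<And>t \<omega> \<xi>. \<omega> \<in> space M \<Longrightarrow> LP V t \<omega> \<xi> = V t \<omega> \<xi>"
      "\<And>t \<omega> \<xi>. \<omega> \<in> space M \<Longrightarrow> LP V' t \<omega> \<xi> = V' t \<omega> \<xi>"
    and \<omega>: "\<omega> \<in> space M"
  shows "V t \<omega> \<xi> = V' t \<omega> \<xi>"
proof -
  have le: "norm (V t \<omega> \<xi> - V' t \<omega> \<xi>) \<le> (2 * L * q ^ n) * \<alpha>c t \<omega> * norm (Pc \<omega> \<xi>)"
    if "\<omega> \<in> space M" for n t \<omega> \<xi>
    using that
  proof (induction n arbitrary: t \<omega> \<xi>)
    case 0
    have "norm (V t \<omega> \<xi>) \<le> L * \<alpha>c t \<omega> * norm (Pc \<omega> \<xi>)" "norm (V' t \<omega> \<xi>) \<le> L * \<alpha>c t \<omega> * norm (Pc \<omega> \<xi>)"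
      using lipschitz_flowD(3)[OF V(1) 0] lipschitz_flowD(3)[OF V(2) 0]
      by (auto simp: trajectory_def mult_ac)
    then show ?case using norm_triangle_ineq4[of "V t \<omega> \<xi>" "V' t \<omega> \<xi>"] by simp
  next
    case (Suc n)
    have "0 \<le> 2 * L * q ^ n" using bounds(5) q_bounds(1) by simp
    from LP_contraction[OF V this Suc.IH Suc.prems]
    show ?case by (simp add: fixed Suc.prems mult_ac)
  qed
  have "(\<lambda>n. (2 * L * q ^ n) * \<alpha>c t \<omega> * norm (Pc \<omega> \<xi>)) \<longlonglongrightarrow> (2 * L * 0) * \<alpha>c t \<omega> * norm (Pc \<omega> \<xi>)"
    using q_bounds by (intro tendsto_intros LIMSEQ_power_zero) auto
  then have "norm (V t \<omega> \<xi> - V' t \<omega> \<xi>) \<le> (2 * L * 0) * \<alpha>c t \<omega> * norm (Pc \<omega> \<xi>)"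
    by (rule Lim_bounded2[where N = 0]) (use le[OF \<omega>] in auto)
  then show ?thesis by simp
qed

section \<open>Joint measurability and existence of the fixed point\<close>

text \<open>The class in which the iteration runs: joint measurability in time and base point passes
  through the integrals of \<open>X\<close> and \<open>Y\<close>, and in the end yields
  measurability of the section in \<omega>.\<close>

definition measurable_flow :: "(real \<Rightarrow> 'w \<Rightarrow> 'x \<Rightarrow> 'x) \<Rightarrow> bool" where
  "measurable_flow V \<longleftrightarrow> lipschitz_flow V \<and>
    (\<forall>\<xi>. bochner_measurable (borel \<Otimes>\<^sub>M M) (\<lambda>(t, \<omega>). V t \<omega> \<xi>))"

lemma pair_section_measurable: "\<omega> \<in> space M \<Longrightarrow> (\<lambda>t::real. (t, \<omega>)) \<in> borel \<rightarrow>\<^sub>M borel \<Otimes>\<^sub>M M"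
  by measurable

lemma measurable_flowI:
  assumes "\<And>\<xi>. bochner_measurable (borel \<Otimes>\<^sub>M M) (\<lambda>(t, \<omega>). V t \<omega> \<xi>)"
    and "\<And>t \<omega>. \<omega> \<in> space M \<Longrightarrow> V t \<omega> 0 = 0"
    and "\<And>t \<omega> \<xi> \<xi>'. \<omega> \<in> space M \<Longrightarrow>
      norm (V t \<omega> \<xi> - V t \<omega> \<xi>') \<le> L * \<alpha>c t \<omega> * norm (Pc \<omega> (\<xi> - \<xi>'))"
  shows "measurable_flow V"
proof -
  have "bochner_measurable borel (\<lambda>t. V t \<omega> \<xi>)" if "\<omega> \<in> space M" for \<omega> \<xi>
    using bochner_measurable_compose[OF assms(1) pair_section_measurable[OF that]] by simp
  then show ?thesis using assms by (simp add: measurable_flow_def lipschitz_flow_def)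
qed

lemma lipschitz_continuous:
  fixes h :: "'x \<Rightarrow> 'x"
  assumes "bounded_linear T" "0 \<le> c" "\<And>x y. norm (h x - h y) \<le> c * norm (T (x - y))"
  shows "continuous_on UNIV h"
proof (rule lipschitz_on_continuous_on)
  show "(c * onorm T)-lipschitz_on UNIV h"
  proof (rule lipschitz_onI)
    fix x y
    have "norm (h x - h y) \<le> c * (onorm T * norm (x - y))"
      using order_trans[OF assms(3) mult_left_mono[OF onorm[OF assms(1)] assms(2)]] .
    then show "dist (h x) (h y) \<le> c * onorm T * dist x y" by (simp add: dist_norm mult_ac)
  qed (use assms(2) onorm_pos_le[OF assms(1)] in simp)
qed

lemma measurable_V:
  assumes V: "measurable_flow V" and a: "a \<in> borel_measurable K" and w: "w \<in> K \<rightarrow>\<^sub>M M"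
    and y: "bochner_measurable K y"
  shows "bochner_measurable K (\<lambda>p. V (a p) (w p) (y p))"
proof (rule bochner_measurable_caratheodory[where g = "\<lambda>p. V (a p) (w p)", OF y])
  have m: "(\<lambda>p. (a p, w p)) \<in> K \<rightarrow>\<^sub>M borel \<Otimes>\<^sub>M M" using a w by measurable
  have "bochner_measurable (borel \<Otimes>\<^sub>M M) (\<lambda>(t, \<omega>). V t \<omega> v)" for v
    using V by (simp add: measurable_flow_def)
  from bochner_measurable_compose[OF this m]
  show "bochner_measurable K (\<lambda>p. V (a p) (w p) v)" for v by simp
  fix p assume "p \<in> space K"
  then have \<omega>: "w p \<in> space M" by (rule measurable_space[OF w])
  show "continuous_on UNIV (V (a p) (w p))"
    using V ac_pos[OF \<omega>, of "a p"] bounds(5)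
    by (intro lipschitz_continuous[OF P_projections(2)[of Pc, OF _ \<omega>], of "L * \<alpha>c (a p) (w p)"])
       (auto intro!: lipschitz_flowD(2)[OF _ \<omega>] simp: measurable_flow_def)
qed

lemma measurable_G_flow:
  assumes "invariant_family P" "measurable_flow V" "w \<in> K \<rightarrow>\<^sub>M M" "a \<in> borel_measurable K"
    "b \<in> borel_measurable K" "bochner_measurable K y"
  shows "bochner_measurable K (\<lambda>p. G P (w p) (a p) (\<lambda>r. V r (w p) (y p)) (b p))"
  by (rule measurable_G[where u = "\<lambda>p r. V r (w p) (y p)", OF assms(1,3,4,5)
        measurable_V[OF assms(2,5,3,6)]])

lemma measurable_integral_G:
  assumes "invariant_family P" "measurable_flow V" and w: "w \<in> K \<rightarrow>\<^sub>M M" and a: "a \<in> borel_measurable K"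
    and y: "bochner_measurable K y" and S: "Measurable.pred (K \<Otimes>\<^sub>M borel) (\<lambda>(p, r). r \<in> S p)"
    and b: "\<And>p. p \<in> space K \<Longrightarrow> bint (S p) (G P (w p) (a p) (\<lambda>r. V r (w p) (y p)))"
  shows "bochner_measurable K (\<lambda>p. integral (S p) (G P (w p) (a p) (\<lambda>r. V r (w p) (y p))))"
proof (rule bochner_measurable_set_integral[OF _ S b])
  have "bochner_measurable (K \<Otimes>\<^sub>M borel) (\<lambda>z. G P (w (fst z)) (a (fst z))
      (\<lambda>r. V r (w (fst z)) (y (fst z))) (snd z))"
    by (rule measurable_G_flow[OF assms(1,2) measurable_compose[OF measurable_fst w]
          measurable_compose[OF measurable_fst a] measurable_snd
          bochner_measurable_compose[OF y measurable_fst]])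
  then show "bochner_measurable (K \<Otimes>\<^sub>M borel) (\<lambda>(p, r). G P (w p) (a p) (\<lambda>r. V r (w p) (y p)) r)"
    by (simp add: split_def)
qed

lemma measurable_X:
  assumes V: "measurable_flow V" and a: "a \<in> borel_measurable K" and w: "w \<in> K \<rightarrow>\<^sub>M M"
    and y: "bochner_measurable K y"
  shows "bochner_measurable K (\<lambda>p. X V (a p) (w p) (y p))"
  unfolding X_def oint_def
proof (intro bochner_measurable_add bochner_measurable_diff)
  show "bochner_measurable K (\<lambda>p. \<Phi> (a p) (w p) (Pc (w p) (y p)))"
    by (rule measurable_Phi[OF a w measurable_family[OF invariant_families(1) w y]])
  have b: "bint {c..d} (G Pc (w p) (a p) (\<lambda>r. V r (w p) (y p)))" if "p \<in> space K" for p c d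
    using V measurable_space[OF w that]
    by (intro locally_bintD trajectory_Gc[OF _ lipschitz_flowD(3)]) (auto simp: measurable_flow_def)
  note [measurable] = a
  show "bochner_measurable K (\<lambda>p. integral {0..a p} (G Pc (w p) (a p) (\<lambda>r. V r (w p) (y p))))"
    by (rule measurable_integral_G[OF invariant_families(1) V w a y _ b]) (simp, measurable)
  show "bochner_measurable K (\<lambda>p. integral {a p..0} (G Pc (w p) (a p) (\<lambda>r. V r (w p) (y p))))"
    by (rule measurable_integral_G[OF invariant_families(1) V w a y _ b]) (simp, measurable)
qed

lemma trajectory_Ksu_bint:
  assumes \<omega>: "\<omega> \<in> space M" and u: "trajectory \<omega> m u"
  shows "bint {..0} (G Ps \<omega> 0 u)" "bint {0..} (G Pu \<omega> 0 u)"
  by (rule Ksu_diff(1,2)[OF \<omega> u u order_refl]; simp add: ac_pos[OF \<omega>])+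

lemma measurable_Y:
  assumes V: "measurable_flow V" and w: "w \<in> K \<rightarrow>\<^sub>M M" and y: "bochner_measurable K y"
  shows "bochner_measurable K (\<lambda>p. Y V (w p) (y p))"
  unfolding Y_def Ksu_def
proof (intro bochner_measurable_diff)
  have tr: "trajectory (w p) (L * norm (Pc (w p) (y p))) (\<lambda>r. V r (w p) (y p))" if "p \<in> space K" for p
    using V measurable_space[OF w that] by (intro lipschitz_flowD(3)) (auto simp: measurable_flow_def)
  show "bochner_measurable K (\<lambda>p. integral {..0} (G Ps (w p) 0 (\<lambda>r. V r (w p) (y p))))"
    by (rule measurable_integral_G[OF invariant_families(2) V w _ y _
          trajectory_Ksu_bint(1)[OF measurable_space[OF w] tr]]) (simp_all, measurable)
  show "bochner_measurable K (\<lambda>p. integral {0..} (G Pu (w p) 0 (\<lambda>r. V r (w p) (y p))))"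
    by (rule measurable_integral_G[OF invariant_families(3) V w _ y _
          trajectory_Ksu_bint(2)[OF measurable_space[OF w] tr]]) (simp_all, measurable)
qed

lemma LP_measurable_flow:
  assumes V: "measurable_flow V"
  shows "measurable_flow (LP V)"
proof (rule measurable_flowI)
  fix \<xi>
  have x: "bochner_measurable (borel \<Otimes>\<^sub>M M) (\<lambda>p. X V (fst p) (snd p) \<xi>)"
    by (rule measurable_X[OF V measurable_fst measurable_snd bochner_measurable_const])
  have "bochner_measurable (borel \<Otimes>\<^sub>M M) (\<lambda>p. Y V (\<theta> (fst p) (snd p)) (X V (fst p) (snd p) \<xi>))"
    by (rule measurable_Y[OF V measurable_theta[OF measurable_fst measurable_snd] x])
  from bochner_measurable_add[OF x this]
  show "bochner_measurable (borel \<Otimes>\<^sub>M M) (\<lambda>(t, \<omega>). LP V t \<omega> \<xi>)"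
    by (simp add: LP_def split_def)
qed (use LP_lipschitz V in \<open>auto simp: measurable_flow_def\<close>)

text \<open>Picard iteration from 0. Limits are taken pointwise in
  \<open>(t, \<omega>, \<xi>)\<close>, with geometric rates in the weighted norm, because Bochner
  measurability is preserved by everywhere limits.\<close>

lemma LP_fixed_point_exists:
  obtains V where "measurable_flow V" "\<And>t \<omega> \<xi>. \<omega> \<in> space M \<Longrightarrow> LP V t \<omega> \<xi> = V t \<omega> \<xi>"
proof -
  define S where "S n = (LP ^^ n) (\<lambda>_ _ _. 0)" for n
  have S0: "S 0 = (\<lambda>_ _ _. 0)" and SS: "S (Suc n) = LP (S n)" for n by (simp_all add: S_def)
  have mf: "measurable_flow (S n)" for n
  proof (induction n)
    case 0
    show ?case
      using ac_pos bounds(5) unfolding S0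
      by (intro measurable_flowI) (auto simp: bochner_measurable_const split_def less_imp_le)
  qed (simp add: SS LP_measurable_flow)
  then have lf: "lipschitz_flow (S n)" for n by (simp add: measurable_flow_def)
  have step: "norm (S (Suc n) t \<omega> \<xi> - S n t \<omega> \<xi>) \<le> (L * q ^ n) * \<alpha>c t \<omega> * norm (Pc \<omega> \<xi>)"
    if "\<omega> \<in> space M" for n t \<omega> \<xi>
    using that
  proof (induction n arbitrary: t \<omega> \<xi>)
    case 0
    show ?case
      using lipschitz_flowD(3)[OF lf[of 1] 0, of \<xi>] by (simp add: S0 trajectory_def mult_ac)
  next
    case (Suc n)
    have "0 \<le> L * q ^ n" using bounds(5) q_bounds(1) by simp
    from LP_contraction[OF lf lf this Suc.IH Suc.prems] show ?case by (simp add: SS mult_ac)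
  qed
  define V where "V t \<omega> \<xi> = lim (\<lambda>n. S n t \<omega> \<xi>)" for t \<omega> \<xi>
  have conv: "(\<lambda>n. S n t \<omega> \<xi>) \<longlonglongrightarrow> V t \<omega> \<xi>"
    and close: "norm (V t \<omega> \<xi> - S n t \<omega> \<xi>) \<le> (L / (1 - q) * q ^ n) * \<alpha>c t \<omega> * norm (Pc \<omega> \<xi>)"
    if \<omega>: "\<omega> \<in> space M" for n t \<omega> \<xi>
  proof -
    have "norm (S (Suc n) t \<omega> \<xi> - S n t \<omega> \<xi>) \<le> (L * \<alpha>c t \<omega> * norm (Pc \<omega> \<xi>)) * q ^ n" for n
      using step[OF \<omega>, of n t \<xi>] by (simp add: mult_ac)
    from geometric_limit[OF this q_bounds]
    show "(\<lambda>n. S n t \<omega> \<xi>) \<longlonglongrightarrow> V t \<omega> \<xi>"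
      "norm (V t \<omega> \<xi> - S n t \<omega> \<xi>) \<le> (L / (1 - q) * q ^ n) * \<alpha>c t \<omega> * norm (Pc \<omega> \<xi>)"
      by (simp_all add: V_def mult_ac)
  qed
  have mV: "measurable_flow V"
  proof (rule measurable_flowI)
    fix \<xi>
    show "bochner_measurable (borel \<Otimes>\<^sub>M M) (\<lambda>(t, \<omega>). V t \<omega> \<xi>)"
    proof (rule bochner_measurable_limit[where s = "\<lambda>n (t, \<omega>). S n t \<omega> \<xi>"])
      show "bochner_measurable (borel \<Otimes>\<^sub>M M) (\<lambda>(t, \<omega>). S n t \<omega> \<xi>)" for n
        using mf[of n] by (simp add: measurable_flow_def)
    qed (auto simp: space_pair_measure conv)
  next
    fix t \<omega> \<xi> \<xi>' assume \<omega>: "\<omega> \<in> space M"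
    show "V t \<omega> 0 = 0"
      using LIMSEQ_unique[OF conv[OF \<omega>, of t 0]] by (simp add: lipschitz_flowD(1)[OF lf \<omega>])
    have "(\<lambda>n. norm (S n t \<omega> \<xi> - S n t \<omega> \<xi>')) \<longlonglongrightarrow> norm (V t \<omega> \<xi> - V t \<omega> \<xi>')"
      by (intro tendsto_intros conv \<omega>)
    then show "norm (V t \<omega> \<xi> - V t \<omega> \<xi>') \<le> L * \<alpha>c t \<omega> * norm (Pc \<omega> (\<xi> - \<xi>'))"
      by (rule Lim_bounded[where M = 0]) (use lipschitz_flowD(2)[OF lf \<omega>] in auto)
  qed
  then have lV: "lipschitz_flow V" by (simp add: measurable_flow_def)
  have "LP V t \<omega> \<xi> = V t \<omega> \<xi>" if \<omega>: "\<omega> \<in> space M" for t \<omega> \<xi>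
  proof -
    define B where "B n = (q * (L / (1 - q) * q ^ n)) * \<alpha>c t \<omega> * norm (Pc \<omega> \<xi>)" for n
    \<comment> \<open>As \<open>S (Suc n)\<close> is \<open>LP (S n)\<close>, closeness of
      \<open>V\<close> to \<open>S n\<close> contracts to closeness of \<open>LP V\<close> to
      \<open>S (Suc n)\<close>; hence \<open>LP V\<close> is a limit of the same sequence.\<close>
    have bd: "norm (LP V t \<omega> \<xi> - S (Suc n) t \<omega> \<xi>) \<le> B n" for n
      unfolding SS B_def
    proof (rule LP_contraction[OF lV lf _ close \<omega>])
      show "0 \<le> L / (1 - q) * q ^ n" using bounds(5) q_bounds by simp
    qed auto
    have "B \<longlonglongrightarrow> (q * (L / (1 - q) * 0)) * \<alpha>c t \<omega> * norm (Pc \<omega> \<xi>)"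
      unfolding B_def [abs_def] using q_bounds by (intro tendsto_intros LIMSEQ_power_zero) auto
    then have B0: "B \<longlonglongrightarrow> 0" by simp
    have "(\<lambda>n. LP V t \<omega> \<xi> - S (Suc n) t \<omega> \<xi>) \<longlonglongrightarrow> 0"
      by (rule Lim_null_comparison[OF always_eventually[OF allI[OF bd]] B0])
    moreover have "(\<lambda>n. LP V t \<omega> \<xi> - S (Suc n) t \<omega> \<xi>) \<longlonglongrightarrow> LP V t \<omega> \<xi> - V t \<omega> \<xi>"
      by (intro tendsto_intros LIMSEQ_Suc[OF conv[OF \<omega>]])
    ultimately have "LP V t \<omega> \<xi> - V t \<omega> \<xi> = 0" by (rule LIMSEQ_unique[rotated])
    then show ?thesis by simp
  qed
  then show thesis using that mV by blast
qed

section \<open>The centre equation and the cocycle property\<close>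

text \<open>Pulled back to time \<open>0\<close>, \<open>d\<close> is an indefinite integral, hence bounded on compact time
  intervals; iteration improves this crude bound to the stated one.\<close>

lemma central_bound:
  assumes \<omega>: "\<omega> \<in> space M" and g: "locally_bint (g 0)"
    and gW: "\<And>t r. g t r = W \<omega> t 0 (g 0 r)" and d: "\<And>t. d t = oint 0 t (g t)"
    and Pcd: "\<And>t. Pc (\<theta> t \<omega>) (d t) = d t" and pe: "0 \<le> p" "0 \<le> e" "\<sigma> * p < 1"
    and le: "\<And>t r. norm (g t r) \<le> Lc \<omega> t r * (p * norm (d r) + e * \<alpha>c r \<omega>)"
  shows "norm (d t) \<le> \<sigma> * e / (1 - \<sigma> * p) * \<alpha>c t \<omega>"
proof -
  have lb: "locally_bint (g s)" for s
    using locally_bint_linear[OF W_linear[OF \<omega>] g, of s 0] gW[of s] by presburger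
  \<comment> \<open>One pass through the integral turns a bound \<open>b\<close> into
    \<open>\<sigma> * (p * b + e)\<close>; \<open>l\<close> is the fixed point of this map.\<close>
  define l where "l = \<sigma> * e / (1 - \<sigma> * p)"
  have l: "0 \<le> l" "\<sigma> * (p * l + e) = l"
    using pe bounds(1) by (auto simp: l_def field_simps)
  obtain B where B: "0 \<le> B" "\<And>s. s \<in> {- \<bar>t\<bar>..\<bar>t\<bar>} \<Longrightarrow> norm (oint 0 s (g 0)) \<le> B"
    using oint_bounded[OF g] by blast
  have base: "norm (d s) \<le> B * \<alpha>c s \<omega>" if s: "s \<in> {- \<bar>t\<bar>..\<bar>t\<bar>}" for s
  proof -
    have "d s = W \<omega> s 0 (oint 0 s (g 0))"
      using oint_linear[OF W_linear[OF \<omega>] g, of 0 s s 0] by (simp add: d gW[of s, symmetric])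
    \<comment> \<open>Since \<open>d s\<close> lies in the centre space, \<open>Pc\<close> may be
      inserted, which makes the bound \<alpha>c applicable to the transport from time 0.\<close>
    then have "d s = \<Phi> s \<omega> (Pc \<omega> (oint 0 s (g 0)))"
      using Pcd[of s] invariant_family_W[OF invariant_families(1) \<omega>, of s 0] \<omega> by (simp add: W_0)
    then have "norm (d s) \<le> \<alpha>c s \<omega> * norm (oint 0 s (g 0))" using onorm_bounds(1)[OF \<omega>] by simp
    also have "\<dots> \<le> \<alpha>c s \<omega> * B" using B(2)[OF s] ac_pos[OF \<omega>, of s] by (intro mult_left_mono) auto
    finally show ?thesis by (simp add: mult.commute)
  qed
  have iter: "norm (d s) \<le> (l + (\<sigma> * p) ^ n * B) * \<alpha>c s \<omega>" if "s \<in> {- \<bar>t\<bar>..\<bar>t\<bar>}" for s n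
    using that
  proof (induction n arbitrary: s)
    case 0
    have "B * \<alpha>c s \<omega> \<le> (l + B) * \<alpha>c s \<omega>" using l(1) ac_pos[OF \<omega>, of s] by (intro mult_right_mono) auto
    then show ?case using base[OF 0] by simp
  next
    case (Suc n)
    let ?b = "l + (\<sigma> * p) ^ n * B"
    have b0: "0 \<le> ?b" using l(1) B(1) pe bounds(1) by simp
    have "norm (d s) \<le> (p * ?b + e) * (\<sigma> * \<alpha>c s \<omega>)"
      unfolding d
    proof (rule norm_oint_kc[OF \<omega> lb])
      show "0 \<le> p * ?b + e" using b0 pe by simp
      fix r assume "r \<in> {min 0 s..max 0 s}"
      then have "r \<in> {- \<bar>t\<bar>..\<bar>t\<bar>}" using Suc.prems by (auto split: if_splits simp: min_def max_def)
      then have "p * norm (d r) + e * \<alpha>c r \<omega> \<le> p * (?b * \<alpha>c r \<omega>) + e * \<alpha>c r \<omega>"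
        using Suc.IH pe(1) by (intro add_right_mono mult_left_mono) auto
      then have "norm (g s r) \<le> Lc \<omega> s r * (p * (?b * \<alpha>c r \<omega>) + e * \<alpha>c r \<omega>)"
        using ac_pos[of "\<theta> r \<omega>" "s - r"] f_lipschitz(1)[of "\<theta> r \<omega>"] \<omega>
        by (intro order_trans[OF le] mult_left_mono) auto
      then show "norm (g s r) \<le> (p * ?b + e) * kc \<omega> s r" by (simp add: kc_def algebra_simps)
    qed
    also have "(p * ?b + e) * (\<sigma> * \<alpha>c s \<omega>) = (\<sigma> * (p * l + e) + (\<sigma> * p) ^ Suc n * B) * \<alpha>c s \<omega>"
      by (simp add: algebra_simps)
    finally show ?case by (simp only: l(2))
  qed
  have t0: "t \<in> {- \<bar>t\<bar>..\<bar>t\<bar>}" by (smt (verit) atLeastAtMost_iff)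
  have "(\<lambda>n. (l + (\<sigma> * p) ^ n * B) * \<alpha>c t \<omega>) \<longlonglongrightarrow> (l + 0 * B) * \<alpha>c t \<omega>"
    using pe bounds(1) by (intro tendsto_intros LIMSEQ_power_zero) auto
  then have "norm (d t) \<le> (l + 0 * B) * \<alpha>c t \<omega>"
    by (rule Lim_bounded2[where N = 0]) (use iter[OF t0] in auto)
  then show ?thesis by (simp add: l_def)
qed

text \<open>The defining equation of \<open>L\<close>, solved. The factor \<open>p\<close> in
  \<open>central_bound\<close> will be \<open>1 + N\<close>, and this value closes its estimate with
  constant \<open>L\<close>.\<close>

lemma sigma_N: "\<sigma> * (1 + N) < 1" "(1 + N) / (1 - \<sigma> * (1 + N)) = L"
proof -
  have e: "L * (1 - \<sigma> * (1 + N)) = 1 + N" using bounds(6) by (simp add: algebra_simps)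
  then have "0 < L * (1 - \<sigma> * (1 + N))" using bounds(3) by simp
  then show 1: "\<sigma> * (1 + N) < 1" using bounds(5) by (simp add: zero_less_mult_iff)
  show "(1 + N) / (1 - \<sigma> * (1 + N)) = L" using e 1 by (simp add: divide_eq_eq)
qed

text \<open>Both sides solve the centre equation over \<open>\<theta> s \<omega>\<close> with the
  same initial value. The fixed-point equation controls orbits by their centre parts, and
  \<open>central_bound\<close> with \<open>e = 0\<close> forces the difference to vanish.\<close>

lemma X_flow:
  assumes V: "lipschitz_flow V" and fp: "\<And>t \<omega> \<xi>. \<omega> \<in> space M \<Longrightarrow> LP V t \<omega> \<xi> = V t \<omega> \<xi>"
    and \<omega>: "\<omega> \<in> space M"
  shows "X V (t + s) \<omega> \<xi> = X V t (\<theta> s \<omega>) (X V s \<omega> \<xi>)"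
proof -
  define \<omega>' where "\<omega>' = \<theta> s \<omega>"
  have \<omega>': "\<omega>' \<in> space M" using \<omega> by (simp add: \<omega>'_def)
  define u where "u r = V r \<omega> \<xi>" for r
  define x where "x = X V s \<omega> \<xi>"
  define v where "v r = V r \<omega>' x" for r
  define d where "d t = X V (t + s) \<omega> \<xi> - X V t \<omega>' x" for t
  define g where "g t r = G Pc \<omega>' t (\<lambda>r. u (r + s)) r - G Pc \<omega>' t v r" for t r
  have lu: "locally_bint (G Pc \<omega> t u)" for t
    unfolding u_def by (rule trajectory_Gc[OF \<omega> lipschitz_flowD(3)[OF V \<omega>]])
  have lv: "locally_bint (G Pc \<omega>' t v)" for t
    unfolding v_def by (rule trajectory_Gc[OF \<omega>' lipschitz_flowD(3)[OF V \<omega>']])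
  have shift: "G Pc \<omega>' t (\<lambda>r. u (r + s)) = (\<lambda>r. G Pc \<omega> (t + s) u (r + s))" for t
    by (rule ext) (simp add: \<omega>'_def G_shift[OF \<omega>])
  have lus: "locally_bint (G Pc \<omega>' t (\<lambda>r. u (r + s)))" for t
    unfolding shift by (rule locally_bint_shift[OF lu])
  have "norm (d t) \<le> \<sigma> * 0 / (1 - \<sigma> * (1 + N)) * \<alpha>c t \<omega>'"
  proof (rule central_bound[OF \<omega>', where g = g and p = "1 + N"])
    show "locally_bint (g 0)"
      unfolding g_def [abs_def] by (rule locally_bint_diff[OF lus lv])
    show "g t r = W \<omega>' t 0 (g 0 r)" for t r
      by (simp add: g_def G_trans[OF \<omega>'] W_minus[OF \<omega>'])
    show "d t = oint 0 t (g t)" for t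
    proof -
      \<comment> \<open>The integral is split at \<open>s\<close>: the part up to \<open>s\<close>
        joins the linear term to form the new initial value \<open>x\<close>, and the rest is
        translated to start at 0.\<close>
      have "X V (t + s) \<omega> \<xi> = W \<omega> (t + s) 0 (Pc \<omega> \<xi>) + (oint 0 s (G Pc \<omega> (t + s) u) + oint s (t + s) (G Pc \<omega> (t + s) u))"
        by (simp add: X_def u_def[symmetric, abs_def] oint_combine[OF lu] W_0[OF \<omega>])
      also have "oint 0 s (G Pc \<omega> (t + s) u) = W \<omega> (t + s) s (oint 0 s (G Pc \<omega> s u))"
        using oint_linear[OF W_linear[OF \<omega>] lu, of 0 s "t + s" s s] by (simp add: G_trans[OF \<omega>])
      also have "W \<omega> (t + s) 0 (Pc \<omega> \<xi>) = W \<omega> (t + s) s (\<Phi> s \<omega> (Pc \<omega> \<xi>))"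
        using W_trans[OF \<omega>, of "t + s" s 0] by (simp add: W_0[OF \<omega>])
      also have "W \<omega> (t + s) s (\<Phi> s \<omega> (Pc \<omega> \<xi>)) + (W \<omega> (t + s) s (oint 0 s (G Pc \<omega> s u)) + oint s (t + s) (G Pc \<omega> (t + s) u))
          = W \<omega> (t + s) s x + oint s (t + s) (G Pc \<omega> (t + s) u)"
        by (simp add: x_def X_def u_def[symmetric, abs_def] W_plus[OF \<omega>])
      also have "oint s (t + s) (G Pc \<omega> (t + s) u) = oint 0 t (G Pc \<omega>' t (\<lambda>r. u (r + s)))"
        unfolding shift using oint_shift[OF lu[of "t + s"], of 0 t s] by simp
      also have "W \<omega> (t + s) s x = \<Phi> t \<omega>' (Pc \<omega>' x)"
        using Pc_X[OF V \<omega>, of s \<xi>] by (simp add: W_def \<omega>'_def x_def)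
      finally show ?thesis
        by (simp add: d_def X_def v_def[symmetric, abs_def] g_def [abs_def] oint_diff[OF lus lv])
    qed
    show "Pc (\<theta> t \<omega>') (d t) = d t" for t
      using Pc_X[OF V \<omega>, of "t + s" \<xi>] Pc_X[OF V \<omega>', of t x] \<omega>'
      by (simp add: d_def Pc_facts(4)[OF theta_space[OF \<omega>]] theta_add[OF \<omega>] \<omega>'_def)
    fix t r
    \<comment> \<open>Either orbit is its centre part plus \<open>Y\<close> of it over the same base
      point, so the difference is at most \<open>1 + N\<close> times that of the centre
      parts.\<close>
    have "u (r + s) - v r = d r + (Y V (\<theta> r \<omega>') (X V (r + s) \<omega> \<xi>) - Y V (\<theta> r \<omega>') (X V r \<omega>' x))"
      using fp[OF \<omega>, of "r + s" \<xi>] fp[OF \<omega>', of r x]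
      by (simp add: u_def v_def d_def LP_def theta_add[OF \<omega>] \<omega>'_def algebra_simps)
    then have "norm (u (r + s) - v r) \<le>
        norm (d r) + norm (Y V (\<theta> r \<omega>') (X V (r + s) \<omega> \<xi>) - Y V (\<theta> r \<omega>') (X V r \<omega>' x))"
      by (simp add: norm_triangle_ineq)
    also have "\<dots> \<le> norm (d r) + N * norm (Pc (\<theta> r \<omega>') (d r))"
      unfolding d_def using \<omega>' by (intro add_left_mono Y_lipschitz[OF V]) simp
    also have "Pc (\<theta> r \<omega>') (d r) = d r"
      using Pc_X[OF V \<omega>, of "r + s" \<xi>] Pc_X[OF V \<omega>', of r x] \<omega>'
      by (simp add: d_def Pc_facts(4)[OF theta_space[OF \<omega>]] theta_add[OF \<omega>] \<omega>'_def)
    finally have n: "norm (u (r + s) - v r) \<le> (1 + N) * norm (d r) + 0 * \<alpha>c r \<omega>'"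
      by (simp add: algebra_simps)
    show "norm (g t r) \<le> Lc \<omega>' t r * ((1 + N) * norm (d r) + 0 * \<alpha>c r \<omega>')"
    proof (rule order_trans)
      show "norm (g t r) \<le> Lc \<omega>' t r * norm (u (r + s) - v r)"
        unfolding g_def by (rule G_bounds(1)[OF \<omega>'])
    qed (use n ac_pos[of "\<theta> r \<omega>'" "t - r"] f_lipschitz(1)[of "\<theta> r \<omega>'"] \<omega>' in \<open>auto intro!: mult_left_mono\<close>)
  qed (use bounds sigma_N in auto)
  then show ?thesis by (simp add: d_def x_def \<omega>'_def)
qed

section \<open>The fixed point as a family of mild solutions\<close>

abbreviation Id_family :: "'w \<Rightarrow> 'x \<Rightarrow> 'x" where "Id_family \<equiv> \<lambda>_ x. x"

text \<open>The integrability conditions, one for each end point with its own target time, merge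
  into a single one at target time 0.\<close>

lemma mild_solution_iff:
  assumes \<omega>: "\<omega> \<in> space M" and u: "bochner_measurable borel u"
  shows "mild_solution \<theta> \<Phi> f \<omega> x u \<longleftrightarrow> locally_bint (G Id_family \<omega> 0 u) \<and>
    (\<forall>t. u t = \<Phi> t \<omega> x + oint 0 t (G Id_family \<omega> t u))"
proof -
  have eq: "(\<lambda>r. \<Phi> (t - r) (\<theta> r \<omega>) (f (\<theta> r \<omega>) (u r))) = G Id_family \<omega> t u" for t
    by (rule ext) (simp add: G_def W_def)
  have *: "has_oriented_int (G Id_family \<omega> t u) 0 t v \<longleftrightarrow>
      bint {min 0 t..max 0 t} (G Id_family \<omega> t u) \<and> oint 0 t (G Id_family \<omega> t u) = v" for t v
    by (rule has_oriented_int_iff[OF measurable_G_section[OF invariant_families(4) \<omega> u]])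
  have lb: "(\<forall>t. bint {min 0 t..max 0 t} (G Id_family \<omega> t u)) \<longleftrightarrow> locally_bint (G Id_family \<omega> 0 u)"
  proof
    assume "\<forall>t. bint {min 0 t..max 0 t} (G Id_family \<omega> t u)"
    then show "locally_bint (G Id_family \<omega> 0 u)" by (intro locally_bint_G[OF \<omega>]) auto
  next
    assume "locally_bint (G Id_family \<omega> 0 u)"
    from locally_bint_linear[OF W_linear[OF \<omega>] this, of _ 0]
    have "locally_bint (G Id_family \<omega> t u)" for t by (simp add: G_trans[OF \<omega>])
    then show "\<forall>t. bint {min 0 t..max 0 t} (G Id_family \<omega> t u)" by (simp add: locally_bintD)
  qed
  show ?thesis unfolding mild_solution_def eq * lb[symmetric] by blast
qed

lemma oint_family:
  assumes P: "invariant_family P" and \<omega>: "\<omega> \<in> space M" and b: "locally_bint (G Id_family \<omega> 0 u)"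
  shows "locally_bint (G P \<omega> t u)"
    "P (\<theta> t \<omega>) (oint a c (G Id_family \<omega> t u)) = oint a c (G P \<omega> t u)"
proof -
  have l: "locally_bint (G Id_family \<omega> t u)"
    using locally_bint_linear[OF W_linear[OF \<omega>] b, of t 0] by (simp add: G_trans[OF \<omega>])
  have lin: "bounded_linear (P (\<theta> t \<omega>))" using invariant_family_linear[OF P] \<omega> by simp
  have eq: "G P \<omega> t u = (\<lambda>r. P (\<theta> t \<omega>) (G Id_family \<omega> t u r))"
    by (rule ext) (rule G_family[OF P \<omega>])
  show "locally_bint (G P \<omega> t u)" unfolding eq by (rule locally_bint_linear[OF lin l])
  show "P (\<theta> t \<omega>) (oint a c (G Id_family \<omega> t u)) = oint a c (G P \<omega> t u)"
    unfolding eq by (rule oint_linear[OF lin l, symmetric])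
qed

text \<open>By the cocycle property, the orbit over \<open>\<theta> s \<omega>\<close> through
  \<open>X V s \<omega> \<xi>\<close> is the orbit over \<omega> translated by \<open>s\<close>.
  Hence \<open>Y\<close> over \<open>\<theta> s \<omega>\<close> consists of half-line integrals
  along the original orbit, split at \<open>s\<close> instead of 0.\<close>

lemma half_line_shift:
  assumes V: "lipschitz_flow V" and fp: "\<And>t \<omega> \<xi>. \<omega> \<in> space M \<Longrightarrow> LP V t \<omega> \<xi> = V t \<omega> \<xi>"
    and \<omega>: "\<omega> \<in> space M" and u: "u = (\<lambda>r. V r \<omega> \<xi>)"
  shows "bint {..s} (G Ps \<omega> t u)" "bint {s..} (G Pu \<omega> t u)"
    "Y V (\<theta> s \<omega>) (X V s \<omega> \<xi>) = integral {..s} (G Ps \<omega> s u) - integral {s..} (G Pu \<omega> s u)"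
proof -
  define \<omega>' where "\<omega>' = \<theta> s \<omega>"
  have \<omega>': "\<omega>' \<in> space M" using \<omega> by (simp add: \<omega>'_def)
  have v: "V r \<omega>' (X V s \<omega> \<xi>) = u (r + s)" for r
    using X_flow[OF V fp \<omega>, of r s \<xi>] fp[OF \<omega>, of "r + s" \<xi>] fp[OF \<omega>', of r "X V s \<omega> \<xi>"]
    by (simp add: LP_def u \<omega>'_def theta_add[OF \<omega>])
  have G: "G P \<omega>' 0 (\<lambda>r. V r \<omega>' (X V s \<omega> \<xi>)) = (\<lambda>r. G P \<omega> s u (r + s))" for P
    unfolding v using G_shift[OF \<omega>, of P s 0 u] by (simp add: \<omega>'_def fun_eq_iff)
  note tr = lipschitz_flowD(3)[OF V \<omega>', of "X V s \<omega> \<xi>"]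
  have b: "bint {..0} (\<lambda>r. G Ps \<omega> s u (r + s))" "bint {0..} (\<lambda>r. G Pu \<omega> s u (r + s))"
    using trajectory_Ksu_bint[OF \<omega>' tr] by (simp_all add: G)
  have sets: "{r. r + - s \<in> {..0}} = {..s}" "{r. r + - s \<in> {0..}} = {s..}" by auto
  have bs: "bint {..s} (G Ps \<omega> s u)" and bu: "bint {s..} (G Pu \<omega> s u)"
    using bint_shift(1)[OF b(1), of "-s"] bint_shift(1)[OF b(2), of "-s"] unfolding sets by simp_all
  show "bint {..s} (G Ps \<omega> t u)" "bint {s..} (G Pu \<omega> t u)"
    using bint_linear[OF W_linear[OF \<omega>] bs, of t s] bint_linear[OF W_linear[OF \<omega>] bu, of t s]
    by (simp_all add: G_trans[OF \<omega>])
  have ints: "integral {..0} (\<lambda>r. G Ps \<omega> s u (r + s)) = integral {..s} (G Ps \<omega> s u)"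
    and intu: "integral {0..} (\<lambda>r. G Pu \<omega> s u (r + s)) = integral {s..} (G Pu \<omega> s u)"
    using bint_shift(2)[OF b(1), of "-s"] bint_shift(2)[OF b(2), of "-s"] unfolding sets by simp_all
  show "Y V (\<theta> s \<omega>) (X V s \<omega> \<xi>) = integral {..s} (G Ps \<omega> s u) - integral {s..} (G Pu \<omega> s u)"
    by (simp add: Y_def Ksu_def G ints intu flip: \<omega>'_def)
qed

text \<open>\<open>Y\<close> at time \<open>t\<close> and the transported \<open>Y\<close> at time 0
  differ only by moving the splitting point of the half lines from 0 to \<open>t\<close>; this
  contributes the stable and unstable parts of the integral over \<open>[0,t]\<close>, and
  \<open>X\<close> contributes the centre part.\<close>

lemma fixed_point_mild_solution:
  assumes V: "lipschitz_flow V" and fp: "\<And>t \<omega> \<xi>. \<omega> \<in> space M \<Longrightarrow> LP V t \<omega> \<xi> = V t \<omega> \<xi>"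
    and \<omega>: "\<omega> \<in> space M"
  shows "mild_solution \<theta> \<Phi> f \<omega> (Pc \<omega> \<xi> + Y V \<omega> \<xi>) (\<lambda>r. V r \<omega> \<xi>)"
proof -
  define u where "u = (\<lambda>r. V r \<omega> \<xi>)"
  note tr = lipschitz_flowD(3)[OF V \<omega>, of \<xi>, folded u_def]
  have um: "bochner_measurable borel u" using tr by (simp add: trajectory_def)
  note half = half_line_shift[OF V fp \<omega> u_def]
  have lc: "locally_bint (G Pc \<omega> t u)" for t by (rule trajectory_Gc[OF \<omega> tr])
  have ls: "locally_bint (G Ps \<omega> t u)" for t
    unfolding locally_bint_def using bint_subset[OF half(1)] by (metis Icc_subset_Iic_iff order_refl)
  have lu: "locally_bint (G Pu \<omega> t u)" for t
    unfolding locally_bint_def using bint_subset[OF half(2)] by (metis Icc_subset_Ici_iff order_refl)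
  have sum: "G Id_family \<omega> t u = (\<lambda>r. G Pc \<omega> t u r + G Ps \<omega> t u r + G Pu \<omega> t u r)" for t
  proof
    fix r
    have "W \<omega> t r (f (\<theta> r \<omega>) (u r)) = W \<omega> t r (Pc (\<theta> r \<omega>) (f (\<theta> r \<omega>) (u r))
        + Ps (\<theta> r \<omega>) (f (\<theta> r \<omega>) (u r)) + Pu (\<theta> r \<omega>) (f (\<theta> r \<omega>) (u r)))"
      using P_sum[of "\<theta> r \<omega>"] \<omega> by simp
    then show "G Id_family \<omega> t u r = G Pc \<omega> t u r + G Ps \<omega> t u r + G Pu \<omega> t u r"
      by (simp add: G_def W_plus[OF \<omega>])
  qed
  have lcs: "locally_bint (\<lambda>r. G Pc \<omega> t u r + G Ps \<omega> t u r)" for t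
    using lc ls by (simp add: locally_bint_def bint_add)
  have lI: "locally_bint (G Id_family \<omega> 0 u)"
    unfolding sum using lcs lu by (simp add: locally_bint_def bint_add)
  have "u t = \<Phi> t \<omega> (Pc \<omega> \<xi> + Y V \<omega> \<xi>) + oint 0 t (G Id_family \<omega> t u)" for t
  proof -
    have b0: "bint {..0} (G Ps \<omega> 0 u)" by (rule half(1))
    have b1: "bint {0..} (G Pu \<omega> 0 u)" by (rule half(2))
    have "\<Phi> t \<omega> (Y V \<omega> \<xi>) = W \<omega> t 0 (integral {..0} (G Ps \<omega> 0 u)) - W \<omega> t 0 (integral {0..} (G Pu \<omega> 0 u))"
      by (simp add: Y_def Ksu_def u_def[symmetric] W_0[OF \<omega>] Phi_minus[OF \<omega>])
    also have "\<dots> = integral {..0} (G Ps \<omega> t u) - integral {0..} (G Pu \<omega> t u)"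
      using integral_bounded_linear[OF W_linear[OF \<omega>] b0, of t 0]
        integral_bounded_linear[OF W_linear[OF \<omega>] b1, of t 0] by (simp add: G_trans[OF \<omega>])
    finally have e: "\<Phi> t \<omega> (Y V \<omega> \<xi>) = integral {..0} (G Ps \<omega> t u) - integral {0..} (G Pu \<omega> t u)" .
    have hs: "bint {..s} (G Ps \<omega> t u)" for s by (rule half(1))
    have hu: "bint {s..} (G Pu \<omega> t u)" for s by (rule half(2))
    \<comment> \<open>The end points are swapped in the unstable case, which compensates the minus
      sign in \<open>Ksu\<close>.\<close>
    note i = integral_half_line_diff(1)[OF ls hs hs, of t 0] integral_half_line_diff(2)[OF lu hu hu, of 0 t]
    have "u t = X V t \<omega> \<xi> + Y V (\<theta> t \<omega>) (X V t \<omega> \<xi>)" using fp[OF \<omega>, of t \<xi>] by (simp add: u_def LP_def)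
    also have "\<dots> = \<Phi> t \<omega> (Pc \<omega> \<xi>) + oint 0 t (G Pc \<omega> t u) +
        (integral {..t} (G Ps \<omega> t u) - integral {t..} (G Pu \<omega> t u))"
      by (simp add: half(3)) (simp add: X_def u_def)
    also have "\<dots> = \<Phi> t \<omega> (Pc \<omega> \<xi>) + \<Phi> t \<omega> (Y V \<omega> \<xi>) +
        (oint 0 t (G Pc \<omega> t u) + oint 0 t (G Ps \<omega> t u) + oint 0 t (G Pu \<omega> t u))"
      unfolding e i[symmetric] by (simp add: algebra_simps)
    also have "\<dots> = \<Phi> t \<omega> (Pc \<omega> \<xi> + Y V \<omega> \<xi>) + oint 0 t (G Id_family \<omega> t u)"
      unfolding sum by (simp add: oint_add[OF lcs lu] oint_add[OF lc ls]
          Phi_plus[OF \<omega>])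
    finally show ?thesis .
  qed
  then show ?thesis
    unfolding u_def[symmetric] mild_solution_iff[OF \<omega> um] using lI by blast
qed

end

section \<open>Invariant sections\<close>

locale perturbed_trichotomy = trichotomy_perturbation +
  fixes \<Psi> :: "real \<Rightarrow> 'a \<Rightarrow> 'b \<Rightarrow> 'b"
  assumes Psi: "bochner_rds M \<theta> \<Psi>"
    and mild: "\<And>\<omega> x. \<omega> \<in> space M \<Longrightarrow> mild_solution \<theta> \<Phi> f \<omega> x (\<lambda>t. \<Psi> t \<omega> x)"
    and unique: "\<And>\<omega> x u. \<omega> \<in> space M \<Longrightarrow> mild_solution \<theta> \<Phi> f \<omega> x u \<Longrightarrow> u = (\<lambda>t. \<Psi> t \<omega> x)"
    and lim_s: "\<And>\<omega>. \<omega> \<in> space M \<Longrightarrow> ((\<lambda>t. \<alpha>s (- t) (\<theta> t \<omega>) * \<alpha>c t \<omega>) \<longlongrightarrow> 0) at_bot"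
    and lim_u: "\<And>\<omega>. \<omega> \<in> space M \<Longrightarrow> ((\<lambda>t. \<alpha>u (- t) (\<theta> t \<omega>) * \<alpha>c t \<omega>) \<longlongrightarrow> 0) at_top"
begin

lemma Psi_measurable: "\<omega> \<in> space M \<Longrightarrow> bochner_measurable borel (\<lambda>t. \<Psi> t \<omega> x)"
proof -
  assume \<omega>: "\<omega> \<in> space M"
  have "bochner_measurable (borel \<Otimes>\<^sub>M M) (\<lambda>(t, \<omega>). \<Psi> t \<omega> x)"
    using Psi by (simp add: bochner_rds_def)
  from bochner_measurable_compose[OF this pair_section_measurable[OF \<omega>]] show ?thesis by simp
qed

lemma Psi_zero: "\<omega> \<in> space M \<Longrightarrow> \<Psi> t \<omega> 0 = 0"
proof -
  assume \<omega>: "\<omega> \<in> space M"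
  have "G Id_family \<omega> t (\<lambda>_. 0) = (\<lambda>_. 0)" for t
    using G_zero[OF invariant_families(4) \<omega>] by auto
  then have "mild_solution \<theta> \<Phi> f \<omega> 0 (\<lambda>_. 0)"
    unfolding mild_solution_iff[OF \<omega> bochner_measurable_const]
    by (simp add: locally_bint_def bint_def bochner_measurable_const oint_def
        Phi_zero[OF \<omega>])
  from unique[OF \<omega> this] show ?thesis by metis
qed

lemma Psi_family:
  assumes P: "invariant_family P" and \<omega>: "\<omega> \<in> space M" and u: "u = (\<lambda>r. \<Psi> r \<omega> x)"
  shows "locally_bint (G P \<omega> t u)" "P (\<theta> t \<omega>) (u t) = \<Phi> t \<omega> (P \<omega> x) + oint 0 t (G P \<omega> t u)"
proof -
  have um: "bochner_measurable borel u" unfolding u by (rule Psi_measurable[OF \<omega>])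
  have m: "locally_bint (G Id_family \<omega> 0 u)" "u t = \<Phi> t \<omega> x + oint 0 t (G Id_family \<omega> t u)"
    using mild[OF \<omega>, of x, folded u] unfolding mild_solution_iff[OF \<omega> um] by blast+
  show "locally_bint (G P \<omega> t u)" by (rule oint_family(1)[OF P \<omega> m(1)])
  have "P (\<theta> t \<omega>) (u t) = P (\<theta> t \<omega>) (\<Phi> t \<omega> x) + P (\<theta> t \<omega>) (oint 0 t (G Id_family \<omega> t u))"
    using m(2) linear_add[OF bounded_linear.linear[OF invariant_family_linear[OF P theta_space[OF \<omega>]]]]
    by metis
  then show "P (\<theta> t \<omega>) (u t) = \<Phi> t \<omega> (P \<omega> x) + oint 0 t (G P \<omega> t u)"
    using invariant_family_W[OF P \<omega>, of t 0 x] \<omega> by (simp add: oint_family(2)[OF P \<omega> m(1)] W_0)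
qed

section \<open>Orbits on an arbitrary invariant section\<close>

context
  fixes \<phi>
  assumes sec: "\<phi> \<in> lipschitz_sections M Pc Ps Pu N" and inv: "invariant_section M \<theta> \<Psi> Pc \<phi>"
begin

definition VI :: "real \<Rightarrow> 'a \<Rightarrow> 'b \<Rightarrow> 'b" where
  "VI t \<omega> \<xi> = \<Psi> t \<omega> (Pc \<omega> \<xi> + \<phi> (\<omega>, Pc \<omega> \<xi>))"

lemma Pc_section:
  assumes \<omega>: "\<omega> \<in> space M" and \<xi>: "\<xi> \<in> range (Pc \<omega>)"
  shows "Pc \<omega> (\<phi> (\<omega>, \<xi>)) = 0" "Pc \<omega> \<xi> = \<xi>"
proof -
  obtain a b where "\<phi> (\<omega>, \<xi>) = Ps \<omega> a + Pu \<omega> b"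
    using sec \<omega> \<xi> unfolding lipschitz_sections_def by blast
  then show "Pc \<omega> (\<phi> (\<omega>, \<xi>)) = 0" by (simp add: Pc_facts[OF \<omega>] Pc_Ps[OF \<omega>] Pc_Pu[OF \<omega>])
  show "Pc \<omega> \<xi> = \<xi>" using \<xi> Pc_facts(1)[OF \<omega>] by auto
qed

lemma section_lipschitz:
  "\<omega> \<in> space M \<Longrightarrow> norm (\<phi> (\<omega>, Pc \<omega> x) - \<phi> (\<omega>, Pc \<omega> y)) \<le> N * norm (Pc \<omega> x - Pc \<omega> y)"
  using sec unfolding lipschitz_sections_def by blast

text \<open>Invariance puts the orbit on the graph over \<open>\<theta> t \<omega>\<close>, and its
  base point there is its centre part because \<open>Pc\<close> annihilates the values of
  \<phi>.\<close>

lemma VI_decomposition: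
  assumes \<omega>: "\<omega> \<in> space M"
  shows "VI t \<omega> \<xi> = Pc (\<theta> t \<omega>) (VI t \<omega> \<xi>) + \<phi> (\<theta> t \<omega>, Pc (\<theta> t \<omega>) (VI t \<omega> \<xi>))"
proof -
  have "VI t \<omega> \<xi> \<in> section_graph Pc \<phi> (\<theta> t \<omega>)"
    using inv \<omega> unfolding invariant_section_def VI_def section_graph_def by blast
  then obtain \<zeta> where \<zeta>: "\<zeta> \<in> range (Pc (\<theta> t \<omega>))" "VI t \<omega> \<xi> = \<zeta> + \<phi> (\<theta> t \<omega>, \<zeta>)"
    unfolding section_graph_def by blast
  then have "Pc (\<theta> t \<omega>) (VI t \<omega> \<xi>) = \<zeta>"
    using Pc_section[OF theta_space[OF \<omega>] \<zeta>(1)] \<omega> by (simp add: Pc_facts)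
  then show ?thesis using \<zeta>(2) by simp
qed

lemma Pc_VI_0:
  assumes \<omega>: "\<omega> \<in> space M"
  shows "Pc \<omega> (Pc \<omega> \<xi> + \<phi> (\<omega>, Pc \<omega> \<xi>)) = Pc \<omega> \<xi>"
  using Pc_section[OF \<omega>, of "Pc \<omega> \<xi>"] by (simp add: Pc_facts[OF \<omega>])

lemma Pc_VI:
  assumes \<omega>: "\<omega> \<in> space M"
  shows "locally_bint (G Pc \<omega> t (\<lambda>r. VI r \<omega> \<xi>))" "Pc (\<theta> t \<omega>) (VI t \<omega> \<xi>) = X VI t \<omega> \<xi>"
  using Psi_family[OF invariant_families(1) \<omega>, of "\<lambda>r. VI r \<omega> \<xi>" "Pc \<omega> \<xi> + \<phi> (\<omega>, Pc \<omega> \<xi>)" t]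
  by (simp_all add: X_def Pc_VI_0[OF \<omega>]) (simp_all add: VI_def)

text \<open>The growth bound for orbits comes from the graph: the difference of two orbits is at
  most \<open>1 + N\<close> times that of their centre parts, so the centre equation becomes an
  inequality for the centre parts alone.\<close>

lemma VI_lipschitz:
  assumes \<omega>: "\<omega> \<in> space M"
  shows "norm (VI t \<omega> \<xi> - VI t \<omega> \<xi>') \<le> L * \<alpha>c t \<omega> * norm (Pc \<omega> (\<xi> - \<xi>'))"
proof -
  define n where "n = norm (Pc \<omega> (\<xi> - \<xi>'))"
  define u where "u r = VI r \<omega> \<xi>" for r
  define v where "v r = VI r \<omega> \<xi>'" for r
  \<comment> \<open>The linear flow is subtracted so that \<open>d\<close> is a pure integral, as
    \<open>central_bound\<close> requires; it returns as the inhomogeneity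
    \<open>e = (1 + N) * n\<close>.\<close>
  define d where "d t = Pc (\<theta> t \<omega>) (u t - v t) - \<Phi> t \<omega> (Pc \<omega> (\<xi> - \<xi>'))" for t
  define g where "g t r = G Pc \<omega> t u r - G Pc \<omega> t v r" for t r
  have lu: "locally_bint (G Pc \<omega> t u)" "locally_bint (G Pc \<omega> t v)" for t
    using Pc_VI(1)[OF \<omega>] by (simp_all add: u_def [abs_def] v_def [abs_def])
  have PhiP: "norm (\<Phi> t \<omega> (Pc \<omega> (\<xi> - \<xi>'))) \<le> \<alpha>c t \<omega> * n" for t
    using onorm_bounds(1)[OF \<omega>, of t "Pc \<omega> (\<xi> - \<xi>')"] by (simp add: n_def Pc_facts[OF \<omega>])
  have uv: "norm (u r - v r) \<le> (1 + N) * norm (d r) + (1 + N) * n * \<alpha>c r \<omega>" for r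
  proof -
    let ?p = "Pc (\<theta> r \<omega>)"
    have "norm (u r - v r) \<le> norm (?p (u r) - ?p (v r)) + norm (\<phi> (\<theta> r \<omega>, ?p (u r)) - \<phi> (\<theta> r \<omega>, ?p (v r)))"
    proof -
      have "u r - v r = (?p (u r) - ?p (v r)) + (\<phi> (\<theta> r \<omega>, ?p (u r)) - \<phi> (\<theta> r \<omega>, ?p (v r)))"
        using VI_decomposition[OF \<omega>, of r \<xi>] VI_decomposition[OF \<omega>, of r \<xi>']
        unfolding u_def v_def by (simp only: algebra_simps)
      then show ?thesis using norm_triangle_ineq by metis
    qed
    also have "\<dots> \<le> (1 + N) * norm (?p (u r) - ?p (v r))"
      using section_lipschitz[of "\<theta> r \<omega>" "u r" "v r"] \<omega> by (simp add: algebra_simps)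
    also have "?p (u r) - ?p (v r) = d r + \<Phi> r \<omega> (Pc \<omega> (\<xi> - \<xi>'))"
      using \<omega> by (simp add: d_def Pc_facts)
    also have "(1 + N) * norm (d r + \<Phi> r \<omega> (Pc \<omega> (\<xi> - \<xi>'))) \<le> (1 + N) * (norm (d r) + \<alpha>c r \<omega> * n)"
      using bounds(3) PhiP[of r] by (intro mult_left_mono order_trans[OF norm_triangle_ineq]) auto
    finally show ?thesis by (simp add: algebra_simps)
  qed
  have d_le: "norm (d t) \<le> \<sigma> * ((1 + N) * n) / (1 - \<sigma> * (1 + N)) * \<alpha>c t \<omega>" for t
  proof (rule central_bound[OF \<omega>, where g = g and p = "1 + N"])
    show "locally_bint (g 0)"
      unfolding g_def [abs_def] by (rule locally_bint_diff[OF lu])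
    show "g t r = W \<omega> t 0 (g 0 r)" for t r
      by (simp add: g_def G_trans[OF \<omega>] W_minus[OF \<omega>])
    show "d t = oint 0 t (g t)" for t
    proof -
      have "Pc (\<theta> t \<omega>) (u t - v t) = X VI t \<omega> \<xi> - X VI t \<omega> \<xi>'"
        using \<omega> by (simp add: Pc_facts u_def v_def Pc_VI(2))
      moreover have "X VI t \<omega> \<xi> = \<Phi> t \<omega> (Pc \<omega> \<xi>) + oint 0 t (G Pc \<omega> t u)"
        "X VI t \<omega> \<xi>' = \<Phi> t \<omega> (Pc \<omega> \<xi>') + oint 0 t (G Pc \<omega> t v)"
        by (simp_all add: X_def u_def [abs_def] v_def [abs_def])
      ultimately show ?thesis
        by (simp add: d_def g_def [abs_def] oint_diff[OF lu]
            Pc_facts[OF \<omega>] Phi_minus[OF \<omega>])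
    qed
    show "Pc (\<theta> t \<omega>) (d t) = d t" for t
      using P_projections(4)[of Pc \<omega> t "Pc \<omega> (\<xi> - \<xi>')"] \<omega> by (simp add: d_def Pc_facts)
    show "norm (g t r) \<le> Lc \<omega> t r * ((1 + N) * norm (d r) + (1 + N) * n * \<alpha>c r \<omega>)" for t r
    proof (rule order_trans)
      show "norm (g t r) \<le> Lc \<omega> t r * norm (u r - v r)"
        unfolding g_def by (rule G_bounds(1)[OF \<omega>])
    qed (use uv[of r] ac_pos[of "\<theta> r \<omega>" "t - r"] f_lipschitz(1)[of "\<theta> r \<omega>"] \<omega> in
        \<open>auto intro!: mult_left_mono\<close>)
    show "0 \<le> (1 + N) * n" using bounds(3) by (simp add: n_def)
  qed (use bounds sigma_N in auto)
  define \<rho> where "\<rho> = \<sigma> * (1 + N)"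
  have \<rho>: "\<rho> < 1" "(1 + N) / (1 - \<rho>) = L" using sigma_N by (simp_all add: \<rho>_def)
  have "norm (u t - v t) \<le> (1 + N) * (\<sigma> * ((1 + N) * n) / (1 - \<sigma> * (1 + N)) * \<alpha>c t \<omega>) + (1 + N) * n * \<alpha>c t \<omega>"
    using bounds(3) by (intro order_trans[OF uv] add_right_mono mult_left_mono[OF d_le]) auto
  also have "\<dots> = ((1 + N) * (\<rho> / (1 - \<rho>) + 1)) * \<alpha>c t \<omega> * n" by (simp add: \<rho>_def algebra_simps)
  also have "(1 + N) * (\<rho> / (1 - \<rho>) + 1) = (1 + N) / (1 - \<rho>)" using \<rho>(1) by (simp add: field_simps)
  finally show ?thesis by (simp add: \<rho>(2) u_def v_def n_def)
qed

lemma VI_lipschitz_flow: "lipschitz_flow VI"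
  unfolding lipschitz_flow_def
proof (intro ballI conjI allI)
  fix \<omega> assume \<omega>: "\<omega> \<in> space M"
  show "bochner_measurable borel (\<lambda>t. VI t \<omega> \<xi>)" for \<xi> unfolding VI_def by (rule Psi_measurable[OF \<omega>])
  have "\<phi> (\<omega>, 0) = 0" using sec \<omega> by (simp add: lipschitz_sections_def)
  then show "VI t \<omega> 0 = 0" for t by (simp add: VI_def Pc_facts[OF \<omega>] Psi_zero[OF \<omega>])
qed (rule VI_lipschitz)

text \<open>The limit hypotheses make the boundary terms of the variation of constants formula
  on the stable and unstable parts vanish.\<close>

lemma Y_VI:
  assumes \<omega>: "\<omega> \<in> space M"
  shows "Y VI \<omega> \<xi> = \<phi> (\<omega>, Pc \<omega> \<xi>)"
proof -
  define u where "u = (\<lambda>r. VI r \<omega> \<xi>)"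
  define x where "x = Pc \<omega> \<xi> + \<phi> (\<omega>, Pc \<omega> \<xi>)"
  have u: "u = (\<lambda>r. \<Psi> r \<omega> x)" by (simp add: u_def VI_def x_def)
  define m where "m = L * norm (Pc \<omega> \<xi>)"
  have tr: "trajectory \<omega> m u"
    unfolding m_def u_def by (rule lipschitz_flowD(3)[OF VI_lipschitz_flow \<omega>])
  \<comment> \<open>The left-hand side is the boundary term at time \<open>t\<close>. For
    \<open>Ps\<close> it is sent to minus infinity, for \<open>Pu\<close> to plus infinity, the
    times at which the respective projected flow back to 0 is controlled.\<close>
  have pullback: "W \<omega> 0 t (P (\<theta> t \<omega>) (u t)) = P \<omega> x + oint 0 t (G P \<omega> 0 u)"
    if P: "invariant_family P" for P t
  proof -
    have "W \<omega> 0 t (P (\<theta> t \<omega>) (u t)) = W \<omega> 0 t (W \<omega> t 0 (P \<omega> x)) + W \<omega> 0 t (oint 0 t (G P \<omega> t u))"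
      by (simp add: Psi_family(2)[OF P \<omega> u] W_0[OF \<omega>] W_plus[OF \<omega>])
    also have "W \<omega> 0 t (oint 0 t (G P \<omega> t u)) = oint 0 t (G P \<omega> 0 u)"
      using oint_linear[OF W_linear[OF \<omega>] Psi_family(1)[OF P \<omega> u], of 0 t 0 t t] by (simp add: G_trans[OF \<omega>])
    finally show ?thesis by (simp add: W_trans[OF \<omega>] \<omega>)
  qed
  have un: "norm (u t) \<le> m * \<alpha>c t \<omega>" for t using tr by (simp add: trajectory_def)
  have "(\<lambda>n. W \<omega> 0 (- real n) (Ps (\<theta> (- real n) \<omega>) (u (- real n)))) \<longlonglongrightarrow> 0"
  proof (rule Lim_null_comparison[OF always_eventually[OF allI]])
    have "filterlim (\<lambda>n. - real n) at_bot sequentially"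
      by (simp add: filterlim_real_sequentially filterlim_uminus_at_bot)
    from tendsto_mult_right_zero[OF filterlim_compose[OF lim_s[OF \<omega>] this], of m]
    show "(\<lambda>n. m * (\<alpha>s (- (- real n)) (\<theta> (- real n) \<omega>) * \<alpha>c (- real n) \<omega>)) \<longlonglongrightarrow> 0" .
    fix n
    define t where "t = - real n"
    have "norm (W \<omega> 0 t (Ps (\<theta> t \<omega>) (u t))) \<le> \<alpha>s (- t) (\<theta> t \<omega>) * norm (u t)"
      using onorm_bounds(2)[OF theta_space[OF \<omega>], of "- t" t "u t"] by (simp add: W_def t_def)
    also have "\<dots> \<le> \<alpha>s (- t) (\<theta> t \<omega>) * (m * \<alpha>c t \<omega>)"
      using as_pos[OF theta_space[OF \<omega>], of "- t" t] by (intro mult_left_mono un) (auto simp: t_def)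
    finally show "norm (W \<omega> 0 (- real n) (Ps (\<theta> (- real n) \<omega>) (u (- real n))))
        \<le> m * (\<alpha>s (- (- real n)) (\<theta> (- real n) \<omega>) * \<alpha>c (- real n) \<omega>)"
      by (simp add: t_def mult_ac)
  qed
  moreover have "W \<omega> 0 (- real n) (Ps (\<theta> (- real n) \<omega>) (u (- real n))) =
      Ps \<omega> x - integral {- real n..0} (G Ps \<omega> 0 u)" for n
    by (simp add: pullback[OF invariant_families(2)] oint_ge)
  ultimately have "(\<lambda>n. Ps \<omega> x - integral {- real n..0} (G Ps \<omega> 0 u)) \<longlonglongrightarrow> 0" by simp
  moreover have "(\<lambda>n. Ps \<omega> x - integral {- real n..0} (G Ps \<omega> 0 u)) \<longlonglongrightarrow> Ps \<omega> x - integral {..0} (G Ps \<omega> 0 u)"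
    by (intro tendsto_intros integral_half_line_limits(1) trajectory_Ksu_bint[OF \<omega> tr])
  ultimately have s: "Ps \<omega> x - integral {..0} (G Ps \<omega> 0 u) = 0" by (rule LIMSEQ_unique[rotated])
  have "(\<lambda>n. W \<omega> 0 (real n) (Pu (\<theta> (real n) \<omega>) (u (real n)))) \<longlonglongrightarrow> 0"
  proof (rule Lim_null_comparison[OF always_eventually[OF allI]])
    from tendsto_mult_right_zero[OF filterlim_compose[OF lim_u[OF \<omega>] filterlim_real_sequentially], of m]
    show "(\<lambda>n. m * (\<alpha>u (- real n) (\<theta> (real n) \<omega>) * \<alpha>c (real n) \<omega>)) \<longlonglongrightarrow> 0" .
    fix n
    define t where "t = real n"
    have "norm (W \<omega> 0 t (Pu (\<theta> t \<omega>) (u t))) \<le> \<alpha>u (- t) (\<theta> t \<omega>) * norm (u t)"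
      using onorm_bounds(3)[OF theta_space[OF \<omega>], of "- t" t "u t"] by (simp add: W_def t_def)
    also have "\<dots> \<le> \<alpha>u (- t) (\<theta> t \<omega>) * (m * \<alpha>c t \<omega>)"
      using au_pos[OF theta_space[OF \<omega>], of "- t" t] by (intro mult_left_mono un) (auto simp: t_def)
    finally show "norm (W \<omega> 0 (real n) (Pu (\<theta> (real n) \<omega>) (u (real n))))
        \<le> m * (\<alpha>u (- real n) (\<theta> (real n) \<omega>) * \<alpha>c (real n) \<omega>)"
      by (simp add: t_def mult_ac)
  qed
  moreover have "W \<omega> 0 (real n) (Pu (\<theta> (real n) \<omega>) (u (real n))) =
      Pu \<omega> x + integral {0..real n} (G Pu \<omega> 0 u)" for n
    by (simp add: pullback[OF invariant_families(3)] oint_le)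
  ultimately have "(\<lambda>n. Pu \<omega> x + integral {0..real n} (G Pu \<omega> 0 u)) \<longlonglongrightarrow> 0" by simp
  moreover have "(\<lambda>n. Pu \<omega> x + integral {0..real n} (G Pu \<omega> 0 u)) \<longlonglongrightarrow> Pu \<omega> x + integral {0..} (G Pu \<omega> 0 u)"
    by (intro tendsto_intros integral_half_line_limits(2) trajectory_Ksu_bint[OF \<omega> tr])
  ultimately have t: "Pu \<omega> x + integral {0..} (G Pu \<omega> 0 u) = 0" by (rule LIMSEQ_unique[rotated])
  have "Y VI \<omega> \<xi> = Ps \<omega> x + Pu \<omega> x"
    using s t by (simp add: Y_def Ksu_def u_def[symmetric] eq_neg_iff_add_eq_0 algebra_simps)
  also have "\<dots> = x - Pc \<omega> x"
    using P_sum[OF \<omega>, of x] by (simp add: algebra_simps)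
  also have "\<dots> = \<phi> (\<omega>, Pc \<omega> \<xi>)" by (simp add: x_def Pc_VI_0[OF \<omega>])
  finally show ?thesis .
qed

lemma LP_VI: "\<omega> \<in> space M \<Longrightarrow> LP VI t \<omega> \<xi> = VI t \<omega> \<xi>"
  using VI_decomposition[of \<omega> t \<xi>] Y_VI[of "\<theta> t \<omega>" "X VI t \<omega> \<xi>"]
    Pc_X[OF VI_lipschitz_flow, of \<omega> t \<xi>] by (simp add: LP_def Pc_VI(2))

text \<open>The section is recovered from its orbits by \<open>Y\<close>, and these are the unique
  fixed point. Extensionality settles the values outside the domain.\<close>

lemma invariant_section_eq:
  assumes V: "lipschitz_flow V" and fp: "\<And>t \<omega> \<xi>. \<omega> \<in> space M \<Longrightarrow> LP V t \<omega> \<xi> = V t \<omega> \<xi>"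
  shows "\<phi> = restrict (\<lambda>(\<omega>, \<xi>). Y V \<omega> \<xi>) (SIGMA \<omega>:space M. range (Pc \<omega>))"
proof
  fix z
  show "\<phi> z = restrict (\<lambda>(\<omega>, \<xi>). Y V \<omega> \<xi>) (SIGMA \<omega>:space M. range (Pc \<omega>)) z"
  proof (cases "z \<in> (SIGMA \<omega>:space M. range (Pc \<omega>))")
    case True
    then obtain \<omega> \<xi> where z: "z = (\<omega>, \<xi>)" "\<omega> \<in> space M" "\<xi> \<in> range (Pc \<omega>)" by auto
    have "(\<lambda>r. VI r \<omega> \<xi>) = (\<lambda>r. V r \<omega> \<xi>)"
      using LP_fixed_point_unique[OF VI_lipschitz_flow V LP_VI fp z(2)] by auto
    then have "Y VI \<omega> \<xi> = Y V \<omega> \<xi>" by (simp add: Y_def)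
    then show ?thesis using Y_VI[OF z(2), of \<xi>] Pc_section(2)[OF z(2,3)] z by auto
  next
    case False
    moreover have "\<phi> \<in> extensional (SIGMA \<omega>:space M. range (Pc \<omega>))"
      using sec by (simp add: lipschitz_sections_def)
    ultimately show ?thesis using extensional_arb[of \<phi> _ z] by (simp add: restrict_def)
  qed
qed

end

section \<open>Existence and uniqueness of the invariant section\<close>

lemma unique_invariant_section:
  "\<exists>\<phi>. \<phi> \<in> lipschitz_sections M Pc Ps Pu N \<and> invariant_section M \<theta> \<Psi> Pc \<phi> \<and>
    (\<forall>\<phi>'. \<phi>' \<in> lipschitz_sections M Pc Ps Pu N \<and> invariant_section M \<theta> \<Psi> Pc \<phi>' \<longrightarrow> \<phi>' = \<phi>) \<and>
    (\<forall>t. \<forall>\<omega>\<in>space M. \<forall>\<xi>\<in>range (Pc \<omega>). \<forall>\<xi>'\<in>range (Pc \<omega>).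
      norm (\<Psi> t \<omega> (\<xi> + \<phi> (\<omega>, \<xi>)) - \<Psi> t \<omega> (\<xi>' + \<phi> (\<omega>, \<xi>'))) \<le> L * \<alpha>c t \<omega> * norm (\<xi> - \<xi>'))"
proof -
  obtain V where mV: "measurable_flow V" and fp: "\<And>t \<omega> \<xi>. \<omega> \<in> space M \<Longrightarrow> LP V t \<omega> \<xi> = V t \<omega> \<xi>"
    using LP_fixed_point_exists by metis
  have V: "lipschitz_flow V" using mV by (simp add: measurable_flow_def)
  define \<phi> where "\<phi> = restrict (\<lambda>(\<omega>, \<xi>). Y V \<omega> \<xi>) (SIGMA \<omega>:space M. range (Pc \<omega>))"
  have \<phi>: "\<phi> (\<omega>, \<xi>) = Y V \<omega> \<xi>" if "\<omega> \<in> space M" "\<xi> \<in> range (Pc \<omega>)" for \<omega> \<xi>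
    using that by (simp add: \<phi>_def)
  have Pc_range: "Pc \<omega> \<xi> = \<xi>" if "\<omega> \<in> space M" "\<xi> \<in> range (Pc \<omega>)" for \<omega> \<xi>
    using that Pc_facts(1) by auto
  \<comment> \<open>Uniqueness of mild solutions identifies the fixed point with the orbits of
    \<Psi>; invariance and the final estimate are then properties of \<open>V\<close>.\<close>
  have PsiV: "\<Psi> t \<omega> (\<xi> + \<phi> (\<omega>, \<xi>)) = V t \<omega> \<xi>" if "\<omega> \<in> space M" "\<xi> \<in> range (Pc \<omega>)" for t \<omega> \<xi>
    using fun_cong[OF unique[OF that(1) fixed_point_mild_solution[OF V fp that(1), of \<xi>]], of t]
    unfolding \<phi>[OF that] Pc_range[OF that] by simp
  have "\<phi> \<in> lipschitz_sections M Pc Ps Pu N"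
    unfolding lipschitz_sections_def
  proof (rule CollectI, intro conjI allI ballI)
    show "\<phi> \<in> extensional (SIGMA \<omega>:space M. range (Pc \<omega>))" by (simp add: \<phi>_def)
    fix x
    have "bochner_measurable M (\<lambda>\<omega>. Y V \<omega> (Pc \<omega> x))"
      by (rule measurable_Y[OF mV measurable_ident measurable_family[OF invariant_families(1)
              measurable_ident bochner_measurable_const], unfolded id_def])
    then show "bochner_measurable M (\<lambda>\<omega>. \<phi> (\<omega>, Pc \<omega> x))"
      using bochner_measurable_cong[of M "\<lambda>\<omega>. \<phi> (\<omega>, Pc \<omega> x)" "\<lambda>\<omega>. Y V \<omega> (Pc \<omega> x)"] by (simp add: \<phi>)
  next
    fix \<omega> assume \<omega>: "\<omega> \<in> space M"
    have "0 \<in> range (Pc \<omega>)" using Pc_facts(2)[OF \<omega>] by (metis rangeI)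
    then show "\<phi> (\<omega>, 0) = 0" by (simp add: \<phi>[OF \<omega>] XY_0[OF V \<omega>])
    fix \<xi> assume \<xi>: "\<xi> \<in> range (Pc \<omega>)"
    let ?s = "integral {..0} (G Ps \<omega> 0 (\<lambda>r. V r \<omega> \<xi>))" and ?u = "integral {0..} (G Pu \<omega> 0 (\<lambda>r. V r \<omega> \<xi>))"
    have "?s = Ps \<omega> ?s" "- ?u = Pu \<omega> (- ?u)"
      using Y_components[OF V \<omega>, of \<xi>] linear_neg[OF bounded_linear.linear[OF P_projections(2)[of Pu, OF _ \<omega>]]]
      by simp_all
    then have "?s \<in> range (Ps \<omega>)" "- ?u \<in> range (Pu \<omega>)" by (metis rangeI)+
    moreover have "\<phi> (\<omega>, \<xi>) = ?s + - ?u" by (simp add: \<phi>[OF \<omega> \<xi>] Y_def Ksu_def)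
    ultimately show "\<phi> (\<omega>, \<xi>) \<in> {y + z |y z. y \<in> range (Ps \<omega>) \<and> z \<in> range (Pu \<omega>)}" by blast
    fix \<xi>' assume \<xi>': "\<xi>' \<in> range (Pc \<omega>)"
    show "norm (\<phi> (\<omega>, \<xi>) - \<phi> (\<omega>, \<xi>')) \<le> N * norm (\<xi> - \<xi>')"
      using Y_lipschitz[OF V \<omega>, of \<xi> \<xi>'] 
      by (simp add: \<phi>[OF \<omega> \<xi>] \<phi>[OF \<omega> \<xi>'] Pc_facts(4)[OF \<omega>] Pc_range[OF \<omega> \<xi>] Pc_range[OF \<omega> \<xi>'])
  qed
  moreover have "invariant_section M \<theta> \<Psi> Pc \<phi>"
    unfolding invariant_section_def
  proof (intro allI ballI subsetI)
    fix t \<omega> z assume \<omega>: "\<omega> \<in> space M" and "z \<in> \<Psi> t \<omega> ` section_graph Pc \<phi> \<omega>"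
    then obtain \<xi> where \<xi>: "\<xi> \<in> range (Pc \<omega>)" "z = V t \<omega> \<xi>"
      using PsiV[OF \<omega>] by (auto simp: section_graph_def)
    \<comment> \<open>The centre part is the new base point, and the fixed-point equation is
      precisely membership in the graph over it.\<close>
    have r: "X V t \<omega> \<xi> \<in> range (Pc (\<theta> t \<omega>))" using Pc_X[OF V \<omega>, of t \<xi>] by (metis rangeI)
    have "z = X V t \<omega> \<xi> + \<phi> (\<theta> t \<omega>, X V t \<omega> \<xi>)"
      using fp[OF \<omega>, of t \<xi>] r \<omega> by (simp add: \<xi>(2) LP_def \<phi>)
    then show "z \<in> section_graph Pc \<phi> (\<theta> t \<omega>)" using r unfolding section_graph_def by blast
  qed
  moreover have "\<phi>' = \<phi>"
    if "\<phi>' \<in> lipschitz_sections M Pc Ps Pu N \<and> invariant_section M \<theta> \<Psi> Pc \<phi>'" for \<phi>'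
    using invariant_section_eq[OF _ _ V fp] that unfolding \<phi>_def by blast
  moreover have "norm (\<Psi> t \<omega> (\<xi> + \<phi> (\<omega>, \<xi>)) - \<Psi> t \<omega> (\<xi>' + \<phi> (\<omega>, \<xi>'))) \<le> L * \<alpha>c t \<omega> * norm (\<xi> - \<xi>')"
    if "\<omega> \<in> space M" "\<xi> \<in> range (Pc \<omega>)" "\<xi>' \<in> range (Pc \<omega>)" for t \<omega> \<xi> \<xi>'
    using lipschitz_flowD(2)[OF V that(1), of t \<xi> \<xi>']
    by (simp add: PsiV[OF that(1,2)] PsiV[OF that(1,3)] Pc_facts(4)[OF that(1)] Pc_range[OF that(1,2)]
        Pc_range[OF that(1,3)])
  ultimately show ?thesis by blast
qed

end

section \<open>Passage to real constants\<close>

text \<open>A third of the slack is added to each constant, which makes both positive and keeps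
  their sum below 1/2.\<close>

lemma real_bounds_of_sum_less_half:
  fixes s t :: ennreal
  assumes "s + t < 1 / 2"
  obtains \<sigma> \<tau> :: real where "0 < \<sigma>" "0 < \<tau>" "\<sigma> + \<tau> < 1 / 2" "s \<le> ennreal \<sigma>" "t \<le> ennreal \<tau>"
proof -
  have half: "(1 / 2 :: ennreal) = ennreal (1 / 2)" 
    by (metis divide_ennreal ennreal_1 ennreal_numeral zero_le_one zero_less_numeral)
  have "s + t < top" using assms by (metis half ennreal_less_top order_less_trans)
  then have st: "s = ennreal (enn2real s)" "t = ennreal (enn2real t)" by auto
  define a b where "a = enn2real s" and "b = enn2real t"
  have ab: "0 \<le> a" "0 \<le> b" by (simp_all add: a_def b_def)
  have "ennreal (a + b) < ennreal (1 / 2)"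
    using assms st ab unfolding half a_def b_def by (simp add: ennreal_plus)
  from iffD1[OF ennreal_less_iff this] have lt: "a + b < 1 / 2" using ab by simp
  define e where "e = (1 / 2 - (a + b)) / 3"
  have e: "0 < e" "a + b + 2 * e < 1 / 2" using lt by (auto simp: e_def field_simps)
  show thesis
  proof (rule that[of "a + e" "b + e"])
    show "s \<le> ennreal (a + e)" "t \<le> ennreal (b + e)"
      using st e ab by (metis a_def b_def ennreal_leI less_add_same_cancel1 less_imp_le)+
  qed (use e ab in auto)
qed

theorem theorem3p1:
  fixes M :: "'w measure"
    and \<theta> :: "real \<Rightarrow> 'w \<Rightarrow> 'w"
    and \<Phi> \<Psi> :: "real \<Rightarrow> 'w \<Rightarrow> 'x \<Rightarrow> 'x::banach"
    and \<alpha>c \<alpha>s \<alpha>u :: "real \<Rightarrow> 'w \<Rightarrow> real"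
    and Pc Ps Pu f :: "'w \<Rightarrow> 'x \<Rightarrow> 'x"
  assumes "measure_preserving_ds M \<theta>"
    and "bochner_linear_rds M \<theta> \<Phi>"
    and "trichotomy M \<theta> \<Phi> \<alpha>c \<alpha>s \<alpha>u Pc Ps Pu"
    and "f \<in> perturbations M \<theta> \<alpha>c \<alpha>s \<alpha>u"
    and "bochner_rds M \<theta> \<Psi>"
    and "\<And>\<omega> x. \<omega> \<in> space M \<Longrightarrow> mild_solution \<theta> \<Phi> f \<omega> x (\<lambda>t. \<Psi> t \<omega> x)"
    and "\<And>\<omega> x u. \<omega> \<in> space M \<Longrightarrow> mild_solution \<theta> \<Phi> f \<omega> x u \<Longrightarrow> u = (\<lambda>t. \<Psi> t \<omega> x)"
    and "\<And>\<omega>. \<omega> \<in> space M \<Longrightarrow> ((\<lambda>t. \<alpha>s (- t) (\<theta> t \<omega>) * \<alpha>c t \<omega>) \<longlongrightarrow> 0) at_bot"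
    and "\<And>\<omega>. \<omega> \<in> space M \<Longrightarrow> ((\<lambda>t. \<alpha>u (- t) (\<theta> t \<omega>) * \<alpha>c t \<omega>) \<longlongrightarrow> 0) at_top"
    and "sigma_const M \<theta> \<alpha>c f + tau_const M \<theta> \<alpha>c \<alpha>s \<alpha>u f < 1 / 2"
  shows "\<exists>N::real. 0 < N \<and> N < 1 \<and>
    (\<exists>\<phi>. \<phi> \<in> lipschitz_sections M Pc Ps Pu N \<and> invariant_section M \<theta> \<Psi> Pc \<phi> \<and>
       (\<forall>\<phi>'. \<phi>' \<in> lipschitz_sections M Pc Ps Pu N \<and> invariant_section M \<theta> \<Psi> Pc \<phi>' \<longrightarrow> \<phi>' = \<phi>) \<and>
       (\<forall>t. \<forall>\<omega>\<in>space M. \<forall>\<xi>\<in>range (Pc \<omega>). \<forall>\<xi>'\<in>range (Pc \<omega>).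
          ennreal (norm (\<Psi> t \<omega> (\<xi> + \<phi> (\<omega>, \<xi>)) - \<Psi> t \<omega> (\<xi>' + \<phi> (\<omega>, \<xi>'))))
            \<le> ennreal N / tau_const M \<theta> \<alpha>c \<alpha>s \<alpha>u f *
               ennreal (\<alpha>c t \<omega>) * ennreal (norm (\<xi> - \<xi>'))))"
proof -
  let ?\<tau> = "tau_const M \<theta> \<alpha>c \<alpha>s \<alpha>u f"
  obtain \<sigma> \<tau> where st: "0 < \<sigma>" "0 < \<tau>" "\<sigma> + \<tau> < 1 / 2"
    and le: "sigma_const M \<theta> \<alpha>c f \<le> ennreal \<sigma>" "?\<tau> \<le> ennreal \<tau>"
    using real_bounds_of_sum_less_half[OF assms(10)] by metis
  obtain N L where NL: "0 < N" "N < 1" "0 < L" "L = (1 + N) * (1 + \<sigma> * L)" "\<tau> * L \<le> N"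
    "(1 + N) * \<sigma> + (1 + \<sigma> * L) * \<tau> < 1"
    using contraction_constants[OF st] by metis
  interpret perturbed_trichotomy M \<theta> \<Phi> \<alpha>c \<alpha>s \<alpha>u Pc Ps Pu f \<sigma> \<tau> N L \<Psi>
    by unfold_locales (fact assms le st NL)+
  \<comment> \<open>The estimate is proved with \<open>L\<close>. From
    \<open>\<tau> * L \<le> N\<close> for the enlarged \<tau> follows the same for the true
    constant; if that is 0, the quotient is infinite because \<open>N\<close> is positive.\<close>
  have LN: "ennreal L \<le> ennreal N / ?\<tau>"
  proof (cases "?\<tau> = 0")
    case True
    then show ?thesis using NL(1) by simp
  next
    case False
    define T where "T = enn2real ?\<tau>"
    have "?\<tau> < top" using le(2) by (rule le_less_trans) simp
    then have T: "?\<tau> = ennreal T" by (simp add: T_def)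
    have "0 < T" using False T by (metis T_def enn2real_nonneg ennreal_0 order_le_less)
    moreover have "T \<le> \<tau>" using le(2) st(2) by (simp add: T ennreal_le_iff)
    then have "T * L \<le> N"
      using mult_right_mono[of T \<tau> L] NL by linarith
    ultimately show ?thesis
      using NL by (simp add: T divide_ennreal le_divide_eq mult.commute ennreal_leI)
  qed
  have lift: "ennreal y \<le> ennreal N / ?\<tau> * ennreal (\<alpha>c t \<omega>) * ennreal z"
    if "y \<le> L * \<alpha>c t \<omega> * z" "\<omega> \<in> space M" "0 \<le> z" for y z t \<omega>
  proof -
    have "ennreal y \<le> ennreal (L * \<alpha>c t \<omega> * z)" by (rule ennreal_leI[OF that(1)])
    also have "\<dots> = ennreal L * ennreal (\<alpha>c t \<omega>) * ennreal z"
      using NL ac_pos[OF that(2), of t] that(3) by (simp add: ennreal_mult)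
    also have "\<dots> \<le> ennreal N / ?\<tau> * ennreal (\<alpha>c t \<omega>) * ennreal z"
      by (intro mult_right_mono LN) auto
    finally show ?thesis .
  qed
  obtain \<phi> where \<phi>: "\<phi> \<in> lipschitz_sections M Pc Ps Pu N" "invariant_section M \<theta> \<Psi> Pc \<phi>"
    "\<forall>\<phi>'. \<phi>' \<in> lipschitz_sections M Pc Ps Pu N \<and> invariant_section M \<theta> \<Psi> Pc \<phi>' \<longrightarrow> \<phi>' = \<phi>"
    "\<forall>t. \<forall>\<omega>\<in>space M. \<forall>\<xi>\<in>range (Pc \<omega>). \<forall>\<xi>'\<in>range (Pc \<omega>).
      norm (\<Psi> t \<omega> (\<xi> + \<phi> (\<omega>, \<xi>)) - \<Psi> t \<omega> (\<xi>' + \<phi> (\<omega>, \<xi>'))) \<le> L * \<alpha>c t \<omega> * norm (\<xi> - \<xi>')"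
    using unique_invariant_section by (elim exE conjE)
  show ?thesis
    by (intro exI[of _ N] exI[of _ \<phi>] conjI NL \<phi>(1-3) allI ballI lift) (use \<phi>(4) in auto)
qed

end
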